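(* There exists a constant $\delta_0 \in (0, \frac12)$ with the following property. If $f$ is a transcendental entire function whose order $\rho(f)$ satisfies $\rho(f) < \frac12 + \delta_0$, then the function $$G(z) = \frac{\Delta f(z)}{f(z)} = \frac{f(z+1)-f(z)}{f(z)}$$ has infinitely many zeros.
   Context: The order of an entire function $f$ is $\rho(f) = \limsup_{r\to\infty} \frac{\log\log M(r,f)}{\log r}$ where $M(r,f)=\max_{|z|=r}|f(z)|$. *)

theory Defs
  imports "HOL-Complex_Analysis.Complex_Analysis" "HOL-Library.Extended_Real" "HOL-Library.Liminf_Limsup"
begin

definition max_modulus :: "(complex \<Rightarrow> complex) \<Rightarrow> real \<Rightarrow> real" where
  "max_modulus f r = Sup ((\<lambda>z. norm (f z)) ` sphere 0 r)"

definition entire_order :: "(complex \<Rightarrow> complex) \<Rightarrow> ereal" where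
  "entire_order f = Limsup at_top (\<lambda>r::real. ereal (ln (ln (max_modulus f r)) / ln r))"

definition transcendental_entire :: "(complex \<Rightarrow> complex) \<Rightarrow> bool" where
  "transcendental_entire f \<longleftrightarrow> f holomorphic_on UNIV \<and> \<not> (\<exists>p. \<forall>z. f z = poly p z)"

text \<open>Zeros of the meromorphic function G: points where G tends to 0 (so removable
  singularities at common zeros are handled as for the meromorphic function).\<close>
definition mero_zeros :: "(complex \<Rightarrow> complex) \<Rightarrow> complex set" where
  "mero_zeros G = {z. (G \<longlongrightarrow> 0) (at z)}"

end

theory Submission
  imports Defs "HOL-Real_Asymp.Real_Asymp"
begin

text \<open>
  Suppose that \<open>G = \<Delta>f / f\<close> has finitely many zeros. By Hadamard's theorem in genus 0, both \<open>f\<close> and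
  \<open>\<Delta>f\<close> are products over their zeros, so \<open>1 / G\<close> is, up to a rational factor, the product over the
  zeros of \<open>f\<close> that \<open>\<Delta>f\<close> does not cancel; hence \<open>u = - ln \<bar>G\<bar>\<close> is essentially a sum of
  \<open>ln \<bar>1 - z / a\<bar>\<close>.

  On a circle \<open>\<bar>z\<bar> = r\<close> away from the zeros of \<open>f\<close>, integrating \<open>L = log (f (z + 1) / f z) = log (1 + G)\<close>
  gives \<open>2 \<pi> i\<close> times the number \<open>n r\<close> of zeros of \<open>f\<close> inside. As \<open>L\<close> is tiny where \<open>G\<close> is,
  every such circle carries points where \<open>u \<le> O (ln r)\<close>; and if these points all lie in a short arc,
  then \<open>n r\<close> is small compared with \<open>J r = \<Sum> min 1 (r / \<bar>a\<bar>)\<close>.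

  The first fact makes \<open>F r = r powr (- 1/2) * \<Sum> \<phi> (r / \<bar>a\<bar>)\<close> almost nondecreasing, because \<open>\<phi>\<close> is
  chosen such that \<open>r F' r = - r powr (- 1/2) * \<Sum> ln \<bar>1 - r / \<bar>a\<bar>\<bar>\<close> (Kjellberg's proof of the
  \<open>cos \<pi>\<rho>\<close> theorem). If the points with \<open>u \<le> O (ln r)\<close> do not fit into a short arc, then \<open>F\<close> even
  grows like a fixed positive power; otherwise \<open>J\<close> grows almost like \<open>r\<close>, since
  \<open>r J' r = J r - n r\<close>. So for a suitable constant \<open>p\<close> the function \<open>F powr p * J\<close> grows at least like
  \<open>r powr (7/10)\<close>, whereas order below \<open>1/2 + \<delta>0\<close> bounds it by \<open>r powr (1/2 + O (\<delta>0))\<close>.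
\<close>

section \<open>Hadamard products of genus 0\<close>

text \<open>Neither factor suffices alone: \<open>F\<close> may stay almost constant when the order
  is near 1/2, and \<open>J\<close> is controlled only while the points with small \<open>u\<close>
  lie in a short arc. Their combination works because every circle makes one factor grow by more
  than the other can lose. The power is \<open>p = 2 * C\<close>, with \<open>C\<close> from
  comparing \<open>\<phi>\<close> with the gain at two separated points; \<open>\<delta>0\<close> is
  then of size \<open>1 / C\<close>. The logarithmic derivative of the combination is at least 3/4,
  and 7/10 leaves slack. \<open>J\<close> runs over all zeros of \<open>f\<close>, since
  \<open>n r\<close> counts them all, but \<open>F\<close> only over the uncancelled ones, since
  only these enter \<open>u\<close>. If the latter are finite in number, \<open>1 / G\<close> is
  rational and \<open>F\<close> carries no information; this case is settled by the behaviour of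
  \<open>G\<close> at infinity. The obstacle is a circle passing close to a zero, where
  \<open>L\<close> is out of control. Such circles cannot be discarded, because a differential
  inequality is needed at all but isolated radii; instead they are made to contribute growth of
  their own.\<close>

lemma Borel_Caratheodory_ball:
  fixes l :: "complex \<Rightarrow> complex"
  assumes hol: "l holomorphic_on ball 0 R" and R: "R > 0" and B: "B > 0" and l0: "l 0 = 0"
    and Re: "\<And>z. norm z < R \<Longrightarrow> Re (l z) < B" and z: "norm z < R"
  shows "norm (l z) \<le> 2 * B * norm z / (R - norm z)"
proof -
  \<comment> \<open>The Moebius map \<open>v / (2 * B - v)\<close> takes the half-plane
    \<open>Re v < B\<close> into the unit disc and fixes 0, so the Schwarz lemma applies after
    rescaling.\<close>
  define p where "p w = l (R * w) / (2 * B - l (R * w))" for w :: complex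
  have nz: "2 * B - l (R * w) \<noteq> 0" and lt: "norm (l (R * w)) < norm (2 * B - l (R * w))"
    if "norm w < 1" for w :: complex
  proof -
    have "norm (R * w) < R"
      using that R by (simp add: norm_mult)
    from Re[OF this] have r: "Re (l (R * w)) < B" .
    show "2 * B - l (R * w) \<noteq> 0"
      using r B by (auto simp: complex_eq_iff)
    have "4 * B * (B - Re (l (R * w))) > 0" using r B by simp
    hence "(norm (l (R * w)))\<^sup>2 < (norm (2 * B - l (R * w)))\<^sup>2"
      unfolding cmod_power2 by (simp add: power2_eq_square algebra_simps)
    thus "norm (l (R * w)) < norm (2 * B - l (R * w))"
      by (rule power_less_imp_less_base) auto
  qed
  have holp: "p holomorphic_on ball 0 1"
    unfolding p_def
    by (intro holomorphic_intros holomorphic_on_compose_gen[OF _ hol, unfolded o_def])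
       (use nz R in \<open>auto simp: norm_mult\<close>)
  have p0: "p 0 = 0" by (simp add: p_def l0)
  have pl: "norm (p w) < 1" if "norm w < 1" for w
    unfolding p_def norm_divide using nz[OF that] lt[OF that] by (simp add: divide_simps)
  define w where "w = z / R"
  have w: "norm w < 1" using z R by (simp add: w_def norm_divide)
  have Rw: "R * w = z" using R by (simp add: w_def)
  have s: "norm (p w) \<le> norm w"
    using Schwarz_Lemma(1)[OF holp p0 pl w] by simp
  have eq: "l z * (1 + p w) = 2 * B * p w"
    using nz[OF w] unfolding p_def Rw by (simp add: field_simps)
  have "norm (l z) * (1 - norm w) \<le> norm (l z) * norm (1 + p w)"
    using s norm_triangle_ineq2[of 1 "- p w"] by (intro mult_left_mono) auto
  also have "\<dots> = 2 * B * norm (p w)"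
    using arg_cong[OF eq, of norm] B by (simp add: norm_mult)
  also have "\<dots> \<le> 2 * B * norm w" using s B by simp
  finally have "norm (l z) * (1 - norm w) \<le> 2 * B * norm w" .
  hence "R * (norm (l z) * (1 - norm w)) \<le> R * (2 * B * norm w)" using R by simp
  moreover have "R * norm w = norm z" using R by (simp add: w_def norm_divide)
  ultimately have "norm (l z) * (R - norm z) \<le> 2 * B * norm z"
    by (metis (no_types, opaque_lifting) mult.assoc mult.commute mult.right_neutral right_diff_distrib)
  thus ?thesis using z by (simp add: field_simps)
qed

text \<open>A zero sequence lists the reciprocals of the zeros with multiplicity and may be padded with
  \<open>0\<close>, which stands for a zero at infinity.\<close>
definition zero_seq :: "(complex \<Rightarrow> complex) \<Rightarrow> (nat \<Rightarrow> complex) \<Rightarrow> bool" where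
  "zero_seq g b \<longleftrightarrow>
     (\<forall>w. w \<noteq> 0 \<longrightarrow> finite {k. b k = w} \<and> int (card {k. b k = w}) = zorder g (1 / w))"

text \<open>A nonzero entry is the reciprocal of a genuine zero, because the order there equals a
  positive cardinality; the compact disc of radius \<open>R\<close> holds finitely many zeros, each
  listed finitely often.\<close>

lemma zero_seq_finite:
  assumes hol: "g holomorphic_on UNIV" and g0: "g 0 \<noteq> 0" and b: "zero_seq g b" and R: "R > 0"
  shows "finite {k. norm (b k) \<ge> 1 / R}"
proof -
  have fin: "finite {z \<in> cball 0 R. g z = 0}"
  proof (cases "g constant_on UNIV")
    case True
    hence "{z \<in> cball 0 R. g z = 0} = {}" using g0 by (auto simp: constant_on_def)
    thus ?thesis by (metis finite.emptyI)
  next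
    case False
    thus ?thesis
      using holomorphic_compact_finite_zeros[of g UNIV "cball 0 R"] hol by (auto simp: connected_UNIV)
  qed
  have "{k. norm (b k) \<ge> 1 / R} \<subseteq> (\<Union>z\<in>{z \<in> cball 0 R. g z = 0}. {k. b k = 1 / z} \<inter> {k. b k \<noteq> 0})"
  proof
    fix k assume k: "k \<in> {k. norm (b k) \<ge> 1 / R}"
    define w where "w = b k"
    have w: "w \<noteq> 0" using k R by (auto simp: w_def not_le)
    have "finite {k. b k = w}" "k \<in> {k. b k = w}"
      using b w by (auto simp: zero_seq_def w_def)
    hence "card {k. b k = w} > 0" by (auto simp: card_gt_0_iff)
    hence "zorder g (1 / w) \<noteq> 0" using b w by (auto simp: zero_seq_def)
    hence "g (1 / w) = 0"
      using zorder_eq_0I[of g "1 / w"] hol by (auto simp: analytic_on_open analytic_at)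
    moreover have "norm (1 / w) \<le> R"
      using k w R by (auto simp: w_def norm_divide field_simps)
    ultimately show "k \<in> (\<Union>z\<in>{z \<in> cball 0 R. g z = 0}. {k. b k = 1 / z} \<inter> {k. b k \<noteq> 0})"
      using w by (auto simp: w_def intro!: bexI[of _ "1 / w"])
  qed
  moreover have "finite ({k. b k = 1 / z} \<inter> {k. b k \<noteq> 0})" for z
  proof (cases "z = 0")
    case True
    have "{k. b k = 1 / z} \<inter> {k. b k \<noteq> 0} = {}" using True by auto
    thus ?thesis by simp
  next
    case False
    thus ?thesis using b by (auto simp: zero_seq_def)
  qed
  ultimately show ?thesis using fin by (meson finite_UN_I finite_subset)
qed

lemma zorder_linear_factor:
  fixes b z :: complex
  shows "zorder (\<lambda>z. 1 - b * z) z = (if b * z = 1 then 1 else 0)"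
proof (cases "b * z = 1")
  case False
  thus ?thesis by (auto intro!: zorder_eq_0I analytic_intros)
next
  case True
  hence b: "b \<noteq> 0" by auto
  have "zorder (\<lambda>z. 1 - b * z) z = 1"
    by (rule zorder_eqI[of UNIV _ "\<lambda>_. - b"]) (use True b in \<open>auto simp: algebra_simps\<close>)
  thus ?thesis using True by simp
qed

text \<open>All zeros up to radius \<open>4 * R\<close> are divided out by comparing orders, and the
  factors belonging to zeros beyond \<open>R\<close> are then multiplied back into \<open>q\<close>.
  So \<open>q\<close> is zero-free where a logarithm is needed, while the remaining product has only
  zeros well inside the circle of radius \<open>3 * R\<close>.\<close>

lemma zero_seq_factor:
  assumes hol: "g holomorphic_on UNIV" and g0: "g 0 \<noteq> 0" and b: "zero_seq g b" and R: "R > 0"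
  obtains q where "q holomorphic_on ball 0 (4 * R)"
    "\<And>z. norm z < 4 * R \<Longrightarrow> g z = q z * (\<Prod>k\<in>{k. norm (b k) \<ge> 1 / R}. 1 - b k * z)"
    "\<And>z. norm z < R \<Longrightarrow> q z \<noteq> 0"
proof -
  define S where "S = {k. norm (b k) \<ge> 1 / (4 * R)}"
  define T where "T = {k. norm (b k) \<ge> 1 / R}"
  define P where "P z = (\<Prod>k\<in>S. 1 - b k * z)" for z
  have finS: "finite S" unfolding S_def using zero_seq_finite[OF hol g0 b, of "4 * R"] R by simp
  have TS: "T \<subseteq> S" unfolding S_def T_def using R by (auto simp: field_simps)
  have zo: "zorder P z = zorder g z" and ze: "P z = 0 \<longleftrightarrow> g z = 0" if z: "norm z < 4 * R" for z
  proof -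
    have ev: "eventually (\<lambda>w. P w \<noteq> 0) (at z)"
    proof -
      have "P holomorphic_on UNIV" unfolding P_def by (intro holomorphic_intros)
      moreover have "P 0 \<noteq> 0" by (simp add: P_def)
      ultimately have "eventually (\<lambda>w. P w \<noteq> 0 \<and> w \<in> UNIV) (at z)"
        by (intro non_zero_neighbour_alt[of _ _ _ 0]) auto
      thus ?thesis by simp
    qed
    have "zorder P z = (\<Sum>k\<in>S. zorder (\<lambda>z. 1 - b k * z) z)"
      unfolding P_def by (rule zorder_prod_analytic) (use ev in \<open>auto simp: P_def intro!: analytic_intros\<close>)
    also have "\<dots> = int (card {k\<in>S. b k * z = 1})"
      using finS by (simp add: zorder_linear_factor sum.If_cases Int_def)
    also have "\<dots> = zorder g z"
    proof (cases "z = 0")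
      case True
      thus ?thesis using zorder_eq_0I[of g 0] g0 hol by (auto simp: analytic_on_open analytic_at)
    next
      case False
      have "{k\<in>S. b k * z = 1} = {k. b k = 1 / z}"
      proof (intro Collect_cong iffI)
        fix k assume k: "b k = 1 / z"
        have "1 / (4 * R) \<le> 1 / norm z"
          using False z R by (intro divide_left_mono) auto
        thus "k \<in> S \<and> b k * z = 1"
          using False k by (simp add: S_def norm_divide)
      qed (use False in \<open>auto simp: field_simps\<close>)
      thus ?thesis using b False by (auto simp: zero_seq_def)
    qed
    finally show zo: "zorder P z = zorder g z" .
    have evg: "eventually (\<lambda>w. g w \<noteq> 0) (at z)"
      using non_zero_neighbour_alt[of g UNIV z 0] hol g0 by auto
    have "zorder P z = 0 \<longleftrightarrow> P z \<noteq> 0"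
      by (rule zorder_eq_0_iff)
         (use ev in \<open>auto intro!: analytic_intros eventually_frequently simp: P_def[abs_def]\<close>)
    moreover have "zorder g z = 0 \<longleftrightarrow> g z \<noteq> 0"
      by (rule zorder_eq_0_iff)
         (use evg hol in \<open>auto intro!: eventually_frequently simp: analytic_at\<close>)
    ultimately show "P z = 0 \<longleftrightarrow> g z = 0" using zo by auto
  qed
  obtain h where h: "h holomorphic_on ball 0 (4 * R)" "\<And>z. z \<in> ball 0 (4 * R) \<Longrightarrow> h z \<noteq> 0"
      "\<And>z. z \<in> ball 0 (4 * R) \<Longrightarrow> g z = h z * P z"
    by (rule holomorphic_zorder_factorization[of g "ball 0 (4 * R)" P])
       (use zo ze hol in \<open>auto simp: P_def[abs_def] intro!: holomorphic_intros intro: holomorphic_on_subset\<close>)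
  show thesis
  proof (rule that[of "\<lambda>z. h z * (\<Prod>k\<in>S - T. 1 - b k * z)"])
    show "(\<lambda>z. h z * (\<Prod>k\<in>S - T. 1 - b k * z)) holomorphic_on ball 0 (4 * R)"
      by (intro holomorphic_intros h)
    show "g z = h z * (\<Prod>k\<in>S - T. 1 - b k * z) * (\<Prod>k\<in>{k. norm (b k) \<ge> 1 / R}. 1 - b k * z)"
      if "norm z < 4 * R" for z
      using h(3)[of z] that prod.subset_diff[OF TS finS, of "\<lambda>k. 1 - b k * z"]
      by (simp add: P_def flip: T_def)
    show "h z * (\<Prod>k\<in>S - T. 1 - b k * z) \<noteq> 0" if z: "norm z < R" for z
    proof -
      have "1 - b k * z \<noteq> 0" if "k \<in> S - T" for k
      proof
        assume "1 - b k * z = 0"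
        hence "norm (b k) * norm z = 1" by (metis eq_iff_diff_eq_0 norm_mult norm_one)
        moreover have "norm (b k) < 1 / R" using that by (auto simp: T_def)
        ultimately show False
          using z R by (smt (verit) divide_pos_pos mult_nonneg_nonneg mult_strict_mono' nonzero_eq_divide_eq norm_ge_zero)
      qed
      moreover have "h z \<noteq> 0" using h(2)[of z] z R by simp
      ultimately show ?thesis using finS by (auto simp: prod_zero_iff)
    qed
  qed
qed

text \<open>Removing zeros disc by disc produces products over discs; this identifies their limit
  with that of the enumerated products. Once \<open>S m\<close> contains every \<open>k < n\<close>
  with \<open>c k \<noteq> 0\<close>, the surplus factors multiply to a number within
  \<open>exp (t n) - 1\<close> of 1, where \<open>t n\<close> is the tail of the series.\<close>

lemma prod_unordered_limit:
  fixes c :: "nat \<Rightarrow> complex"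
  assumes sm: "summable (\<lambda>k. norm (c k))"
    and S: "\<And>m. finite (S m)" "\<And>k. c k \<noteq> 0 \<Longrightarrow> eventually (\<lambda>m. k \<in> S m) sequentially"
    and lim: "(\<lambda>m. \<Prod>k\<in>S m. 1 + c k) \<longlonglongrightarrow> L"
  shows "(\<lambda>n. \<Prod>k<n. 1 + c k) \<longlonglongrightarrow> L"
proof -
  define t where "t n = (\<Sum>k. norm (c (k + n)))" for n
  have t0: "t \<longlonglongrightarrow> 0"
    unfolding t_def using suminf_exist_split2[OF sm] by simp
  have pt: "(\<Sum>k\<in>A. norm (c k)) \<le> t n" if A: "finite A" "\<And>k. k \<in> A \<Longrightarrow> k \<ge> n" for A n
  proof -
    have "(\<Sum>k\<in>A. norm (c k)) = (\<Sum>k\<in>(\<lambda>k. k - n) ` A. norm (c (k + n)))"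
      using A by (subst sum.reindex) (auto simp: inj_on_def eq_diff_iff)
    also have "\<dots> \<le> t n"
      unfolding t_def using A summable_ignore_initial_segment[OF sm] by (intro sum_le_suminf) auto
    finally show ?thesis .
  qed
  have bd: "norm (\<Prod>k\<in>A. 1 + c k) \<le> exp (\<Sum>k. norm (c k))" if "finite A" for A
  proof -
    have "norm (\<Prod>k\<in>A. 1 + c k) \<le> (\<Prod>k\<in>A. exp (norm (c k)))"
      unfolding prod_norm[symmetric]
      by (intro prod_mono) (auto intro: order_trans[OF norm_triangle_ineq] simp: exp_ge_add_one_self)
    also have "\<dots> = exp (\<Sum>k\<in>A. norm (c k))" using that by (simp add: exp_sum)
    also have "\<dots> \<le> exp (\<Sum>k. norm (c k))"
      using that sm by (simp add: sum_le_suminf)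
    finally show ?thesis .
  qed
  have key: "norm (L - (\<Prod>k<n. 1 + c k)) \<le> exp (\<Sum>k. norm (c k)) * (exp (t n) - 1)" for n
  proof -
    have "eventually (\<lambda>m. \<forall>k\<in>{k. k < n \<and> c k \<noteq> 0}. k \<in> S m) sequentially"
      by (rule eventually_ball_finite) (use S(2) in auto)
    hence "eventually (\<lambda>m. norm ((\<Prod>k\<in>S m. 1 + c k) - (\<Prod>k<n. 1 + c k))
             \<le> exp (\<Sum>k. norm (c k)) * (exp (t n) - 1)) sequentially"
    proof eventually_elim
      case (elim m)
      define A where "A = {k\<in>S m. k \<ge> n}"
      have fA: "finite A" using S(1) by (simp add: A_def)
      have "(\<Prod>k\<in>S m. 1 + c k) = (\<Prod>k\<in>{k\<in>S m. k < n} \<union> A. 1 + c k)"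
        by (rule prod.cong) (auto simp: A_def)
      also have "\<dots> = (\<Prod>k\<in>{k\<in>S m. k < n}. 1 + c k) * (\<Prod>k\<in>A. 1 + c k)"
        by (rule prod.union_disjoint) (use S(1) in \<open>auto simp: A_def\<close>)
      also have "(\<Prod>k\<in>{k\<in>S m. k < n}. 1 + c k) = (\<Prod>k<n. 1 + c k)"
        by (rule prod.mono_neutral_left) (use elim in auto)
      finally have "(\<Prod>k\<in>S m. 1 + c k) - (\<Prod>k<n. 1 + c k) = (\<Prod>k<n. 1 + c k) * ((\<Prod>k\<in>A. 1 + c k) - 1)"
        by (simp add: algebra_simps)
      hence "norm ((\<Prod>k\<in>S m. 1 + c k) - (\<Prod>k<n. 1 + c k)) =
          norm (\<Prod>k<n. 1 + c k) * norm ((\<Prod>k\<in>A. 1 + c k) - 1)"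
        by (simp add: norm_mult)
      also have "\<dots> \<le> exp (\<Sum>k. norm (c k)) * (exp (t n) - 1)"
      proof (rule mult_mono)
        show "norm (\<Prod>k<n. 1 + c k) \<le> exp (\<Sum>k. norm (c k))" by (rule bd) auto
        have "norm ((\<Prod>k\<in>A. 1 + c k) - 1) \<le> (\<Prod>k\<in>A. 1 + norm (c k)) - 1"
          by (rule norm_prod_minus1_le_prod_minus1)
        also have "(\<Prod>k\<in>A. 1 + norm (c k)) \<le> (\<Prod>k\<in>A. exp (norm (c k)))"
          by (intro prod_mono) (auto simp: exp_ge_add_one_self add_nonneg_nonneg)
        also have "\<dots> = exp (\<Sum>k\<in>A. norm (c k))" using fA by (simp add: exp_sum)
        also have "\<dots> \<le> exp (t n)" using pt[OF fA, of n] by (auto simp: A_def)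
        finally show "norm ((\<Prod>k\<in>A. 1 + c k) - 1) \<le> exp (t n) - 1" by simp
      qed auto
      finally show ?case .
    qed
    thus ?thesis
      by (intro tendsto_upperbound[OF tendsto_norm[OF tendsto_diff[OF lim tendsto_const]]]) auto
  qed
  have "(\<lambda>n. exp (\<Sum>k. norm (c k)) * (exp (t n) - 1)) \<longlonglongrightarrow> exp (\<Sum>k. norm (c k)) * (exp 0 - 1)"
    by (intro tendsto_intros t0)
  hence "(\<lambda>n. exp (\<Sum>k. norm (c k)) * (exp (t n) - 1)) \<longlonglongrightarrow> 0" by simp
  hence "(\<lambda>n. L - (\<Prod>k<n. 1 + c k)) \<longlonglongrightarrow> 0"
    by (rule Lim_null_comparison[rotated]) (use key in auto)
  hence "(\<lambda>n. L - (L - (\<Prod>k<n. 1 + c k))) \<longlonglongrightarrow> L - 0" by (intro tendsto_intros)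
  thus ?thesis by simp
qed

section \<open>Zero counting and convergence of the genus 0 product\<close>

definition growth :: "real \<Rightarrow> (complex \<Rightarrow> complex) \<Rightarrow> bool" where
  "growth \<rho> g \<longleftrightarrow> (\<exists>C>0. \<forall>z. norm (g z) \<le> exp (C * (1 + norm z) powr \<rho>))"

text \<open>Jensen's inequality in maximum-principle form: on the circle of radius
  \<open>3 * R\<close> every removed factor has modulus at least 2, since
  \<open>norm (b k * w)\<close> is at least 3 there, so each zero gains a factor 2 that the maximum
  principle carries inwards.\<close>

lemma zero_seq_factor_bound:
  assumes hol: "g holomorphic_on UNIV" and g0: "g 0 \<noteq> 0" and b: "zero_seq g b" and R: "R > 0"
    and M: "\<And>z. norm z = 3 * R \<Longrightarrow> norm (g z) \<le> M"
    and q: "q holomorphic_on ball 0 (4 * R)"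
    and gq: "\<And>z. norm z < 4 * R \<Longrightarrow> g z = q z * (\<Prod>k\<in>{k. norm (b k) \<ge> 1 / R}. 1 - b k * z)"
    and z: "norm z \<le> 3 * R"
  shows "norm (q z) * 2 ^ card {k. norm (b k) \<ge> 1 / R} \<le> M"
proof -
  let ?T = "{k. norm (b k) \<ge> 1 / R}"
  have "norm (q z) \<le> M / 2 ^ card ?T"
  proof (rule maximum_modulus_frontier[of q "cball 0 (3 * R)"])
    show "q holomorphic_on interior (cball 0 (3 * R))"
      using q by (rule holomorphic_on_subset) (use R in auto)
    show "continuous_on (closure (cball 0 (3 * R))) q"
      by (rule holomorphic_on_imp_continuous_on[OF holomorphic_on_subset[OF q]]) (use R in auto)
    show "norm (q w) \<le> M / 2 ^ card ?T" if w: "w \<in> frontier (cball 0 (3 * R))" for w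
    proof -
      have nw: "norm w = 3 * R" using w R by (auto simp: frontier_cball)
      have "(2::real) ^ card ?T = (\<Prod>k\<in>?T. 2)" by simp
      also have "\<dots> \<le> (\<Prod>k\<in>?T. norm (1 - b k * w))"
      proof (rule prod_mono, safe)
        fix k assume "1 / R \<le> norm (b k)"
        hence "norm (b k * w) \<ge> 3" using R nw by (simp add: norm_mult field_simps)
        thus "2 \<le> norm (1 - b k * w)"
          using norm_triangle_ineq2[of "b k * w" 1] by (simp add: norm_minus_commute)
      qed auto
      also have "\<dots> = norm (\<Prod>k\<in>?T. 1 - b k * w)" by (simp add: prod_norm)
      finally have "norm (q w) * 2 ^ card ?T \<le> norm (g w)"
        using gq[of w] nw R by (simp add: norm_mult mult_left_mono)
      thus ?thesis using M[OF nw] by (simp add: field_simps)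
    qed
  qed (use z in auto)
  thus ?thesis by (simp add: field_simps)
qed

text \<open>At \<open>z = 0\<close> the function and its factor \<open>q\<close> agree, so the
  factor 2 per zero bounds the number of zeros by a multiple of the logarithm of the
  maximum.\<close>

lemma zero_count_bound:
  assumes hol: "g holomorphic_on UNIV" and g0: "g 0 \<noteq> 0" and b: "zero_seq g b"
    and gr: "growth \<rho> g" and \<rho>: "\<rho> > 0"
  obtains C where "C > 0" "\<And>R. R > 0 \<Longrightarrow> real (card {k. norm (b k) \<ge> 1 / R}) \<le> C * (1 + R) powr \<rho>"
proof -
  obtain C where C: "C > 0" "\<And>z. norm (g z) \<le> exp (C * (1 + norm z) powr \<rho>)"
    using gr by (auto simp: growth_def)
  define D where "D = (C * 3 powr \<rho> + \<bar>ln (norm (g 0))\<bar>) / ln 2"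
  have "D > 0" unfolding D_def using C by (intro divide_pos_pos add_pos_nonneg mult_pos_pos) auto
  moreover have "real (card {k. norm (b k) \<ge> 1 / R}) \<le> D * (1 + R) powr \<rho>" if R: "R > 0" for R
  proof -
    let ?n = "card {k. norm (b k) \<ge> 1 / R}"
    obtain q where q: "q holomorphic_on ball 0 (4 * R)"
      "\<And>z. norm z < 4 * R \<Longrightarrow> g z = q z * (\<Prod>k\<in>{k. norm (b k) \<ge> 1 / R}. 1 - b k * z)"
      "\<And>z. norm z < R \<Longrightarrow> q z \<noteq> 0"
      using zero_seq_factor[OF hol g0 b R] by blast
    have "norm (q 0) * 2 ^ ?n \<le> exp (C * (1 + 3 * R) powr \<rho>)"
    proof (rule zero_seq_factor_bound[OF hol g0 b R _ q(1,2)])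
      show "norm (g z) \<le> exp (C * (1 + 3 * R) powr \<rho>)" if "norm z = 3 * R" for z
        using C(2)[of z] that by simp
    qed (use R in auto)
    moreover have "q 0 = g 0" using q(2)[of 0] R by simp
    ultimately have "ln (norm (g 0) * 2 ^ ?n) \<le> C * (1 + 3 * R) powr \<rho>"
      using g0 by (metis exp_gt_zero exp_le_cancel_iff exp_ln mult_pos_pos zero_less_norm_iff zero_less_numeral zero_less_power)
    hence "ln (norm (g 0)) + ?n * ln 2 \<le> C * (1 + 3 * R) powr \<rho>"
      using g0 by (simp add: ln_mult ln_realpow)
    also have "(1 + 3 * R) powr \<rho> \<le> (3 * (1 + R)) powr \<rho>"
      using R \<rho> by (intro powr_mono2) auto
    also have "\<dots> = 3 powr \<rho> * (1 + R) powr \<rho>" by (rule powr_mult)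
    finally have "?n * ln 2 \<le> C * 3 powr \<rho> * (1 + R) powr \<rho> + \<bar>ln (norm (g 0))\<bar>"
      using C(1) by simp
    also have "\<dots> \<le> C * 3 powr \<rho> * (1 + R) powr \<rho> + \<bar>ln (norm (g 0))\<bar> * (1 + R) powr \<rho>"
      using R \<rho> by (intro add_left_mono mult_le_cancel_left1[THEN iffD2]) (auto simp: ge_one_powr_ge_zero)
    also have "\<dots> = (C * 3 powr \<rho> + \<bar>ln (norm (g 0))\<bar>) * (1 + R) powr \<rho>"
      by (rule distrib_right[symmetric])
    also have "\<dots> = (D * ln 2) * (1 + R) powr \<rho>" by (simp add: D_def)
    also have "\<dots> = D * (1 + R) powr \<rho> * ln 2" by simp
    finally show ?thesis by simp
  qed
  ultimately show thesis using that by blast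
qed

text \<open>Dyadic decomposition: an entry of size about \<open>2 powr (- j)\<close> contributes
  about \<open>2 powr (- j * \<sigma>)\<close>, and there are at most about
  \<open>2 powr (j * \<rho>)\<close> of them, which leaves a geometric series of ratio
  \<open>2 powr (\<rho> - \<sigma>)\<close>. The finitely many entries of norm at least 1 are set
  aside.\<close>

lemma summable_powr_from_count:
  fixes b :: "nat \<Rightarrow> complex"
  assumes fin: "\<And>R. R > 0 \<Longrightarrow> finite {k. norm (b k) \<ge> 1 / R}"
    and C: "\<And>R. R > 0 \<Longrightarrow> real (card {k. norm (b k) \<ge> 1 / R}) \<le> C * (1 + R) powr \<rho>"
    and \<rho>: "0 < \<rho>" "\<rho> < \<sigma>"
  shows "summable (\<lambda>k. norm (b k) powr \<sigma>)"
proof -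
  have C0: "C \<ge> 0" using order_trans[OF of_nat_0_le_iff C[of 1]] by (simp add: zero_le_mult_iff)
  define c where "c k = (if norm (b k) < 1 then norm (b k) powr \<sigma> else 0)" for k
  define a where "a j = C * 4 powr \<rho> * (2 powr (\<rho> - \<sigma>)) ^ j" for j :: nat
  have sa: "summable a"
    unfolding a_def using \<rho> by (intro summable_mult summable_geometric) (auto simp: powr_less_one)
  have "summable c"
  proof (rule bounded_imp_summable)
    show "c k \<ge> 0" for k by (simp add: c_def)
    show "(\<Sum>k\<le>n. c k) \<le> suminf a" for n
    proof -
      \<comment> \<open>Each entry is charged to every scale that it reaches, not only to its own,
        so that after exchanging the sums the cumulative count applies directly.\<close>
      define d where "d k j = (if norm (b k) \<ge> 1 / 2 ^ (j + 1) then 2 powr (- real j * \<sigma>) else 0)" for k j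
      have sg: "summable (\<lambda>j. 2 powr (- real j * \<sigma>))"
      proof -
        have "2 powr (- real j * \<sigma>) = (2 powr - \<sigma>) ^ j" for j
          by (simp add: powr_powr powr_realpow[symmetric] mult.commute)
        thus ?thesis using \<rho> by (simp add: powr_less_one)
      qed
      have sd: "summable (d k)" for k
        by (rule summable_comparison_test'[OF sg, of 0]) (auto simp: d_def)
      have cd: "c k \<le> suminf (d k)" for k
      proof (cases "norm (b k) < 1 \<and> b k \<noteq> 0")
        case False
        have "suminf (d k) \<ge> 0" by (rule suminf_nonneg[OF sd]) (auto simp: d_def)
        thus ?thesis using False by (auto simp: c_def)
      next
        case True
        define x where "x = norm (b k)"
        have x: "0 < x" "x < 1" using True by (auto simp: x_def)
        define j where "j = nat \<lfloor>- log 2 x\<rfloor>"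
        have l: "log 2 x < 0" using x by simp
        hence j: "real j \<le> - log 2 x" "- log 2 x < real j + 1" by (auto simp: j_def)
        have "x \<ge> 2 powr (- (real j + 1))" using j x by (simp add: le_powr_iff powr_le_iff)
        also have "2 powr (- (real j + 1)) = 1 / 2 ^ (j + 1)"
          by (subst powr_minus_divide) (metis of_nat_1 of_nat_add powr_realpow zero_less_numeral)
        finally have d: "d k j = 2 powr (- real j * \<sigma>)" by (simp add: d_def x_def)
        have "x \<le> 2 powr (- real j)" using j x by (simp add: le_powr_iff powr_le_iff)
        hence "x powr \<sigma> \<le> (2 powr (- real j)) powr \<sigma>" using x \<rho> by (intro powr_mono2) auto
        also have "\<dots> = d k j" unfolding d by (simp add: powr_powr)
        also have "\<dots> \<le> suminf (d k)"
          using sum_le_suminf[OF sd, of "{j}"] by (auto simp: d_def)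
        finally show ?thesis using True by (simp add: c_def x_def)
      qed
      have "(\<Sum>k\<le>n. c k) \<le> (\<Sum>k\<le>n. suminf (d k))" by (intro sum_mono cd)
      also have "\<dots> = (\<Sum>j. \<Sum>k\<le>n. d k j)" by (rule suminf_sum[symmetric]) (rule sd)
      also have "\<dots> \<le> suminf a"
      proof (rule suminf_le[OF _ _ sa])
        show "summable (\<lambda>j. \<Sum>k\<le>n. d k j)" by (intro summable_sum sd)
        show "(\<Sum>k\<le>n. d k j) \<le> a j" for j
        proof -
          have "(\<Sum>k\<le>n. d k j) = real (card ({..n} \<inter> {k. norm (b k) \<ge> 1 / 2 ^ (j + 1)})) * 2 powr (- real j * \<sigma>)"
            by (simp add: d_def sum.If_cases)
          also have "\<dots> \<le> real (card {k. norm (b k) \<ge> 1 / 2 ^ (j + 1)}) * 2 powr (- real j * \<sigma>)"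
            using fin[of "2 ^ (j + 1)"] by (intro mult_right_mono) (auto intro!: card_mono)
          also have "\<dots> \<le> C * (1 + 2 ^ (j + 1)) powr \<rho> * 2 powr (- real j * \<sigma>)"
            using C[of "2 ^ (j + 1)"] by (intro mult_right_mono) auto
          also have "\<dots> \<le> C * (4 * 2 ^ j) powr \<rho> * 2 powr (- real j * \<sigma>)"
          proof (intro mult_right_mono mult_left_mono powr_mono2)
            show "(1::real) + 2 ^ (j + 1) \<le> 4 * 2 ^ j" 
              using one_le_power[of "2::real" j] unfolding power_add power_one_right by linarith
          qed (use C0 \<rho> in auto)
          also have "(4 * 2 ^ j :: real) = 4 * 2 powr real j" by (simp add: powr_realpow)
          also have "C * (4 * 2 powr real j) powr \<rho> * 2 powr (- real j * \<sigma>) =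
             C * 4 powr \<rho> * (2 powr (real j * \<rho>) * 2 powr (- real j * \<sigma>))"
            by (simp add: powr_mult powr_powr)
          also have "2 powr (real j * \<rho>) * 2 powr (- real j * \<sigma>) = 2 powr ((\<rho> - \<sigma>) * real j)"
            by (simp add: powr_add[symmetric] algebra_simps)
          also have "\<dots> = (2 powr (\<rho> - \<sigma>)) ^ j"
            by (simp add: powr_powr[symmetric] powr_realpow)
          finally show ?thesis by (simp add: a_def)
        qed
      qed
      finally show ?thesis .
    qed
  qed
  moreover have "eventually (\<lambda>k. c k = norm (b k) powr \<sigma>) sequentially"
  proof -
    have "finite {k. norm (b k) \<ge> 1}" using fin[of 1] by simp
    then obtain N where "\<forall>k\<in>{k. norm (b k) \<ge> 1}. k < N" using finite_nat_set_iff_bounded by blast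
    hence "eventually (\<lambda>k. k \<notin> {k. norm (b k) \<ge> 1}) sequentially"
      unfolding eventually_sequentially by (meson leD)
    thus ?thesis by eventually_elim (auto simp: c_def)
  qed
  ultimately show ?thesis using summable_cong[of c] by simp
qed

lemma growth_limit:
  fixes C c \<rho> y :: real
  assumes "0 < \<rho>" "\<rho> < 1"
  shows "(\<lambda>n. 2 * (C * (1 + 3 * real (Suc n)) powr \<rho> + c) * y / (real (Suc n) - y)) \<longlonglongrightarrow> 0"
proof -
  have "((\<lambda>x. 2 * (C * (1 + 3 * (x + 1)) powr \<rho> + c) * y / (x + 1 - y)) \<longlongrightarrow> 0) at_top"
    using assms by real_asymp
  from filterlim_compose[OF this filterlim_real_sequentially] show ?thesis by (simp add: add_ac)
qed

text \<open>On a disc of radius \<open>n + 1\<close> the zero-free factor is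
  \<open>g 0 * exp l\<close>. By Borel-Caratheodory, \<open>l\<close> at a fixed point is of size
  \<open>n powr (\<rho> - 1)\<close>, which tends to 0 for \<open>\<rho> < 1\<close>; hence no
  exponential factor survives.\<close>

lemma hadamard_product:
  assumes hol: "g holomorphic_on UNIV" and g0: "g 0 \<noteq> 0" and b: "zero_seq g b"
    and gr: "growth \<rho> g" and \<rho>: "0 < \<rho>" "\<rho> < 1" and sm: "summable (\<lambda>k. norm (b k))"
  shows "(\<lambda>n. \<Prod>k<n. 1 - b k * z) \<longlonglongrightarrow> g z / g 0"
proof -
  obtain C where C: "C > 0" "\<And>z. norm (g z) \<le> exp (C * (1 + norm z) powr \<rho>)"
    using gr by (auto simp: growth_def)
  define T where "T n = {k. norm (b k) \<ge> 1 / real (Suc n)}" for n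
  define y where "y = norm z"
  \<comment> \<open>The summand 1 makes the bound on the real part of the logarithm strict and
    \<open>B n\<close> positive.\<close>
  define B where "B n = C * (1 + 3 * real (Suc n)) powr \<rho> + (\<bar>ln (norm (g 0))\<bar> + 1)" for n
  have "\<exists>l. g z / g 0 = exp l * (\<Prod>k\<in>T n. 1 - b k * z) \<and> norm l \<le> 2 * B n * y / (real (Suc n) - y)"
    if n: "real (Suc n) > y" for n
  proof -
    have R: "real (Suc n) > 0" using n unfolding y_def by (meson le_less_trans norm_ge_zero)
    obtain q where q: "q holomorphic_on ball 0 (4 * real (Suc n))"
      "\<And>z. norm z < 4 * real (Suc n) \<Longrightarrow> g z = q z * (\<Prod>k\<in>{k. norm (b k) \<ge> 1 / real (Suc n)}. 1 - b k * z)"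
      "\<And>z. norm z < real (Suc n) \<Longrightarrow> q z \<noteq> 0"
      using zero_seq_factor[OF hol g0 b R] by blast
    have q0: "q 0 = g 0" using q(2)[of 0] R by simp
    have qb: "norm (q w) \<le> exp (C * (1 + 3 * real (Suc n)) powr \<rho>)" if w: "norm w < real (Suc n)" for w
    proof -
      have "norm (q w) * 1 \<le> norm (q w) * 2 ^ card {k. norm (b k) \<ge> 1 / real (Suc n)}"
        by (intro mult_left_mono one_le_power) auto
      also have "\<dots> \<le> exp (C * (1 + 3 * real (Suc n)) powr \<rho>)"
      proof (rule zero_seq_factor_bound[OF hol g0 b R _ q(1,2)])
        show "norm (g z) \<le> exp (C * (1 + 3 * real (Suc n)) powr \<rho>)" if "norm z = 3 * real (Suc n)" for z
          using C(2)[of z] that by simp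
      qed (use R w in auto)
      finally show ?thesis by simp
    qed
    have holq: "(\<lambda>w. q w / g 0) holomorphic_on ball 0 (real (Suc n))"
      by (intro holomorphic_intros holomorphic_on_subset[OF q(1)]) (use R g0 in auto)
    obtain l0 where l0: "l0 holomorphic_on ball 0 (real (Suc n))"
      "\<And>w. w \<in> ball 0 (real (Suc n)) \<Longrightarrow> q w / g 0 = exp (l0 w)"
      by (rule contractible_imp_holomorphic_log[OF holq])
         (use q(3) g0 in \<open>auto simp: convex_imp_contractible\<close>)
    define l where "l w = l0 w - l0 0" for w
    have e0: "exp (l0 0) = 1" using l0(2)[of 0] R q0 g0 by simp
    have el: "exp (l w) = q w / g 0" if "norm w < real (Suc n)" for w
      using l0(2)[of w] that e0 by (simp add: l_def exp_diff)
    have "norm (l z) \<le> 2 * B n * norm z / (real (Suc n) - norm z)"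
    proof (rule Borel_Caratheodory_ball[of l "real (Suc n)"])
      show "l holomorphic_on ball 0 (real (Suc n))" unfolding l_def by (intro holomorphic_intros l0)
      show "0 < B n" using C(1) by (auto simp: B_def intro: add_nonneg_pos)
      show "Re (l w) < B n" if w: "norm w < real (Suc n)" for w
      proof -
        have "exp (Re (l w)) = norm (q w) / norm (g 0)"
          using el[OF w] by (metis norm_divide norm_exp_eq_Re)
        also have "\<dots> \<le> exp (C * (1 + 3 * real (Suc n)) powr \<rho>) / norm (g 0)"
          using qb[OF w] by (intro divide_right_mono) auto
        also have "\<dots> = exp (C * (1 + 3 * real (Suc n)) powr \<rho> - ln (norm (g 0)))"
          using g0 by (simp add: exp_diff)
        finally show ?thesis by (auto simp: B_def)
      qed
    qed (use R n in \<open>auto simp: y_def l_def\<close>)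
    moreover have "g z / g 0 = exp (l z) * (\<Prod>k\<in>T n. 1 - b k * z)"
      using el[of z] q(2)[of z] n R g0 by (auto simp: T_def y_def)
    ultimately show ?thesis unfolding y_def by blast
  qed
  then obtain l where l: "\<And>n. real (Suc n) > y \<Longrightarrow> g z / g 0 = exp (l n) * (\<Prod>k\<in>T n. 1 - b k * z)"
     "\<And>n. real (Suc n) > y \<Longrightarrow> norm (l n) \<le> 2 * B n * y / (real (Suc n) - y)" by metis
  have ev: "eventually (\<lambda>n. real (Suc n) > y) sequentially"
    by real_asymp
  have "l \<longlonglongrightarrow> 0"
    by (rule Lim_null_comparison[OF eventually_mono[OF ev l(2)]])
       (assumption, unfold B_def, rule growth_limit[OF \<rho>])
  hence "(\<lambda>n. g z / g 0 * exp (- l n)) \<longlonglongrightarrow> g z / g 0 * exp (- 0)" by (intro tendsto_intros)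
  moreover have "eventually (\<lambda>n. g z / g 0 * exp (- l n) = (\<Prod>k\<in>T n. 1 + (- b k * z))) sequentially"
    using ev
  proof eventually_elim
    case (elim n)
    show ?case unfolding l(1)[OF elim] by (simp add: exp_minus field_simps)
  qed
  ultimately have "(\<lambda>n. \<Prod>k\<in>T n. 1 + (- b k * z)) \<longlonglongrightarrow> g z / g 0"
    by (simp add: tendsto_cong)
  hence "(\<lambda>n. \<Prod>k<n. 1 + (- b k * z)) \<longlonglongrightarrow> g z / g 0"
  proof (rule prod_unordered_limit[rotated 3])
    show "summable (\<lambda>k. norm (- b k * z))" using sm by (simp add: norm_mult summable_mult2)
    show "finite (T m)" for m
      unfolding T_def using zero_seq_finite[OF hol g0 b, of "real (Suc m)"] by simp
    show "eventually (\<lambda>m. k \<in> T m) sequentially" if "- b k * z \<noteq> 0" for k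
    proof -
      have nb: "norm (b k) > 0" using that by simp
      have "eventually (\<lambda>m. real m > 1 / norm (b k)) sequentially"
        using filterlim_real_sequentially filterlim_at_top_dense by blast
      thus ?thesis
      proof eventually_elim
        case (elim m)
        have "1 < norm (b k) * real m" using elim nb by (simp add: field_simps)
        moreover have "norm (b k) * real (Suc m) = norm (b k) * real m + norm (b k)"
          by (simp add: algebra_simps)
        ultimately have "1 \<le> norm (b k) * real (Suc m)" using nb by linarith
        thus ?case by (simp add: T_def field_simps del: of_nat_Suc)
      qed
    qed
  qed
  thus ?thesis by simp
qed

section \<open>Kernels\<close>

text \<open>\<open>\<phi> x\<close> is \<open>sqrt x\<close> times the integral of \<open>t powr (- 3/2) * ln \<bar>1 - t\<bar>\<close> over \<open>t \<ge> x\<close>, in closed form;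
  the convention \<open>ln 0 = 0\<close> gives the correct value at \<open>x = 1\<close>.\<close>
definition \<phi> :: "real \<Rightarrow> real" where
  "\<phi> x = 2 * ((1 + sqrt x) * ln (1 + sqrt x) + (1 - sqrt x) * ln \<bar>1 - sqrt x\<bar>)"

definition \<phi>d :: "real \<Rightarrow> real" where
  "\<phi>d x = (ln (1 + sqrt x) - ln \<bar>1 - sqrt x\<bar>) / sqrt x"

lemma phi_0 [simp]: "\<phi> 0 = 0"
  by (simp add: \<phi>_def)

lemma phi_has_derivative:
  assumes "x > 0" "x \<noteq> 1"
  shows "(\<phi> has_field_derivative \<phi>d x) (at x)"
proof -
  define y where "y = sqrt x"
  have y: "y > 0" "y \<noteq> 1" using assms by (auto simp: y_def)
  define h where "h y = 2 * ((1 + y) * ln (1 + y) + (1 - y) * ln \<bar>1 - y\<bar>)" for y :: real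
  have 1: "((\<lambda>y. (1 + y) * ln (1 + y)) has_field_derivative ln (1 + y) + 1) (at y)"
    by (rule derivative_eq_intros refl | use y in simp)+
  have 2: "((\<lambda>y. (1 - y) * ln \<bar>1 - y\<bar>) has_field_derivative - ln \<bar>1 - y\<bar> - 1) (at y)"
  proof (cases "y < 1")
    case True
    have "((\<lambda>y. (1 - y) * ln (1 - y)) has_field_derivative - ln (1 - y) - 1) (at y)"
      by (rule derivative_eq_intros refl | use True in simp)+
    hence "((\<lambda>y. (1 - y) * ln \<bar>1 - y\<bar>) has_field_derivative - ln (1 - y) - 1) (at y)"
      by (rule has_field_derivative_transform_within_open[of _ _ _ "{..<1}"]) (use True in auto)
    thus ?thesis using True by simp
  next
    case False
    hence y1: "y > 1" using y by simp
    have D: "((\<lambda>y. (1 - y) * ln (y - 1)) has_field_derivative (1 - y) * (1 / (y - 1)) - ln (y - 1)) (at y)"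
      by (rule derivative_eq_intros refl | use y1 in simp)+
    have eq: "(1 - y) * (1 / (y - 1)) - ln (y - 1) = - ln (y - 1) - 1" using y1 by (simp add: field_simps)
    have "((\<lambda>y. (1 - y) * ln (y - 1)) has_field_derivative - ln (y - 1) - 1) (at y)"
      using D unfolding eq .
    hence "((\<lambda>y. (1 - y) * ln \<bar>1 - y\<bar>) has_field_derivative - ln (y - 1) - 1) (at y)"
      by (rule has_field_derivative_transform_within_open[of _ _ _ "{1<..}"]) (use y1 in auto)
    thus ?thesis using y1 by simp
  qed
  have dh: "(h has_field_derivative 2 * ((ln (1 + y) + 1) + (- ln \<bar>1 - y\<bar> - 1))) (at y)"
    unfolding h_def[abs_def] by (intro DERIV_cmult DERIV_add 1 2)
  have ds: "(sqrt has_field_derivative inverse (sqrt x) / 2) (at x)"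
    using DERIV_real_sqrt[OF assms(1)] .
  have "((\<lambda>x. h (sqrt x)) has_field_derivative
     2 * ((ln (1 + y) + 1) + (- ln \<bar>1 - y\<bar> - 1)) * (inverse (sqrt x) / 2)) (at x)"
    unfolding y_def by (rule DERIV_chain2[where f = h and g = sqrt, OF dh[unfolded y_def] ds])
  moreover have "2 * ((ln (1 + y) + 1) + (- ln \<bar>1 - y\<bar> - 1)) * (inverse (sqrt x) / 2) = \<phi>d x"
    using assms by (simp add: \<phi>d_def y_def field_simps)
  ultimately show ?thesis by (simp add: h_def \<phi>_def[abs_def])
qed

text \<open>The differential equation that dictates the form of \<open>\<phi>\<close>: its
  homogeneous part is cancelled by the factor \<open>r powr (- 1/2)\<close>, so that only the
  logarithms remain in the derivative.\<close>

lemma x_phid: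
  assumes "x > 0" "x \<noteq> 1"
  shows "x * \<phi>d x = \<phi> x / 2 - ln \<bar>1 - x\<bar>"
proof -
  define y where "y = sqrt x"
  have y: "y > 0" "y \<noteq> 1" "x = y * y" using assms by (auto simp: y_def)
  have "1 - x = (1 - y) * (1 + y)" by (simp add: y(3) algebra_simps)
  hence "\<bar>1 - x\<bar> = \<bar>1 - y\<bar> * \<bar>1 + y\<bar>" by (simp only: abs_mult)
  hence "ln \<bar>1 - x\<bar> = ln (\<bar>1 - y\<bar> * (1 + y))" using y by simp
  also have "\<dots> = ln \<bar>1 - y\<bar> + ln (1 + y)"
    using y by (simp add: ln_mult)
  finally have l: "ln \<bar>1 - x\<bar> = ln \<bar>1 - y\<bar> + ln (1 + y)" .
  have "x * \<phi>d x = y * (ln (1 + y) - ln \<bar>1 - y\<bar>)"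
    using y by (simp add: \<phi>d_def flip: y_def)
  thus ?thesis unfolding l \<phi>_def y_def[symmetric] by (simp add: algebra_simps)
qed

lemma phid_bound:
  assumes "0 < x" "x \<le> 1/4"
  shows "\<bar>\<phi>d x\<bar> \<le> 3"
proof -
  define y where "y = sqrt x"
  have y: "y > 0" "y \<le> 1/2"
    using assms real_sqrt_le_mono[of x "1/4"] by (auto simp: y_def real_sqrt_divide)
  have "ln (1 + y) \<le> y" using y by (intro ln_add_one_self_le_self) auto
  moreover have "- ln (1 - y) \<le> 2 * y"
  proof -
    have "ln (inverse (1 - y)) \<le> inverse (1 - y) - 1" using y by (intro ln_le_minus_one) auto
    also have "\<dots> \<le> 2 * y" using y by (simp add: field_simps)
    finally show ?thesis using y by (simp add: ln_inverse)
  qed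
  moreover have "ln (1 + y) \<ge> 0" "ln (1 - y) \<le> 0" using y by auto
  ultimately have "\<bar>ln (1 + y) - ln (1 - y)\<bar> \<le> 3 * y" by linarith
  thus ?thesis using y by (simp add: \<phi>d_def y_def[symmetric] divide_simps abs_mult)
qed

lemma phi_nonneg_le:
  assumes "0 \<le> x" "x < 1"
  shows "0 \<le> \<phi> x" "\<phi> x \<le> 4 * x"
proof -
  define y where "y = sqrt x"
  have y: "y \<ge> 0" "y < 1" "x = y * y" using assms by (auto simp: y_def)
  have 1: "ln (1 + y) \<le> y" using y by (intro ln_add_one_self_le_self) auto
  have 2: "ln (1 - y) \<le> - y" using y ln_le_minus_one[of "1 - y"] by auto
  have "- ln (1 - y) \<le> inverse (1 - y) - 1"
    using y ln_le_minus_one[of "inverse (1 - y)"] by (simp add: ln_inverse)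
  also have "\<dots> = y / (1 - y)" using y by (simp add: field_simps)
  finally have 3: "- ln (1 - y) \<le> y / (1 - y)" .
  have "- ln (1 + y) \<le> inverse (1 + y) - 1"
    using y ln_le_minus_one[of "inverse (1 + y)"] by (simp add: ln_inverse)
  also have "\<dots> = - y / (1 + y)" using y by (simp add: field_simps)
  finally have 4: "- ln (1 + y) \<le> - y / (1 + y)" .
  have e: "\<phi> x = 2 * ((1 + y) * ln (1 + y) + (1 - y) * ln (1 - y))"
    using y by (simp add: \<phi>_def flip: y_def)
  have "(1 + y) * ln (1 + y) \<le> (1 + y) * y" using 1 y by (intro mult_left_mono) auto
  moreover have "(1 - y) * ln (1 - y) \<le> (1 - y) * (- y)" using 2 y by (intro mult_left_mono) auto
  ultimately have "\<phi> x \<le> 4 * (y * y)" unfolding e by (simp add: algebra_simps)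
  thus "\<phi> x \<le> 4 * x" by (simp add: y(3))
  have "(1 + y) * - ln (1 + y) \<le> (1 + y) * (- y / (1 + y))" using 4 y by (intro mult_left_mono) auto
  moreover have "(1 - y) * - ln (1 - y) \<le> (1 - y) * (y / (1 - y))" using 3 y by (intro mult_left_mono) auto
  ultimately show "0 \<le> \<phi> x" unfolding e using y by simp
qed

text \<open>With \<open>y = sqrt x\<close>, the true growth is \<open>4 * ln y\<close>. The lower
  bound lets \<open>Phi\<close> beat any multiple of \<open>ln r\<close> once there are infinitely
  many terms; the upper one is crude but matches the exponent 1/2.\<close>

lemma phi_large:
  assumes "1 \<le> x"
  shows "2 * ln x \<le> \<phi> x" "\<phi> x \<le> 8 * sqrt x"
proof -
  define y where "y = sqrt x"
  have y: "y \<ge> 1" "x = y * y" using assms by (auto simp: y_def)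
  show "2 * ln x \<le> \<phi> x"
  proof (cases "y = 1")
    case True
    thus ?thesis using y by (simp add: \<phi>_def)
  next
    case False
    hence y1: "y > 1" using y by simp
    have e: "\<phi> x = 4 * ln (1 + y) + 2 * (y - 1) * (ln (1 + y) - ln (y - 1))"
      using y1 by (simp add: \<phi>_def algebra_simps flip: y_def)
    have "ln (1 + y) \<ge> ln (y - 1)" using y1 by simp
    hence "2 * (y - 1) * (ln (1 + y) - ln (y - 1)) \<ge> 0" using y1 by simp
    moreover have "ln (1 + y) \<ge> ln y" using y1 by simp
    moreover have "ln x = 2 * ln y" using y1 by (simp add: y(2) ln_mult)
    ultimately show ?thesis unfolding e by linarith
  qed
  show "\<phi> x \<le> 8 * sqrt x"
  proof (cases "y = 1")
    case True
    have "ln (2::real) \<le> 1" using ln_le_minus_one[of 2] by simp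
    thus ?thesis using True by (simp add: \<phi>_def flip: y_def)
  next
    case False
    hence y1: "y > 1" using y by simp
    have e: "\<phi> x = 4 * ln (1 + y) + 2 * ((y - 1) * ln ((1 + y) / (y - 1)))"
      using y1 by (simp add: \<phi>_def algebra_simps ln_div flip: y_def)
    have "ln ((1 + y) / (y - 1)) \<le> 2 / (y - 1)"
      using y1 ln_le_minus_one[of "(1 + y) / (y - 1)"] by (simp add: field_simps)
    hence "(y - 1) * ln ((1 + y) / (y - 1)) \<le> (y - 1) * (2 / (y - 1))"
      using y1 by (intro mult_left_mono) auto
    also have "(y - 1) * (2 / (y - 1)) = 2" using y1 by (simp add: field_simps)
    finally have "(y - 1) * ln ((1 + y) / (y - 1)) \<le> 2" .
    moreover have "ln (1 + y) \<le> y" using y1 by (intro ln_add_one_self_le_self) auto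
    ultimately have "\<phi> x \<le> 4 * y + 4" unfolding e by linarith
    hence "\<phi> x \<le> 8 * y" using y1 by linarith
    thus ?thesis by (simp add: y_def)
  qed
qed

lemma phi_nonneg: "x \<ge> 0 \<Longrightarrow> \<phi> x \<ge> 0"
  using phi_nonneg_le(1)[of x] phi_large(1)[of x] ln_ge_zero[of x] by linarith

text \<open>This is how the order enters the bound on \<open>F\<close>: summed over zeros with
  convergent \<open>\<sigma>\<close>-th powers it gives \<open>Phi r = O (r powr \<sigma>)\<close>,
  which leaves \<open>r powr (\<sigma> - 1/2)\<close> after normalisation.\<close>

lemma phi_le_powr:
  assumes "x \<ge> 0" "1/2 \<le> \<sigma>" "\<sigma> < 1"
  shows "\<phi> x \<le> 8 * x powr \<sigma>"
proof (cases "x < 1")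
  case True
  have "x powr 1 \<le> x powr \<sigma>" using assms True by (intro powr_mono') auto
  thus ?thesis using phi_nonneg_le(2)[of x] assms True by auto
next
  case False
  have "sqrt x = x powr (1/2)" using False by (simp add: powr_half_sqrt)
  also have "\<dots> \<le> x powr \<sigma>" using assms False by (intro powr_mono) auto
  finally show ?thesis using phi_large(2)[of x] False by auto
qed

text \<open>By \<open>x_phid\<close> this says that \<open>\<phi>\<close> is nondecreasing. It caps
  the loss of \<open>F\<close> even on circles close to a zero, where nothing else is known.\<close>

lemma phi_ge_ln:
  assumes "x > 0" "x \<noteq> 1"
  shows "ln \<bar>1 - x\<bar> \<le> \<phi> x / 2"
proof (cases "x \<le> 2")
  case True
  have "ln \<bar>1 - x\<bar> \<le> 0" using assms True by (intro ln_le_zero_iff[THEN iffD2]) auto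
  thus ?thesis using phi_nonneg[of x] assms by linarith
next
  case False
  have "ln \<bar>1 - x\<bar> \<le> ln x" using False by (intro ln_mono) auto
  thus ?thesis using phi_large(1)[of x] False by linarith
qed

lemma isCont_abs_ln: "isCont (\<lambda>t::real. t * ln \<bar>t\<bar>) 0"
proof -
  have "((\<lambda>t::real. t * ln \<bar>t\<bar>) \<longlongrightarrow> 0) (at_right 0)" by real_asymp
  moreover have "((\<lambda>t::real. t * ln \<bar>t\<bar>) \<longlongrightarrow> 0) (at_left 0)" by real_asymp
  ultimately show ?thesis by (simp add: isCont_def filterlim_split_at)
qed

lemma phi_continuous:
  assumes "x \<ge> 0"
  shows "isCont \<phi> x"
proof -
  have c: "isCont (\<lambda>t::real. t * ln \<bar>t\<bar>) s" for s
  proof (cases "s = 0")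
    case False
    thus ?thesis by (intro continuous_intros) auto
  qed (simp add: isCont_abs_ln)
  have "isCont (\<lambda>x. (1 - sqrt x) * ln \<bar>1 - sqrt x\<bar>) x"
    by (rule isCont_o2[OF _ c, of _ "\<lambda>x. 1 - sqrt x"]) (intro continuous_intros)
  moreover have "isCont (\<lambda>x. (1 + sqrt x) * ln (1 + sqrt x)) x"
    using assms by (intro continuous_intros) (auto simp: add_nonneg_eq_0_iff)
  ultimately have "isCont (\<lambda>x. 2 * ((1 + sqrt x) * ln (1 + sqrt x) + (1 - sqrt x) * ln \<bar>1 - sqrt x\<bar>)) x"
    by (intro continuous_mult[OF continuous_const] continuous_add)
  thus ?thesis by (simp add: \<phi>_def[abs_def])
qed

text \<open>What \<open>ln \<bar>1 - z / a\<bar>\<close> gains over its minimum on \<open>\<bar>z\<bar> = x * \<bar>a\<bar>\<close> when the directions of \<open>z\<close> and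
  \<open>a\<close> differ by a chord of length \<open>\<delta> / 2\<close>.\<close>
definition dgain :: "real \<Rightarrow> real \<Rightarrow> real" where
  "dgain \<delta> x = ln (1 + x * \<delta>\<^sup>2 / (4 * (1 - x)\<^sup>2)) / 2"

lemma dgain_nonneg: "x \<ge> 0 \<Longrightarrow> dgain \<delta> x \<ge> 0"
  by (auto simp: dgain_def)

text \<open>For small \<open>x\<close> both \<open>\<phi>\<close> and the gain are linear. For
  moderate \<open>x\<close> the kernel is bounded and the singularity of
  \<open>ln \<bar>1 - x\<bar>\<close> at 1 is matched by that of \<open>dgain\<close>. For
  \<open>x > 16\<close> the term \<open>4 * ln \<bar>1 - x\<bar>\<close> dominates unaided, as it
  grows like \<open>4 * ln x\<close> against \<open>2 * ln x\<close> for
  \<open>\<phi>\<close>.\<close>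

lemma phi_le_dgain:
  assumes \<delta>: "0 < \<delta>" "\<delta> \<le> 1"
  obtains C where "C > 0" "\<And>x. x > 0 \<Longrightarrow> x \<noteq> 1 \<Longrightarrow> \<phi> x \<le> C * dgain \<delta> x + 4 * ln \<bar>1 - x\<bar>"
proof -
  \<comment> \<open>\<open>1800 = 8 * 15 * 15\<close>, and 15 bounds
    \<open>\<bar>1 - x\<bar>\<close> for \<open>1/2 \<le> x \<le> 16\<close>; thus \<open>c0\<close>
    is a lower bound of the gain in that range.\<close>
  define c0 where "c0 = ln (1 + \<delta>\<^sup>2 / 1800) / 2"
  have "ln (1 + \<delta>\<^sup>2 / 1800) > 0" by (rule ln_gt_zero) (use \<delta> in auto)
  hence c0: "c0 > 0" unfolding c0_def by simp
  \<comment> \<open>32 bounds \<open>\<phi>\<close> up to \<open>x = 16\<close>; the logarithm is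
    the constant left over when the singular part of \<open>- 4 * ln \<bar>1 - x\<bar>\<close> is
    traded for \<open>4 * dgain \<delta> x\<close>.\<close>
  define K where "K = 32 + 2 * ln (8 / \<delta>\<^sup>2)"
  have d8: "ln (8 / \<delta>\<^sup>2) > 0" using \<delta> power_le_one[of \<delta> 2] by (subst ln_gt_zero_iff) (auto simp: field_simps)
  have K: "K > 0" using d8 by (simp add: K_def)
  define C where "C = 256 / \<delta>\<^sup>2 + 4 + K / c0"
  have C: "C \<ge> 256 / \<delta>\<^sup>2" "C \<ge> 4 + K / c0" "C > 0"
  proof -
    have "256 / \<delta>\<^sup>2 > 0" "K / c0 > 0" using c0 K \<delta> by auto
    thus "C \<ge> 256 / \<delta>\<^sup>2" "C \<ge> 4 + K / c0" "C > 0" unfolding C_def by linarith+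
  qed
  show thesis
  proof (rule that[OF C(3)])
    fix x :: real assume x: "x > 0" "x \<noteq> 1"
    consider "x < 1/2" | "1/2 \<le> x" "x \<le> 16" | "x > 16" by linarith
    thus "\<phi> x \<le> C * dgain \<delta> x + 4 * ln \<bar>1 - x\<bar>"
    proof cases
      case 1
      define t where "t = x * \<delta>\<^sup>2 / 4"
      have t: "0 < t" "t \<le> 1" using 1 x \<delta> power_le_one[of \<delta> 2]
        mult_mono[of x 1 "\<delta>\<^sup>2" 1] by (auto simp: t_def)
      have "t / 2 \<le> ln (1 + t)"
      proof -
        have "- ln (1 + t) \<le> inverse (1 + t) - 1"
          using ln_le_minus_one[of "inverse (1 + t)"] t by (simp add: ln_inverse)
        also have "\<dots> \<le> - (t / 2)" using t by (simp add: field_simps)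
        finally show ?thesis by simp
      qed
      also have "\<dots> \<le> ln (1 + x * \<delta>\<^sup>2 / (4 * (1 - x)\<^sup>2))"
      proof (rule ln_mono)
        have "(1 - x)\<^sup>2 \<le> 1" using 1 x by (simp add: power_le_one)
        hence "t \<le> t / (1 - x)\<^sup>2" using t 1 x by (simp add: field_simps)
        thus "1 + t \<le> 1 + x * \<delta>\<^sup>2 / (4 * (1 - x)\<^sup>2)" by (simp add: t_def)
      qed (use t in auto)
      finally have "x * \<delta>\<^sup>2 / 16 \<le> dgain \<delta> x" by (simp add: t_def dgain_def)
      hence "256 / \<delta>\<^sup>2 * (x * \<delta>\<^sup>2 / 16) \<le> C * dgain \<delta> x"
        using C x by (intro mult_mono) auto
      hence 3: "16 * x \<le> C * dgain \<delta> x" using \<delta> by simp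
      have "- ln (1 - x) \<le> inverse (1 - x) - 1"
        using 1 ln_le_minus_one[of "inverse (1 - x)"] by (simp add: ln_inverse)
      also have "\<dots> \<le> 2 * x" using 1 x by (simp add: field_simps)
      finally show ?thesis using 3 phi_nonneg_le(2)[of x] 1 x by auto
    next
      case 2
      have "\<phi> x \<le> 32"
      proof (cases "x < 1")
        case False
        have "sqrt x \<le> sqrt 16" using 2 by (intro real_sqrt_le_mono) auto
        thus ?thesis using phi_large(2)[of x] False by simp
      qed (use phi_nonneg_le(2)[of x] x in auto)
      define L where "L = ln (1 + \<delta>\<^sup>2 / (8 * (1 - x)\<^sup>2))"
      have Ld: "L \<le> 2 * dgain \<delta> x"
      proof -
        have "\<delta>\<^sup>2 / (8 * (1 - x)\<^sup>2) \<le> x * \<delta>\<^sup>2 / (4 * (1 - x)\<^sup>2)"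
        proof -
          have "\<delta>\<^sup>2 / (8 * (1 - x)\<^sup>2) = (1/2) * (\<delta>\<^sup>2 / (4 * (1 - x)\<^sup>2))" by simp
          also have "\<dots> \<le> x * (\<delta>\<^sup>2 / (4 * (1 - x)\<^sup>2))" using 2 by (intro mult_right_mono) auto
          finally show ?thesis by simp
        qed
        moreover have "\<delta>\<^sup>2 / (8 * (1 - x)\<^sup>2) \<ge> 0" by simp
        ultimately have "ln (1 + \<delta>\<^sup>2 / (8 * (1 - x)\<^sup>2)) \<le> ln (1 + x * \<delta>\<^sup>2 / (4 * (1 - x)\<^sup>2))"
          by (intro ln_mono) linarith+
        thus ?thesis unfolding L_def dgain_def by simp
      qed
      have "\<bar>1 - x\<bar> \<le> 15" using 2 by auto
      hence "\<bar>1 - x\<bar>\<^sup>2 \<le> 15\<^sup>2" by (intro power_mono) auto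
      hence "\<delta>\<^sup>2 / 1800 \<le> \<delta>\<^sup>2 / (8 * (1 - x)\<^sup>2)"
        using \<delta> x by (intro divide_left_mono) auto
      moreover have "\<delta>\<^sup>2 / 1800 \<ge> 0" by simp
      ultimately have "ln (1 + \<delta>\<^sup>2 / 1800) \<le> ln (1 + \<delta>\<^sup>2 / (8 * (1 - x)\<^sup>2))"
        by (intro ln_mono) linarith+
      hence "2 * c0 \<le> L" unfolding L_def c0_def by simp
      hence cd: "c0 \<le> dgain \<delta> x" using Ld by simp
      have "ln (\<delta>\<^sup>2 / (8 * (1 - x)\<^sup>2)) \<le> L"
        unfolding L_def using \<delta> x by (intro ln_mono) (auto simp: add_pos_nonneg)
      moreover have "ln (\<delta>\<^sup>2 / (8 * (1 - x)\<^sup>2)) = - ln (8 / \<delta>\<^sup>2) - 2 * ln \<bar>1 - x\<bar>"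
      proof -
        have "ln (\<delta>\<^sup>2 / (8 * t\<^sup>2)) = - ln (8 / \<delta>\<^sup>2) - 2 * ln t" if "t > 0" for t :: real
          using \<delta> that by (simp add: ln_div ln_mult ln_realpow)
        from this[of "\<bar>1 - x\<bar>"] show ?thesis using x by simp
      qed
      ultimately have 1: "- ln (8 / \<delta>\<^sup>2) - 2 * ln \<bar>1 - x\<bar> \<le> 2 * dgain \<delta> x"
        using Ld by (metis order_trans)
      have 2: "K \<le> K / c0 * dgain \<delta> x" using cd c0 K by (simp add: field_simps)
      have 3: "4 * dgain \<delta> x + K / c0 * dgain \<delta> x \<le> C * dgain \<delta> x"
        unfolding distrib_right[symmetric] using C x by (intro mult_right_mono dgain_nonneg) auto
      have "p \<le> c + 4 * a" if "p \<le> 32" "32 + 2 * l \<le> k" "4 * d + k \<le> c" "- l - 2 * a \<le> 2 * d"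
        for p c a l k d :: real using that by linarith
      from this[OF \<open>\<phi> x \<le> 32\<close> _ 3 1] 2 show ?thesis
        unfolding K_def by blast
    next
      case 3
      define y where "y = sqrt x"
      have y: "y > 4" "x = y * y" using 3 real_sqrt_less_mono[of 16 x] by (auto simp: y_def)
      have e: "\<phi> x = 4 * ln (1 + y) + 2 * ((y - 1) * ln ((1 + y) / (y - 1)))"
        using y by (simp add: \<phi>_def algebra_simps ln_div flip: y_def)
      have "ln ((1 + y) / (y - 1)) \<le> 2 / (y - 1)"
        using y ln_le_minus_one[of "(1 + y) / (y - 1)"] by (simp add: field_simps)
      hence "(y - 1) * ln ((1 + y) / (y - 1)) \<le> (y - 1) * (2 / (y - 1))"
        using y by (intro mult_left_mono) auto
      also have "(y - 1) * (2 / (y - 1)) = 2" using y by (simp add: field_simps)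
      finally have "(y - 1) * ln ((1 + y) / (y - 1)) \<le> 2" .
      moreover have "ln (y - 1) \<ge> 1"
      proof -
        have "ln (exp 1) \<le> ln (y - 1)" using y exp_le by (intro ln_mono) auto
        thus ?thesis by simp
      qed
      moreover have "ln \<bar>1 - x\<bar> = ln (1 + y) + ln (y - 1)"
      proof -
        have "\<bar>1 - x\<bar> = (1 + y) * (y - 1)" using y 3 by (simp add: algebra_simps)
        thus ?thesis using y by (simp add: ln_mult)
      qed
      ultimately have "\<phi> x \<le> 4 * ln \<bar>1 - x\<bar>" unfolding e by linarith
      moreover have "C * dgain \<delta> x \<ge> 0" using C x dgain_nonneg[of x] by simp
      ultimately show ?thesis by linarith
    qed
  qed
qed

section \<open>A weight that detects circles close to a zero\<close>

text \<open>The derivative of \<open>wfun\<close> dominates the integral of \<open>1 / \<bar>z - a\<bar>\<close> over a short arc of the circle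
  \<open>\<bar>z\<bar> = x * \<bar>a\<bar>\<close>. Adding a multiple of it to \<open>min 1 x\<close> makes \<open>J\<close> grow fast on all circles that
  pass close to a zero, so that these need no separate treatment.\<close>
definition wfun :: "real \<Rightarrow> real" where
  "wfun x = (if x \<le> 1/2 then 0
     else if x \<le> 1 then (1/2) powr (1/4) - (1 - x) powr (1/4)
     else if x \<le> 3/2 then (1/2) powr (1/4) + (x - 1) powr (1/4)
     else 2 * (1/2) powr (1/4))"

text \<open>The exponent - 3/4 meets three demands: it is integrable, so that \<open>wfun\<close>
  stays bounded; it dominates the singularity of order 1/2 in the estimate of the arc integral; and
  3/4 exceeds \<open>\<sigma>\<close>, so that a single zero too close to the circle is visible in a
  sum of size \<open>r powr \<sigma>\<close>.\<close>

definition wfund :: "real \<Rightarrow> real" where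
  "wfund x = (if \<bar>x - 1\<bar> < 1/2 then \<bar>x - 1\<bar> powr (- 3/4) / 4 else 0)"

lemma wfun_has_derivative:
  assumes "x \<noteq> 1/2" "x \<noteq> 1" "x \<noteq> 3/2"
  shows "(wfun has_field_derivative wfund x) (at x)"
proof -
  consider "x < 1/2" | "1/2 < x" "x < 1" | "1 < x" "x < 3/2" | "3/2 < x"
    using assms by linarith
  thus ?thesis
  proof cases
    case 1
    have "((\<lambda>x. 0) has_field_derivative 0) (at x)" by simp
    hence "(wfun has_field_derivative 0) (at x)"
      by (rule has_field_derivative_transform_within_open[of _ _ _ "{..<1/2}"])
         (use 1 in \<open>auto simp: wfun_def\<close>)
    thus ?thesis using 1 by (simp add: wfund_def)
  next
    case 2
    have "((\<lambda>x. (1/2) powr (1/4) - (1 - x) powr (1/4)) has_field_derivative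
            (1/4) * (1 - x) powr (1/4 - 1)) (at x)"
      by (rule derivative_eq_intros refl | use 2 in simp)+
    hence "(wfun has_field_derivative (1/4) * (1 - x) powr (1/4 - 1)) (at x)"
      by (rule has_field_derivative_transform_within_open[of _ _ _ "{1/2<..<1}"])
         (use 2 in \<open>auto simp: wfun_def\<close>)
    thus ?thesis using 2 by (simp add: wfund_def)
  next
    case 3
    have "((\<lambda>x. (1/2) powr (1/4) + (x - 1) powr (1/4)) has_field_derivative
            (1/4) * (x - 1) powr (1/4 - 1)) (at x)"
      by (rule derivative_eq_intros refl | use 3 in simp)+
    hence "(wfun has_field_derivative (1/4) * (x - 1) powr (1/4 - 1)) (at x)"
      by (rule has_field_derivative_transform_within_open[of _ _ _ "{1<..<3/2}"])
         (use 3 in \<open>auto simp: wfun_def\<close>)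
    thus ?thesis using 3 by (simp add: wfund_def)
  next
    case 4
    have "((\<lambda>x. 2 * (1/2) powr (1/4)) has_field_derivative (0::real)) (at x)" by simp
    hence "(wfun has_field_derivative 0) (at x)"
      by (rule has_field_derivative_transform_within_open[of _ _ _ "{3/2<..}"])
         (use 4 in \<open>auto simp: wfun_def\<close>)
    thus ?thesis using 4 by (simp add: wfund_def)
  qed
qed

lemma wfun_continuous: "continuous_on UNIV wfun"
proof -
  \<comment> \<open>Clamping the arguments keeps the bases of \<open>powr\<close> nonnegative, so
    that two pieces meeting at 1 suffice.\<close>
  define h where "h x = (if x \<le> 1 then (1/2) powr (1/4) - (1 - max (1/2) x) powr (1/4)
     else (1/2) powr (1/4) + (min (3/2) x - 1) powr (1/4))" for x :: real
  have "wfun = h" by (auto simp: fun_eq_iff wfun_def h_def)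
  moreover have "continuous_on ({..1} \<union> {1..}) h"
    unfolding h_def
  proof (rule continuous_on_If)
    show "continuous_on {..1} (\<lambda>x::real. (1/2) powr (1/4) - (1 - max (1/2) x) powr (1/4))"
      by (intro continuous_intros continuous_on_powr') auto
    show "continuous_on {1..} (\<lambda>x::real. (1/2) powr (1/4) + (min (3/2) x - 1) powr (1/4))"
      by (intro continuous_intros continuous_on_powr') auto
  qed auto
  moreover have "{..1} \<union> {1..} = (UNIV :: real set)" by auto
  ultimately show ?thesis by simp
qed

lemma wfund_nonneg: "wfund x \<ge> 0"
  by (auto simp: wfund_def)

lemma wfun_bounds: "0 \<le> wfun x" "x \<ge> 0 \<Longrightarrow> wfun x \<le> 4 * min 1 x"
proof -
  have h: "(1/2) powr (1/4) \<le> (1::real)" by (rule powr_le1) auto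
  have a: "t powr (1/4) \<le> (1/2) powr (1/4)" if "0 \<le> t" "t \<le> 1/2" for t :: real
    using that by (intro powr_mono2) auto
  show "0 \<le> wfun x" using a[of "1 - x"] by (auto simp: wfun_def)
  assume x: "x \<ge> 0"
  have "wfun x \<le> 2"
  proof -
    have b: "(1 - x) powr (1/4) \<ge> 0" by simp
    have c: "1 \<le> x \<Longrightarrow> x \<le> 3/2 \<Longrightarrow> (x - 1) powr (1/4) \<le> 1" using h a[of "x - 1"] by simp
    consider "x \<le> 1/2" | "1/2 < x" "x \<le> 1" | "1 < x" "x \<le> 3/2" | "3/2 < x" by linarith
    thus ?thesis
    proof cases
      case 2
      hence "wfun x = (1/2) powr (1/4) - (1 - x) powr (1/4)" by (simp add: wfun_def)
      thus ?thesis using b h by linarith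
    next
      case 3
      hence "wfun x = (1/2) powr (1/4) + (x - 1) powr (1/4)" by (simp add: wfun_def)
      thus ?thesis using c 3 h by linarith
    qed (use h in \<open>auto simp: wfun_def\<close>)
  qed
  moreover have "x \<le> 1/2 \<Longrightarrow> wfun x = 0" by (simp add: wfun_def)
  ultimately show "wfun x \<le> 4 * min 1 x" using x by (cases "x \<le> 1/2") auto
qed

text \<open>The weight 1/80 is small enough that \<open>gfun\<close> exceeds \<open>min 1 x\<close>
  by at most the factor 21/20, and large enough that the resulting term \<open>W / 80\<close> in the
  derivative absorbs the \<open>W\<close> term in the bound of the zero count.\<close>

definition gfun :: "real \<Rightarrow> real" where
  "gfun x = min 1 x + wfun x / 80"

definition gfund :: "real \<Rightarrow> real" where
  "gfund x = (if x < 1 then 1 else 0) + wfund x / 80"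

lemma gfun_has_derivative:
  assumes "x \<noteq> 1/2" "x \<noteq> 1" "x \<noteq> 3/2"
  shows "(gfun has_field_derivative gfund x) (at x)"
proof -
  have "((\<lambda>x. min 1 x) has_field_derivative (if x < 1 then 1 else 0)) (at x)"
  proof (cases "x < 1")
    case True
    have "((\<lambda>x. x) has_field_derivative 1) (at x)" by simp
    hence "((\<lambda>x. min 1 x) has_field_derivative 1) (at x)"
      by (rule has_field_derivative_transform_within_open[of _ _ _ "{..<1}"]) (use True in auto)
    thus ?thesis using True by simp
  next
    case False
    have "((\<lambda>x. 1) has_field_derivative (0::real)) (at x)" by simp
    hence "((\<lambda>x. min 1 x) has_field_derivative 0) (at x)"
      by (rule has_field_derivative_transform_within_open[of _ _ _ "{1<..}"]) (use False assms in auto)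
    thus ?thesis using False by simp
  qed
  thus ?thesis unfolding gfun_def[abs_def] gfund_def
    by (intro DERIV_add DERIV_cdivide wfun_has_derivative assms)
qed

lemma gfun_continuous: "continuous_on UNIV gfun"
  unfolding gfun_def[abs_def] by (intro continuous_intros wfun_continuous) auto

lemma gfun_0 [simp]: "gfun 0 = 0"
  by (simp add: gfun_def wfun_def)

lemma gfun_bounds:
  assumes "x \<ge> 0"
  shows "min 1 x \<le> gfun x" "gfun x \<le> 21/20 * min 1 x"
  using wfun_bounds(1)[of x] wfun_bounds(2)[of x] assms by (auto simp: gfun_def)

lemma gfund_small: "x \<le> 1/2 \<Longrightarrow> gfund x = 1"
  by (simp add: gfund_def wfund_def)

section \<open>Termwise differentiation of sums over the zeros\<close>

text \<open>Only the finitely many terms with \<open>r * \<beta> k\<close> close to the range where the kernel is rough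
  need pointwise differentiability; the remaining ones form a uniformly convergent series.\<close>
lemma kernel_sum:
  fixes \<kappa> \<kappa>d :: "real \<Rightarrow> real" and \<beta> :: "nat \<Rightarrow> real"
  assumes \<beta>: "\<And>k. \<beta> k \<ge> 0" "summable \<beta>"
    and c: "c > 0" and \<kappa>0: "\<kappa> 0 = 0"
    and d: "\<And>x. 0 < x \<Longrightarrow> x < c \<Longrightarrow> (\<kappa> has_field_derivative \<kappa>d x) (at x)"
    and M: "\<And>x. 0 < x \<Longrightarrow> x < c \<Longrightarrow> \<bar>\<kappa>d x\<bar> \<le> M"
    and M2: "\<And>x. 0 < x \<Longrightarrow> x < c \<Longrightarrow> \<bar>\<kappa> x\<bar> \<le> M * x"
    and r: "r > 0"
  shows "summable (\<lambda>k. \<kappa> (r * \<beta> k))"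
    and "summable (\<lambda>k. \<beta> k * \<kappa>d (r * \<beta> k))"
    and "(\<And>k. \<beta> k > 0 \<Longrightarrow> (\<kappa> has_field_derivative \<kappa>d (r * \<beta> k)) (at (r * \<beta> k))) \<Longrightarrow>
       ((\<lambda>r. \<Sum>k. \<kappa> (r * \<beta> k)) has_field_derivative (\<Sum>k. \<beta> k * \<kappa>d (r * \<beta> k))) (at r)"
    and "(\<And>x. x \<ge> 0 \<Longrightarrow> isCont \<kappa> x) \<Longrightarrow> isCont (\<lambda>r. \<Sum>k. \<kappa> (r * \<beta> k)) r"
proof -
  have "\<beta> \<longlonglongrightarrow> 0" using \<beta>(2) by (rule summable_LIMSEQ_zero)
  \<comment> \<open>The factor 2 keeps \<open>t * \<beta> k\<close> below \<open>c\<close> for all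
    \<open>t < 2 * r\<close>, that is, on a whole neighbourhood of \<open>r\<close>.\<close>
  hence "eventually (\<lambda>k. \<beta> k < c / (2 * r)) sequentially"
    by (rule order_tendstoD) (use c r in auto)
  then obtain N where N: "\<And>k. k \<ge> N \<Longrightarrow> \<beta> k < c / (2 * r)"
    by (auto simp: eventually_sequentially)
  define I where "I = {0<..<2*r}"
  have small: "t * \<beta> (k + N) < c" if "t \<in> I" for t k
  proof -
    have "t * \<beta> (k + N) \<le> 2 * r * \<beta> (k + N)"
      using that \<beta>(1) by (intro mult_right_mono) (auto simp: I_def)
    also have "\<dots> < c" using N[of "k + N"] r by (simp add: field_simps)
    finally show ?thesis .
  qed
  have sb: "summable (\<lambda>k. \<beta> (k + N))" by (rule summable_ignore_initial_segment[OF \<beta>(2)])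
  have s1: "summable (\<lambda>k. \<kappa> (t * \<beta> (k + N)))" if t: "t \<in> I" for t
  proof (rule summable_comparison_test'[of "\<lambda>k. M * t * \<beta> (k + N)" 0])
    show "summable (\<lambda>k. M * t * \<beta> (k + N))" using sb by (rule summable_mult)
    show "norm (\<kappa> (t * \<beta> (k + N))) \<le> M * t * \<beta> (k + N)" for k
    proof (cases "\<beta> (k + N) = 0")
      case False
      hence "t * \<beta> (k + N) > 0" using \<beta>(1)[of "k + N"] t by (simp add: I_def)
      thus ?thesis using M2[OF _ small[OF t]] by (simp add: mult_ac)
    qed (simp add: \<kappa>0)
  qed
  have db: "norm (\<beta> (k + N) * \<kappa>d (t * \<beta> (k + N))) \<le> M * \<beta> (k + N)" if t: "t \<in> I" for t k
  proof (cases "\<beta> (k + N) = 0")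
    case False
    hence p: "t * \<beta> (k + N) > 0" using \<beta>(1)[of "k + N"] t by (simp add: I_def)
    show ?thesis
      using mult_right_mono[OF M[OF p small[OF t]] \<beta>(1)[of "k + N"]] \<beta>(1)[of "k + N"]
      by (simp add: abs_mult mult_ac)
  qed simp
  have sM: "summable (\<lambda>k. M * \<beta> (k + N))" using sb by (rule summable_mult)
  have rI: "r \<in> I" using r by (simp add: I_def)
  show s\<kappa>: "summable (\<lambda>k. \<kappa> (r * \<beta> k))"
    using s1[OF rI] summable_iff_shift[of "\<lambda>k. \<kappa> (r * \<beta> k)" N] by simp
  have s2: "summable (\<lambda>k. \<beta> (k + N) * \<kappa>d (r * \<beta> (k + N)))"
    by (rule summable_comparison_test'[OF sM, of 0]) (use db[OF rI] in auto)
  thus sd: "summable (\<lambda>k. \<beta> k * \<kappa>d (r * \<beta> k))"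
    using summable_iff_shift[of "\<lambda>k. \<beta> k * \<kappa>d (r * \<beta> k)" N] by simp
  have dk: "((\<lambda>t. \<kappa> (t * \<beta> k)) has_field_derivative \<beta> k * \<kappa>d (t * \<beta> k)) (at t)"
    if "\<beta> k > 0 \<Longrightarrow> (\<kappa> has_field_derivative \<kappa>d (t * \<beta> k)) (at (t * \<beta> k))" for t k
  proof (cases "\<beta> k = 0")
    case True
    thus ?thesis by simp
  next
    case False
    hence "(\<kappa> has_field_derivative \<kappa>d (t * \<beta> k)) (at (t * \<beta> k))" using that \<beta>(1)[of k] by simp
    moreover have "((\<lambda>t. t * \<beta> k) has_field_derivative \<beta> k) (at t)"
      by (rule derivative_eq_intros refl | simp)+
    ultimately have "((\<lambda>t. \<kappa> (t * \<beta> k)) has_field_derivative \<kappa>d (t * \<beta> k) * \<beta> k) (at t)"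
      by (rule DERIV_chain2[where f = \<kappa> and g = "\<lambda>t. t * \<beta> k"])
    thus ?thesis by (simp only: mult.commute)
  qed
  have tail: "((\<lambda>t. \<Sum>k. \<kappa> (t * \<beta> (k + N))) has_field_derivative
      (\<Sum>k. \<beta> (k + N) * \<kappa>d (r * \<beta> (k + N)))) (at r)"
  proof (rule has_field_derivative_series'(2)[where S = I and ?x0.0 = r])
    show "convex I" by (simp add: I_def)
    show "((\<lambda>t. \<kappa> (t * \<beta> (k + N))) has_field_derivative \<beta> (k + N) * \<kappa>d (t * \<beta> (k + N))) (at t within I)"
      if "t \<in> I" for k t
      by (rule has_field_derivative_at_within, rule dk, rule d) (use that small[OF that] in \<open>auto simp: I_def\<close>)
    show "uniformly_convergent_on I (\<lambda>n t. \<Sum>i<n. \<beta> (i + N) * \<kappa>d (t * \<beta> (i + N)))"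
      by (rule Weierstrass_m_test'[OF db sM])
    show "summable (\<lambda>k. \<kappa> (r * \<beta> (k + N)))" by (rule s1[OF rI])
    show "r \<in> interior I" using rI by (simp add: I_def interior_open)
  qed (rule rI)
  have split: "eventually (\<lambda>t. (\<Sum>k<N. \<kappa> (t * \<beta> k)) + (\<Sum>k. \<kappa> (t * \<beta> (k + N))) = (\<Sum>k. \<kappa> (t * \<beta> k))) (nhds r)"
  proof -
    have "eventually (\<lambda>t. t \<in> I) (nhds r)"
      by (rule eventually_nhds_in_open) (use rI in \<open>auto simp: I_def\<close>)
    thus ?thesis
    proof eventually_elim
      case (elim t)
      have "summable (\<lambda>k. \<kappa> (t * \<beta> k))"
        using s1[OF elim] summable_iff_shift[of "\<lambda>k. \<kappa> (t * \<beta> k)" N] by simp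
      from suminf_split_initial_segment[OF this, of N] show ?case by simp
    qed
  qed
  {
    assume D: "\<And>k. \<beta> k > 0 \<Longrightarrow> (\<kappa> has_field_derivative \<kappa>d (r * \<beta> k)) (at (r * \<beta> k))"
    have "((\<lambda>t. (\<Sum>k<N. \<kappa> (t * \<beta> k)) + (\<Sum>k. \<kappa> (t * \<beta> (k + N)))) has_field_derivative
       (\<Sum>k<N. \<beta> k * \<kappa>d (r * \<beta> k)) + (\<Sum>k. \<beta> (k + N) * \<kappa>d (r * \<beta> (k + N)))) (at r)"
      by (intro DERIV_add DERIV_sum dk D tail)
    also have "(\<Sum>k<N. \<beta> k * \<kappa>d (r * \<beta> k)) + (\<Sum>k. \<beta> (k + N) * \<kappa>d (r * \<beta> (k + N))) = (\<Sum>k. \<beta> k * \<kappa>d (r * \<beta> k))"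
      using suminf_split_initial_segment[OF sd, of N] by simp
    finally show "((\<lambda>r. \<Sum>k. \<kappa> (r * \<beta> k)) has_field_derivative (\<Sum>k. \<beta> k * \<kappa>d (r * \<beta> k))) (at r)"
      using DERIV_cong_ev[OF refl split refl] by simp
  }
  {
    assume C: "\<And>x. x \<ge> 0 \<Longrightarrow> isCont \<kappa> x"
    have "isCont (\<lambda>t. \<kappa> (t * \<beta> k)) r" for k
      by (rule isCont_o2[OF _ C]) (use r \<beta>(1) in \<open>auto intro!: continuous_intros\<close>)
    hence "isCont (\<lambda>t. (\<Sum>k<N. \<kappa> (t * \<beta> k)) + (\<Sum>k. \<kappa> (t * \<beta> (k + N)))) r"
      by (intro continuous_add DERIV_isCont[OF tail] continuous_sum)
    thus "isCont (\<lambda>r. \<Sum>k. \<kappa> (r * \<beta> k)) r"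
      using isCont_cong[OF split] by simp
  }
qed

section \<open>Arcs and circles\<close>

lemma sin_ge_half:
  assumes "0 \<le> t" "t \<le> pi / 2"
  shows "t / 2 \<le> sin t"
proof (cases "t \<le> pi / 3")
  case True
  have "sin 0 - 0 / 2 \<le> sin t - t / 2"
  proof (rule DERIV_nonneg_imp_nondecreasing[OF assms(1)])
    fix x assume x: "0 \<le> x" "x \<le> t"
    have "cos (pi / 3) \<le> cos x" using x True by (intro cos_monotone_0_pi_le) auto
    moreover have "((\<lambda>t. sin t - t / 2) has_real_derivative cos x - 1 / 2) (at x)"
      by (rule derivative_eq_intros refl | simp)+
    ultimately show "\<exists>y. ((\<lambda>t. sin t - t / 2) has_real_derivative y) (at x) \<and> 0 \<le> y"
      by (intro exI[of _ "cos x - 1/2"]) (simp add: cos_60)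
  qed
  thus ?thesis by simp
next
  case False
  have "sin (pi / 3) \<le> sin t" using False assms by (intro sin_monotone_2pi_le) auto
  moreover have "8 / 5 \<le> sqrt 3" by (rule real_le_rsqrt) (simp add: power2_eq_square)
  hence "sin (pi / 3) \<ge> 4 / 5" unfolding sin_60 by simp
  moreover have "pi \<le> 16 / 5" using pi_approx by simp
  ultimately show ?thesis using assms by simp
qed

lemma norm_cis_diff: "norm (cis s - cis t) = 2 * \<bar>sin ((s - t) / 2)\<bar>"
proof -
  have "cis s - cis t = cis t * (cis (s - t) - 1)"
    by (simp add: algebra_simps cis_mult)
  hence "norm (cis s - cis t) = norm (cis (s - t) - 1)" by (simp add: norm_mult)
  also have "\<dots> = 2 * \<bar>sin ((s - t) / 2)\<bar>"
    using dist_exp_i_1[of "s - t"] by (simp only: cis_conv_exp)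
  finally show ?thesis .
qed

lemma unit_eq_cis:
  assumes "norm \<zeta> = 1"
  obtains t where "\<zeta> = cis t" "- pi < t" "t \<le> pi"
proof
  have "\<zeta> \<noteq> 0" using assms by auto
  thus "\<zeta> = cis (Arg \<zeta>)" using assms cis_Arg[of \<zeta>] by (simp add: sgn_div_norm)
qed (use Arg_bounded in auto)

text \<open>A chord is at least half as long as its angle, so the angle stays within
  \<open>2 * \<epsilon>\<close> of the direction of \<open>\<zeta>\<close>. That direction is taken
  in \<open>(- pi, pi]\<close> while the parameter runs over \<open>[0, 2 * pi]\<close>, so the arc
  can show up around \<open>p\<close> and around \<open>p + 2 * pi\<close>: two intervals of length
  \<open>4 * \<epsilon>\<close>.\<close>

lemma emeasure_arc:
  assumes "norm \<zeta> = 1" "\<epsilon> \<ge> 0"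
  shows "emeasure lborel {t \<in> {0..2*pi}. norm (cis t - \<zeta>) < \<epsilon>} \<le> ennreal (8 * \<epsilon>)"
proof -
  obtain p where p: "\<zeta> = cis p" "- pi < p" "p \<le> pi" using unit_eq_cis[OF assms(1)] by metis
  let ?A = "{p - 2 * \<epsilon>..p + 2 * \<epsilon>}" and ?B = "{p + 2 * pi - 2 * \<epsilon>..p + 2 * pi + 2 * \<epsilon>}"
  have sub: "{t \<in> {0..2*pi}. norm (cis t - \<zeta>) < \<epsilon>} \<subseteq> ?A \<union> ?B"
  proof safe
    fix t assume t: "t \<in> {0..2*pi}" "norm (cis t - \<zeta>) < \<epsilon>" "t \<notin> ?B"
    define s where "s = (t - p) / 2"
    have s: "- (pi / 2) \<le> s" "s \<le> 3 * pi / 2" using t p by (auto simp: s_def)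
    have ns: "2 * \<bar>sin s\<bar> < \<epsilon>" using t(2) by (simp add: p norm_cis_diff s_def)
    have h: "\<bar>u\<bar> / 2 \<le> \<bar>sin u\<bar>" if "\<bar>u\<bar> \<le> pi / 2" for u
      using sin_ge_half[of "\<bar>u\<bar>"] that by (cases "u \<ge> 0") auto
    show "t \<in> ?A"
    proof (cases "s \<le> pi / 2")
      case True
      hence "\<bar>s\<bar> / 2 \<le> \<bar>sin s\<bar>" using s by (intro h) auto
      hence "\<bar>s\<bar> < \<epsilon>" using ns by linarith
      moreover have "t = p + 2 * s" by (simp add: s_def field_simps)
      ultimately show ?thesis by auto
    next
      case False
      have "\<bar>s - pi\<bar> / 2 \<le> \<bar>sin (s - pi)\<bar>" by (rule h) (use False s in linarith)
      also have "\<bar>sin (s - pi)\<bar> = \<bar>sin s\<bar>" by simp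
      finally have "\<bar>s - pi\<bar> / 2 \<le> \<bar>sin s\<bar>" .
      moreover have "u < \<epsilon>" if "u / 2 \<le> v" "2 * v < \<epsilon>" for u v :: real using that by linarith
      ultimately have "\<bar>s - pi\<bar> < \<epsilon>" using ns by blast
      hence "\<bar>t - p - 2 * pi\<bar> < 2 * \<epsilon>" by (simp add: s_def abs_if field_simps split: if_splits)
      hence "t \<in> ?B" by auto
      thus ?thesis using t(3) by blast
    qed
  qed
  have "emeasure lborel {t \<in> {0..2*pi}. norm (cis t - \<zeta>) < \<epsilon>} \<le> emeasure lborel (?A \<union> ?B)"
    using sub by (intro emeasure_mono) auto
  also have "\<dots> \<le> emeasure lborel ?A + emeasure lborel ?B"
    by (rule emeasure_subadditive) auto
  also have "\<dots> = ennreal (8 * \<epsilon>)" using assms(2) by (simp add: ennreal_plus[symmetric] del: ennreal_plus)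
  finally show ?thesis .
qed

lemma meas_arc [measurable]: "{t \<in> {0..2*pi}. norm (cis t - \<zeta>) < \<epsilon>} \<in> sets borel"
proof -
  have "{0..2*pi} \<inter> {t. norm (cis t - \<zeta>) < \<epsilon>} \<in> sets borel"
    by (intro sets.Int borel_closed borel_open open_Collect_less closed_real_atLeastAtMost
        continuous_intros) 
  thus ?thesis by (simp add: Int_def)
qed

text \<open>The law of cosines, arranged to separate the radial offset from the angular one.\<close>

lemma norm_one_minus_sq:
  assumes "norm \<zeta> = 1" "x \<ge> 0"
  shows "(norm (1 - of_real x * (cis t * cnj \<zeta>)))\<^sup>2 = (1 - x)\<^sup>2 + x * (norm (cis t - \<zeta>))\<^sup>2"
proof -
  obtain p where p: "\<zeta> = cis p" using unit_eq_cis[OF assms(1)] by metis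
  have z: "cis t * cnj \<zeta> = cis (t - p)" by (simp add: p cis_cnj cis_mult)
  have "(norm (cis t - \<zeta>))\<^sup>2 = (norm (cis p))\<^sup>2 * (norm (cis (t - p) - 1))\<^sup>2"
    unfolding p power_mult_distrib[symmetric] norm_mult[symmetric]
    by (simp add: algebra_simps cis_mult)
  hence n: "(norm (cis t - \<zeta>))\<^sup>2 = (norm (cis (t - p) - 1))\<^sup>2" by simp
  have c: "cos (t - p) * cos (t - p) = 1 - sin (t - p) * sin (t - p)"
    using sin_cos_squared_add[of "t - p"] by (simp add: power2_eq_square)
  show ?thesis unfolding n z unfolding cmod_power2
    by (simp add: power2_eq_square algebra_simps c)
qed

section \<open>Integrals of the Cauchy kernel over short arcs\<close>

definition arcT :: "real \<Rightarrow> real \<Rightarrow> real" where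
  "arcT \<delta> x = 24 * \<delta> * min 1 x + 176 * sqrt \<delta> * (x * wfund x)"

lemma arcT_nonneg: "\<delta> \<ge> 0 \<Longrightarrow> x \<ge> 0 \<Longrightarrow> arcT \<delta> x \<ge> 0"
  using wfund_nonneg[of x] by (simp add: arcT_def)

text \<open>Unless \<open>r * norm b\<close> is within 1/2 of 1, the integrand is bounded by
  \<open>3 * min 1 x\<close> and only the length of the arc matters. Otherwise the radial offset
  bounds it near the direction of the zero and the chord bounds it elsewhere.\<close>

lemma arc_integral:
  fixes b \<zeta> :: complex
  assumes r: "r > 0" and \<zeta>: "norm \<zeta> = 1" and \<delta>: "\<delta> \<ge> 0" and x1: "r * norm b \<noteq> 1"
  shows "(\<integral>\<^sup>+t. ennreal (r * norm b / norm (1 - b * (r * cis t))) *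
            indicator {t \<in> {0..2*pi}. norm (cis t - \<zeta>) < \<delta>} t \<partial>lborel) \<le> ennreal (arcT \<delta> (r * norm b))"
proof (cases "b = 0")
  case True
  thus ?thesis by simp
next
  case False
  define x where "x = r * norm b"
  have x: "x > 0" "x \<noteq> 1" using False r x1 by (auto simp: x_def)
  define A where "A = {t \<in> {0..2*pi}. norm (cis t - \<zeta>) < \<delta>}"
  have [measurable]: "A \<in> sets borel" unfolding A_def by (rule meas_arc)
  have mA: "emeasure lborel A \<le> ennreal (8 * \<delta>)" unfolding A_def by (rule emeasure_arc[OF \<zeta> \<delta>])
  define q where "q t = norm (1 - b * (r * cis t))" for t
  have q1: "\<bar>1 - x\<bar> \<le> q t" for t
    using norm_triangle_ineq3[of 1 "b * (r * cis t)"] r by (simp add: q_def x_def norm_mult mult_ac)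
  have ind: "(\<integral>\<^sup>+t. ennreal c * indicator B t \<partial>lborel) \<le> ennreal c * ennreal m"
    if "emeasure lborel B \<le> ennreal m" "B \<in> sets borel" for c m B
    using that by (subst nn_integral_cmult_indicator) (auto intro!: mult_left_mono)
  show ?thesis
  proof (cases "\<bar>x - 1\<bar> < 1/2")
    case far: False
    have le: "x / q t \<le> 3 * min 1 x" for t
    proof -
      have "x / q t \<le> x / \<bar>1 - x\<bar>" using q1[of t] x by (intro divide_left_mono) auto
      also have "\<dots> \<le> 3 * min 1 x" using far x by (auto simp: field_simps min_def abs_if split: if_splits)
      finally show ?thesis .
    qed
    have "(\<integral>\<^sup>+t. ennreal (x / q t) * indicator A t \<partial>lborel) \<le> (\<integral>\<^sup>+t. ennreal (3 * min 1 x) * indicator A t \<partial>lborel)"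
      using le by (intro nn_integral_mono mult_right_mono ennreal_leI) auto
    also have "\<dots> \<le> ennreal (3 * min 1 x) * ennreal (8 * \<delta>)" by (rule ind[OF mA]) simp
    also have "\<dots> = ennreal (24 * \<delta> * min 1 x)" using x \<delta> by (simp add: ennreal_mult[symmetric] mult_ac)
    also have "\<dots> \<le> ennreal (arcT \<delta> x)"
      unfolding arcT_def using \<delta> x wfund_nonneg[of x] by (intro ennreal_leI) simp
    finally show ?thesis by (simp add: x_def q_def A_def)
  next
    case near: True
    define \<xi> where "\<xi> = cnj (sgn b)"
    have \<xi>: "norm \<xi> = 1" using False by (simp add: \<xi>_def norm_sgn)
    have bz: "b * (r * cis t) = of_real x * (cis t * cnj \<xi>)" for t
    proof -
      have "b = norm b * sgn b" using False by (simp add: sgn_div_norm scaleR_conv_of_real)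
      thus ?thesis by (subst \<open>b = norm b * sgn b\<close>) (simp add: x_def \<xi>_def mult_ac)
    qed
    have q2: "sqrt x * norm (cis t - \<xi>) \<le> q t" for t
    proof (rule power2_le_imp_le)
      have "(q t)\<^sup>2 = (1 - x)\<^sup>2 + x * (norm (cis t - \<xi>))\<^sup>2"
        unfolding q_def bz using norm_one_minus_sq[OF \<xi>, of x t] x by simp
      thus "(sqrt x * norm (cis t - \<xi>))\<^sup>2 \<le> (q t)\<^sup>2"
        using x by (simp add: power_mult_distrib)
    qed (simp add: q_def)
    define d where "d = \<bar>x - 1\<bar>"
    have d: "0 < d" "d < 1/2" using x near by (auto simp: d_def)
    show ?thesis
    proof (cases "\<delta> = 0")
      case True
      hence e: "{t \<in> {0..2*pi}. norm (cis t - \<zeta>) < \<delta>} = {}" by auto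
      show ?thesis unfolding e by simp
    next
      case False
      hence \<delta>0: "\<delta> > 0" using \<delta> by simp
      \<comment> \<open>The geometric mean of arc size and radial offset balances the two
        contributions: both \<open>w / d\<close> and \<open>\<delta> / w\<close> become
        \<open>sqrt \<delta> / sqrt d\<close>.\<close>
      define w where "w = sqrt (\<delta> * d)"
      have w: "w > 0" using \<delta>0 d by (simp add: w_def)
      define B where "B = {t \<in> {0..2*pi}. norm (cis t - \<xi>) < w}"
      have [measurable]: "B \<in> sets borel" unfolding B_def by (rule meas_arc)
      have mB: "emeasure lborel B \<le> ennreal (8 * w)" unfolding B_def by (rule emeasure_arc[OF \<xi>]) (use w in simp)
      have le: "ennreal (x / q t) * indicator A t \<le>
          ennreal ((3/2) / d) * indicator B t + ennreal ((5/4) / w) * indicator A t" for t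
      proof (cases "t \<in> A")
        case tA: True
        show ?thesis
        proof (cases "t \<in> B")
          case True
          have "x \<le> 3/2" using near by linarith
          hence "x / q t \<le> (3/2) / d"
            using q1[of t] d by (intro frac_le) (auto simp: d_def abs_minus_commute)
          thus ?thesis using True tA by (simp add: add_increasing2 ennreal_leI)
        next
          case False
          hence nw: "norm (cis t - \<xi>) \<ge> w" using tA by (auto simp: A_def B_def)
          have "sqrt x * w \<le> sqrt x * norm (cis t - \<xi>)" using nw x by (intro mult_left_mono) auto
          hence "sqrt x * w \<le> q t" using q2[of t] by linarith
          moreover have sw: "0 < sqrt x * w" using x w by simp
          ultimately have "0 < q t" by linarith
          hence "x / q t \<le> x / (sqrt x * w)"
            using x sw \<open>sqrt x * w \<le> q t\<close> by (intro divide_left_mono mult_pos_pos[of "q t"]) auto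
          also have "\<dots> = sqrt x / w" using x w by (simp add: real_div_sqrt field_simps)
          also have "\<dots> \<le> (5/4) / w"
          proof -
            have "x \<le> 25/16" using near by linarith
            hence "sqrt x \<le> sqrt ((5/4)\<^sup>2)"
              by (intro real_sqrt_le_mono) (simp add: power2_eq_square)
            hence "sqrt x \<le> 5/4" by (simp only: real_sqrt_abs)
            thus ?thesis using w by (intro divide_right_mono) auto
          qed
          finally show ?thesis using tA False by (simp add: ennreal_leI)
        qed
      qed simp
      have "(\<integral>\<^sup>+t. ennreal (x / q t) * indicator A t \<partial>lborel) \<le>
         (\<integral>\<^sup>+t. ennreal ((3/2) / d) * indicator B t + ennreal ((5/4) / w) * indicator A t \<partial>lborel)"
        by (intro nn_integral_mono le)
      also have "\<dots> = (\<integral>\<^sup>+t. ennreal ((3/2) / d) * indicator B t \<partial>lborel) + (\<integral>\<^sup>+t. ennreal ((5/4) / w) * indicator A t \<partial>lborel)"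
        by (rule nn_integral_add) auto
      also have "\<dots> \<le> ennreal ((3/2) / d) * ennreal (8 * w) + ennreal ((5/4) / w) * ennreal (8 * \<delta>)"
        by (intro add_mono ind mA mB) auto
      also have "\<dots> = ennreal (12 * (w / d) + 10 * (\<delta> / w))"
        using d w \<delta> by (simp add: ennreal_mult[symmetric] ennreal_plus[symmetric] del: ennreal_plus)
      also have "\<dots> \<le> ennreal (arcT \<delta> x)"
      proof (rule ennreal_leI)
        have dd: "sqrt d * sqrt d = d" "sqrt d > 0" using d by auto
        have 1: "w / d = sqrt \<delta> / sqrt d" using d dd by (simp add: w_def real_sqrt_mult field_simps)
        have 2: "\<delta> / w = sqrt \<delta> / sqrt d" using \<delta>0 d by (simp add: w_def real_sqrt_mult field_simps)
        \<comment> \<open>Here \<open>1 / sqrt d \<le> 8 * (x * wfund x)\<close>, so the coefficient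
          in \<open>arcT\<close> is \<open>(12 + 10) * 8 = 176\<close>.\<close>
        have "1 / sqrt d = d powr (- (1/2))" using d by (simp add: powr_minus_divide powr_half_sqrt)
        also have "\<dots> \<le> d powr (- 3/4)" using d by (intro powr_mono') auto
        also have "\<dots> = 4 * wfund x" using near by (simp add: wfund_def d_def)
        also have "\<dots> \<le> 4 * (2 * (x * wfund x))"
        proof -
          have "1/2 \<le> x" using near by linarith
          from mult_right_mono[OF this wfund_nonneg[of x]] show ?thesis by simp
        qed
        finally have "sqrt \<delta> * (1 / sqrt d) \<le> sqrt \<delta> * (8 * (x * wfund x))"
          using \<delta> by (intro mult_left_mono) auto
        hence "12 * (w / d) + 10 * (\<delta> / w) \<le> 176 * sqrt \<delta> * (x * wfund x)" unfolding 1 2 by simp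
        moreover have "24 * \<delta> * min 1 x \<ge> 0" using \<delta> x by simp
        ultimately show "12 * (w / d) + 10 * (\<delta> / w) \<le> arcT \<delta> x" by (simp add: arcT_def)
      qed
      finally show ?thesis by (simp add: x_def q_def A_def)
    qed
  qed
qed

text \<open>With \<open>a = 1 / b\<close> the argument of \<open>Ln\<close> is
  \<open>1 + 1 / (z - a)\<close>, which avoids the branch cut for \<open>norm (z - a) > 1\<close>.
  If \<open>a\<close> lies outside the circle, the logarithm is holomorphic in a larger disc; if
  inside, it differs from \<open>1 / (z - a)\<close> by a function with a primitive.\<close>

lemma contour_Ln_shift:
  fixes b :: complex
  assumes r: "r > 0" and b: "b \<noteq> 0" and dist: "\<bar>r - 1 / norm b\<bar> \<ge> 4"
  shows "((\<lambda>z. Ln (1 - b / (1 - b * z))) has_contour_integral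
           (if r * norm b > 1 then 2 * of_real pi * \<i> else 0)) (circlepath 0 r)"
proof -
  define a where "a = 1 / b"
  have na: "norm a = 1 / norm b" by (simp add: a_def norm_divide)
  have form: "1 - b / (1 - b * z) = 1 + 1 / (z - a)" for z
  proof (cases "z = a")
    case True
    thus ?thesis using b by (simp add: a_def)
  next
    case False
    have e: "1 - b * z = b * (a - z)" using b by (simp add: a_def field_simps)
    have "b / (1 - b * z) = 1 / (a - z)" unfolding e using b False by simp
    also have "\<dots> = - (1 / (z - a))" by (metis divide_minus_right minus_diff_eq)
    finally show ?thesis by simp
  qed
  have nonpos: "1 + 1 / (z - a) \<notin> \<real>\<^sub>\<le>\<^sub>0" if "norm (z - a) > 1" for z
  proof
    assume "1 + 1 / (z - a) \<in> \<real>\<^sub>\<le>\<^sub>0"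
    hence "Re (1 / (z - a)) \<le> -1" by (auto simp: complex_nonpos_Reals_iff)
    moreover have "\<bar>Re (1 / (z - a))\<bar> \<le> 1 / norm (z - a)"
      using abs_Re_le_cmod[of "1 / (z - a)"] by (simp only: norm_divide norm_one)
    moreover have "1 / norm (z - a) < 1"
      using that by (intro divide_less_eq_1_pos[THEN iffD2]) linarith+
    ultimately show False by linarith
  qed
  show ?thesis unfolding form
  proof (cases "norm a < r")
    case True
    \<comment> \<open>\<open>P\<close> below is an explicit primitive of the difference:
      differentiating the logarithm in it yields exactly \<open>- 1 / (z - a)\<close>.\<close>
    hence ge: "norm a \<le> r - 4" using dist na by auto
    define P where "P z = (z - a + 1) * Ln (1 + 1 / (z - a))" for z
    have "((\<lambda>z. Ln (1 + 1 / (z - a)) - 1 / (z - a)) has_contour_integral 0) (circlepath 0 r)"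
    proof (rule Cauchy_theorem_primitive[of "{z. norm (z - a) > 1}" P])
      show "(P has_field_derivative Ln (1 + 1 / (z - a)) - 1 / (z - a)) (at z within {z. norm (z - a) > 1})"
        if z: "z \<in> {z. norm (z - a) > 1}" for z
      proof -
        have z0: "z - a \<noteq> 0" using z by auto
        have z1: "1 + 1 / (z - a) \<noteq> 0" using nonpos[of z] z by auto
        have d1: "((\<lambda>z. z - a + 1) has_field_derivative 1) (at z)"
          by (auto intro!: derivative_eq_intros)
        have d2: "((\<lambda>z. 1 + 1 / (z - a)) has_field_derivative - 1 / ((z - a) * (z - a))) (at z)"
          using z0 by (auto intro!: derivative_eq_intros)
        have d3: "(Ln has_field_derivative inverse (1 + 1 / (z - a))) (at (1 + 1 / (z - a)))"
          by (rule has_field_derivative_Ln) (use nonpos[of z] z in auto)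
        have d4: "((\<lambda>z. Ln (1 + 1 / (z - a))) has_field_derivative
            inverse (1 + 1 / (z - a)) * (- 1 / ((z - a) * (z - a)))) (at z)"
          by (rule DERIV_chain2[where f = Ln, OF d3 d2])
        have "(P has_field_derivative 1 * Ln (1 + 1 / (z - a)) +
            inverse (1 + 1 / (z - a)) * (- 1 / ((z - a) * (z - a))) * (z - a + 1)) (at z)"
          unfolding P_def by (rule DERIV_mult[OF d1 d4])
        hence "(P has_field_derivative Ln (1 + 1 / (z - a)) +
            inverse (1 + 1 / (z - a)) * (- 1 / ((z - a) * (z - a))) * (z - a + 1)) (at z within {z. norm (z - a) > 1})"
          by (simp only: mult_1 has_field_derivative_at_within)
        moreover have "inverse (1 + 1 / (z - a)) * (- 1 / ((z - a) * (z - a))) * (z - a + 1) = - (1 / (z - a))"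
        proof -
          have "1 + 1 / (z - a) = (z - a + 1) / (z - a)" using z0 by (simp add: field_simps)
          moreover have "z - a + 1 \<noteq> 0" using z1 z0 calculation by auto
          ultimately show ?thesis using z0 by (simp add: divide_simps)
        qed
        ultimately show ?thesis by simp
      qed
      show "path_image (circlepath 0 r) \<subseteq> {z. norm (z - a) > 1}"
      proof safe
        fix z assume "z \<in> path_image (circlepath 0 r)"
        hence "norm z = r" using r by simp
        thus "norm (z - a) > 1" using norm_triangle_ineq2[of z a] ge by simp
      qed
    qed auto
    moreover have "((\<lambda>z. 1 / (z - a)) has_contour_integral 2 * of_real pi * \<i> * winding_number (circlepath 0 r) a) (circlepath 0 r)"
      using has_contour_integral_winding_number[of "circlepath 0 r" a] True r by simp
    moreover have "winding_number (circlepath 0 r) a = 1"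
      by (rule winding_number_circlepath) (use True in auto)
    ultimately have "((\<lambda>z. (Ln (1 + 1 / (z - a)) - 1 / (z - a)) + 1 / (z - a)) has_contour_integral 0 + 2 * of_real pi * \<i>) (circlepath 0 r)"
      by (intro has_contour_integral_add) auto
    moreover have "r * norm b > 1" using True b by (simp add: na field_simps)
    ultimately show "((\<lambda>z. Ln (1 + 1 / (z - a))) has_contour_integral
           (if r * norm b > 1 then 2 * of_real pi * \<i> else 0)) (circlepath 0 r)" by simp
  next
    case False
    hence ge: "norm a \<ge> r + 4" using dist na by auto
    have "(\<lambda>z. Ln (1 + 1 / (z - a))) holomorphic_on ball 0 (r + 1)"
    proof (intro holomorphic_intros)
      fix z :: complex assume "z \<in> ball 0 (r + 1)"
      hence "norm (z - a) > 1" using norm_triangle_ineq2[of a z] ge by (simp add: norm_minus_commute)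
      thus "z - a \<noteq> 0" "1 + 1 / (z - a) \<notin> \<real>\<^sub>\<le>\<^sub>0" using nonpos by auto
    qed
    hence "((\<lambda>z. Ln (1 + 1 / (z - a))) has_contour_integral 0) (circlepath 0 r)"
      by (rule Cauchy_theorem_convex_simple) (use r in auto)
    moreover have "\<not> r * norm b > 1" using False b by (simp add: na field_simps)
    ultimately show "((\<lambda>z. Ln (1 + 1 / (z - a))) has_contour_integral
           (if r * norm b > 1 then 2 * of_real pi * \<i> else 0)) (circlepath 0 r)" by simp
  qed
qed

text \<open>Parametrised by half the angle from \<open>\<zeta>\<close>, the chord is
  \<open>2 * sin t\<close> on \<open>[0, pi]\<close>; as the sine rises and then falls, its
  superlevel sets are intervals. Connectedness is what prevents the imaginary part of a logarithm
  from changing branch on the set.\<close>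

lemma connected_arc:
  fixes \<zeta> :: complex
  assumes "norm \<zeta> = 1"
  shows "connected {z. norm z = 1 \<and> norm (z - \<zeta>) \<ge> \<delta>}"
proof -
  obtain p where p: "\<zeta> = cis p" using unit_eq_cis[OF assms] by metis
  define I where "I = {t \<in> {0..pi}. \<delta> / 2 \<le> sin t}"
  have "is_interval I"
    unfolding is_interval_1
  proof safe
    fix s u t assume su: "s \<in> I" "u \<in> I" and t: "s \<le> t" "t \<le> u"
    have st: "0 \<le> s" "u \<le> pi" "\<delta> / 2 \<le> sin s" "\<delta> / 2 \<le> sin u" using su by (auto simp: I_def)
    have "\<delta> / 2 \<le> sin t"
    proof (cases "t \<le> pi / 2")
      case True
      have "sin s \<le> sin t" using st t True by (intro sin_monotone_2pi_le) auto
      thus ?thesis using st by linarith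
    next
      case False
      have "sin (pi - u) \<le> sin (pi - t)" using st t False by (intro sin_monotone_2pi_le) auto
      thus ?thesis using st by simp
    qed
    thus "t \<in> I" using st t by (auto simp: I_def)
  qed
  hence "connected I" by (simp add: is_interval_connected_1)
  hence "connected ((\<lambda>t. cis (p + 2 * t)) ` I)"
    by (intro connected_continuous_image continuous_intros)
  moreover have "(\<lambda>t. cis (p + 2 * t)) ` I = {z. norm z = 1 \<and> norm (z - \<zeta>) \<ge> \<delta>}"
  proof (intro equalityI subsetI)
    fix z assume "z \<in> (\<lambda>t. cis (p + 2 * t)) ` I"
    then obtain t where t: "t \<in> I" "z = cis (p + 2 * t)" by auto
    have "norm (z - \<zeta>) = 2 * \<bar>sin t\<bar>" by (simp add: t p norm_cis_diff)
    thus "z \<in> {z. norm z = 1 \<and> norm (z - \<zeta>) \<ge> \<delta>}" using t by (auto simp: I_def)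
  next
    fix z assume z: "z \<in> {z. norm z = 1 \<and> norm (z - \<zeta>) \<ge> \<delta>}"
    obtain s where s: "z * cnj \<zeta> = cis s" "- pi < s" "s \<le> pi"
      using unit_eq_cis[of "z * cnj \<zeta>"] z assms by (auto simp: norm_mult)
    define t where "t = (if s \<ge> 0 then s / 2 else s / 2 + pi)"
    have t: "0 \<le> t" "t \<le> pi" using s by (auto simp: t_def)
    have "cis s = cis (2 * t)" by (auto simp: t_def cis.ctr sin_add cos_add algebra_simps)
    hence "z * cnj \<zeta> * \<zeta> = cis (2 * t) * cis p" using s p by simp
    moreover have "z * cnj \<zeta> * \<zeta> = z" by (simp add: p cis_cnj mult.assoc cis_mult)
    ultimately have zt: "z = cis (p + 2 * t)" by (simp add: cis_mult add.commute)
    have "norm (z - \<zeta>) = 2 * \<bar>sin t\<bar>" by (simp add: zt p norm_cis_diff)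
    hence "t \<in> I" using z t sin_ge_zero[of t] by (auto simp: I_def)
    thus "z \<in> (\<lambda>t. cis (p + 2 * t)) ` I" using zt by blast
  qed
  ultimately show ?thesis by simp
qed

section \<open>The logarithm of f (z + 1) / f z on circles away from the zeros\<close>

locale zero_free_circle =
  fixes b :: "nat \<Rightarrow> complex" and f :: "complex \<Rightarrow> complex" and r :: real
  assumes sm: "summable (\<lambda>k. norm (b k))" and r: "r > 0"
    and dist: "\<And>k. b k \<noteq> 0 \<Longrightarrow> \<bar>r - 1 / norm (b k)\<bar> \<ge> 4"
    and prod: "\<And>z. (\<lambda>n. \<Prod>k<n. 1 - b k * z) \<longlonglongrightarrow> f z / f 0" and f0: "f 0 \<noteq> 0"
    and fz: "\<And>z. norm z = r \<Longrightarrow> f z \<noteq> 0"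
begin

definition ell :: "nat \<Rightarrow> complex \<Rightarrow> complex" where
  "ell k z = Ln (1 - b k / (1 - b k * z))"

text \<open>A logarithm of \<open>f (z + 1) / f z\<close> assembled factor by factor. Each factor
  stays close to 1, so principal branches give a continuous sum, whereas \<open>Ln\<close> of the
  whole quotient could jump: the quotient may wind around 0.\<close>

definition L :: "complex \<Rightarrow> complex" where
  "L z = (\<Sum>k. ell k z)"

definition J :: real where "J = (\<Sum>k. min 1 (r * norm (b k)))"

definition W :: real where "W = (\<Sum>k. r * norm (b k) * wfund (r * norm (b k)))"

lemma ne1: "r * norm (b k) \<noteq> 1"
proof
  assume a: "r * norm (b k) = 1"
  hence "b k \<noteq> 0" by auto
  moreover from this a have "r = 1 / norm (b k)" by (simp add: field_simps)
  ultimately show False using dist[of k] by simp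
qed

text \<open>The distance 4 between circle and zeros keeps every factor
  \<open>1 - b k / (1 - b k * z)\<close> within 1/4 of 1, inside the range where \<open>Ln\<close>
  is linearly bounded.\<close>

lemma small:
  assumes z: "norm z = r"
  shows "4 * norm (b k) \<le> norm (1 - b k * z)"
proof (cases "b k = 0")
  case False
  have "4 * norm (b k) \<le> \<bar>r - 1 / norm (b k)\<bar> * norm (b k)"
    using dist[OF False] by (intro mult_right_mono) auto
  also have "\<dots> = \<bar>r * norm (b k) - 1\<bar>"
    using False by (simp add: abs_mult_pos left_diff_distrib)
  also have "\<dots> \<le> norm (1 - b k * z)"
    using norm_triangle_ineq3[of 1 "b k * z"] z by (simp add: norm_mult abs_minus_commute mult.commute)
  finally show ?thesis .
qed auto

lemma nz:
  assumes "norm z = r"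
  shows "1 - b k * z \<noteq> 0"
proof
  assume "1 - b k * z = 0"
  thus False using small[OF assms, of k] by (cases "b k = 0") auto
qed

lemma finite_near: "finite {k. r * norm (b k) > 1/2}" "finite {k. r * norm (b k) > 1}"
proof -
  have "(\<lambda>k. r * norm (b k)) \<longlonglongrightarrow> r * 0"
    by (intro tendsto_intros summable_LIMSEQ_zero sm)
  hence "eventually (\<lambda>k. r * norm (b k) < 1/2) sequentially" by (rule order_tendstoD) simp
  then obtain N where N: "\<And>k. k \<ge> N \<Longrightarrow> r * norm (b k) < 1/2" by (auto simp: eventually_sequentially)
  have "{k. r * norm (b k) > 1/2} \<subseteq> {..<N}" using N by (metis (mono_tags, lifting) leI lessThan_iff mem_Collect_eq order_less_asym subsetI)
  thus *: "finite {k. r * norm (b k) > 1/2}" by (rule finite_subset) simp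
  show "finite {k. r * norm (b k) > 1}" by (rule finite_subset[OF _ *]) auto
qed

lemma sum_J: "summable (\<lambda>k. min 1 (r * norm (b k)))"
  by (rule summable_comparison_test'[OF summable_mult[OF sm, of r], of 0]) (use r in auto)

lemma sum_W: "summable (\<lambda>k. r * norm (b k) * wfund (r * norm (b k)))"
proof (rule summable_finite[OF finite_near(1)])
  fix k assume "k \<notin> {k. r * norm (b k) > 1/2}"
  thus "r * norm (b k) * wfund (r * norm (b k)) = 0" by (simp add: wfund_def)
qed

lemma JW_nonneg: "J \<ge> 0" "W \<ge> 0"
  unfolding J_def W_def using r wfund_nonneg
  by (auto intro!: suminf_nonneg sum_J sum_W mult_nonneg_nonneg)

text \<open>A summable bound that is uniform over the circle, for the Weierstrass test; the
  dependence on \<open>r\<close> is harmless because \<open>r\<close> is fixed.\<close>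

lemma quot_bound:
  assumes z: "norm z = r"
  shows "norm (b k) / norm (1 - b k * z) \<le> (2 + r) * norm (b k)"
proof (cases "b k = 0")
  case False
  have pos: "norm (1 - b k * z) > 0" using nz[OF z] by simp
  have "1 \<le> (2 + r) * norm (1 - b k * z)"
  proof (cases "r * norm (b k) \<le> 1/2")
    case True
    have "1/2 \<le> norm (1 - b k * z)"
      using norm_triangle_ineq2[of 1 "b k * z"] z True by (simp add: norm_mult mult.commute)
    hence "2 * (1/2) \<le> (2 + r) * norm (1 - b k * z)" using r by (intro mult_mono) auto
    thus ?thesis by simp
  next
    case False
    have "1 \<le> r * (4 * norm (b k))" using False by simp
    also have "\<dots> \<le> (2 + r) * norm (1 - b k * z)" using small[OF z, of k] r by (intro mult_mono) auto
    finally show ?thesis .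
  qed
  hence "norm (b k) * 1 \<le> norm (b k) * ((2 + r) * norm (1 - b k * z))" by (intro mult_left_mono) auto
  thus ?thesis using pos by (simp add: divide_simps mult_ac)
qed auto

lemma quot_le:
  assumes z: "norm z = r"
  shows "norm (b k) / norm (1 - b k * z) \<le> 1/4"
  using small[OF z, of k] nz[OF z, of k] by (simp add: divide_simps)

lemma ell_bound:
  assumes z: "norm z = r"
  shows "norm (ell k z) \<le> 2 * (norm (b k) / norm (1 - b k * z))"
proof -
  have e: "norm (- (b k / (1 - b k * z))) = norm (b k) / norm (1 - b k * z)" by (simp add: norm_divide)
  have "norm (- (b k / (1 - b k * z))) < 1/2" unfolding e using quot_le[OF z, of k] by linarith
  from norm_Ln_le[OF this] show ?thesis by (simp add: ell_def norm_divide)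
qed

lemma ell_bound':
  assumes z: "norm z = r"
  shows "norm (ell k z) \<le> 2 * (2 + r) * norm (b k)"
proof -
  have "2 * (norm (b k) / norm (1 - b k * z)) \<le> 2 * ((2 + r) * norm (b k))"
    by (intro mult_left_mono quot_bound z) auto
  thus ?thesis using ell_bound[OF z, of k] by linarith
qed

lemma sum_M: "summable (\<lambda>k. 2 * (2 + r) * norm (b k))"
  by (rule summable_mult[OF sm])

lemma sum_ell:
  assumes z: "norm z = r"
  shows "summable (\<lambda>k. norm (ell k z))"
  by (rule summable_comparison_test'[OF sum_M, of 0]) (use ell_bound'[OF z] in auto)

lemma L_uniform: "uniform_limit (sphere 0 r) (\<lambda>n z. \<Sum>k<n. ell k z) L sequentially"
  unfolding L_def[abs_def] by (rule Weierstrass_m_test[OF _ sum_M]) (use ell_bound' in auto)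

lemma ell_arg:
  assumes z: "norm z = r"
  shows "1 - b k / (1 - b k * z) \<notin> \<real>\<^sub>\<le>\<^sub>0"
proof
  assume "1 - b k / (1 - b k * z) \<in> \<real>\<^sub>\<le>\<^sub>0"
  hence "1 \<le> Re (b k / (1 - b k * z))" by (auto simp: complex_nonpos_Reals_iff)
  also have "\<dots> \<le> norm (b k / (1 - b k * z))" by (rule complex_Re_le_cmod)
  also have "\<dots> \<le> 1/4" using quot_le[OF z, of k] by (simp add: norm_divide)
  finally show False by simp
qed

lemma L_continuous: "continuous_on (sphere 0 r) L"
proof (rule uniform_limit_theorem[OF _ L_uniform])
  show "eventually (\<lambda>n. continuous_on (sphere 0 r) (\<lambda>z. \<Sum>k<n. ell k z)) sequentially"
    unfolding ell_def using ell_arg nz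
    by (intro always_eventually allI continuous_intros) auto
qed simp

lemma exp_L:
  assumes z: "norm z = r"
  shows "exp (L z) = f (z + 1) / f z"
proof -
  have "(\<lambda>n. \<Sum>k<n. ell k z) \<longlonglongrightarrow> L z"
    using summable_LIMSEQ[OF summable_norm_cancel[OF sum_ell[OF z]]] by (simp add: L_def)
  hence "(\<lambda>n. (\<Prod>k<n. 1 - b k * z) * exp (\<Sum>k<n. ell k z)) \<longlonglongrightarrow> f z / f 0 * exp (L z)"
    by (intro tendsto_intros prod)
  also have "(\<lambda>n. (\<Prod>k<n. 1 - b k * z) * exp (\<Sum>k<n. ell k z)) = (\<lambda>n. \<Prod>k<n. 1 - b k * (z + 1))"
  proof
    fix n
    have e: "exp (ell k z) = 1 - b k / (1 - b k * z)" for k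
      unfolding ell_def using ell_arg[OF z, of k] by (intro exp_Ln) (metis nonpos_Reals_zero_I)
    have q: "q * (1 - c / q) = q - c" if "q \<noteq> 0" for q c :: complex
      using that by (simp add: field_simps)
    have "(1 - b k * z) * exp (ell k z) = 1 - b k * (z + 1)" for k
      unfolding e q[OF nz[OF z]] by (simp add: algebra_simps)
    thus "(\<Prod>k<n. 1 - b k * z) * exp (\<Sum>k<n. ell k z) = (\<Prod>k<n. 1 - b k * (z + 1))"
      by (simp add: exp_sum prod.distrib[symmetric])
  qed
  finally have "f z / f 0 * exp (L z) = f (z + 1) / f 0"
    by (rule LIMSEQ_unique[OF _ prod])
  thus ?thesis using f0 fz[OF z] by (simp add: field_simps)
qed

lemma contour_L: "(L has_contour_integral 2 * of_real pi * \<i> * of_nat (card {k. r * norm (b k) > 1})) (circlepath 0 r)"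
proof -
  let ?I = "2 * of_real pi * \<i> * of_nat (card {k. r * norm (b k) > 1})"
  have he: "(ell k has_contour_integral (if r * norm (b k) > 1 then 2 * of_real pi * \<i> else 0)) (circlepath 0 r)" for k
  proof (cases "b k = 0")
    case True
    thus ?thesis by (simp add: ell_def[abs_def] has_contour_integral_0)
  next
    case False
    show ?thesis unfolding ell_def[abs_def] by (rule contour_Ln_shift[OF r False dist[OF False]])
  qed
  have hs: "((\<lambda>z. \<Sum>k<n. ell k z) has_contour_integral
      (\<Sum>k<n. if r * norm (b k) > 1 then 2 * of_real pi * \<i> else 0)) (circlepath 0 r)" for n
    by (rule has_contour_integral_sum) (use he in auto)
  have 1: "eventually (\<lambda>n. (\<lambda>z. \<Sum>k<n. ell k z) contour_integrable_on (circlepath 0 r)) sequentially"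
    unfolding contour_integrable_on_def by (intro always_eventually allI exI) (rule hs)
  have lim: "(\<lambda>n. contour_integral (circlepath 0 r) (\<lambda>z. \<Sum>k<n. ell k z)) \<longlonglongrightarrow> contour_integral (circlepath 0 r) L"
    and int: "L contour_integrable_on (circlepath 0 r)"
    using contour_integral_uniform_limit_circlepath[OF 1 L_uniform] r by auto
  obtain N where N: "{k. r * norm (b k) > 1} \<subseteq> {..<N}"
    using finite_near(2) finite_nat_iff_bounded by auto
  have "contour_integral (circlepath 0 r) (\<lambda>z. \<Sum>k<n. ell k z) = ?I" if n: "n \<ge> N" for n
  proof -
    have "{..<n} \<inter> {k. r * norm (b k) > 1} = {k. r * norm (b k) > 1}" using N n by auto
    thus ?thesis
      using contour_integral_unique[OF hs[of n]] by (simp add: sum.If_cases mult_ac)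
  qed
  hence "eventually (\<lambda>n. contour_integral (circlepath 0 r) (\<lambda>z. \<Sum>k<n. ell k z) = ?I) sequentially"
    by (auto simp: eventually_sequentially)
  hence "contour_integral (circlepath 0 r) L = ?I"
    by (intro LIMSEQ_unique[OF lim] tendsto_eventually)
  thus ?thesis using int has_contour_integral_integral by fastforce
qed

text \<open>A majorant of \<open>r * norm (L z)\<close> at \<open>z = r * cis t\<close>; values in
  \<open>ennreal\<close> allow exchanging sum and integral without integrability conditions.\<close>

definition S :: "real \<Rightarrow> ennreal" where
  "S t = (\<Sum>k. ennreal (2 * (r * norm (b k) / norm (1 - b k * (r * cis t)))))"

lemma norm_rcis: "norm (of_real r * cis t) = r"
  using r by (simp add: norm_mult)

lemma L_le_S: "ennreal (norm (L (r * cis t)) * r) \<le> S t"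
proof -
  let ?z = "of_real r * cis t"
  have z: "norm ?z = r" by (rule norm_rcis)
  have "summable (\<lambda>k. norm (b k) / norm (1 - b k * ?z))"
    by (rule summable_comparison_test'[OF summable_mult[OF sm], of 0 _ "2 + r"])
       (use quot_bound[OF z] in auto)
  hence "summable (\<lambda>k. 2 * (norm (b k) / norm (1 - b k * ?z)))" by (rule summable_mult)
  hence s: "summable (\<lambda>k. 2 * (norm (b k) / norm (1 - b k * ?z)) * r)" by (rule summable_mult2)
  have "norm (L ?z) * r \<le> (\<Sum>k. norm (ell k ?z)) * r"
    unfolding L_def using r by (intro mult_right_mono summable_norm sum_ell z) auto
  also have "\<dots> = (\<Sum>k. norm (ell k ?z) * r)" by (rule suminf_mult2[OF sum_ell[OF z]])
  also have "\<dots> \<le> (\<Sum>k. 2 * (norm (b k) / norm (1 - b k * ?z)) * r)"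
    using r by (intro suminf_le s summable_mult2 sum_ell z mult_right_mono ell_bound) auto
  also have "\<dots> = (\<Sum>k. 2 * (r * norm (b k) / norm (1 - b k * ?z)))" by (simp add: mult_ac)
  finally have "ennreal (norm (L ?z) * r) \<le> ennreal (\<Sum>k. 2 * (r * norm (b k) / norm (1 - b k * ?z)))"
    by (rule ennreal_leI)
  also have "\<dots> = S t"
    unfolding S_def using s r by (intro suminf_ennreal2[symmetric]) (auto simp: mult_ac)
  finally show ?thesis by simp
qed

lemma S_measurable [measurable]: "S \<in> borel_measurable borel"
proof -
  have "continuous_on UNIV (\<lambda>t. 2 * (r * norm (b k) / norm (1 - b k * (r * cis t))))" for k
    using nz[OF norm_rcis] by (intro continuous_intros) auto
  hence "(\<lambda>t. 2 * (r * norm (b k) / norm (1 - b k * (r * cis t)))) \<in> borel_measurable borel" for k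
    by (rule borel_measurable_continuous_onI)
  hence [measurable]: "(\<lambda>t. ennreal (2 * (r * norm (b k) / norm (1 - b k * (r * cis t))))) \<in> borel_measurable borel" for k
    by (rule measurable_compose[OF _ measurable_ennreal])
  show ?thesis unfolding S_def[abs_def] by measurable
qed

lemma S_arc:
  fixes \<zeta> :: complex
  assumes \<zeta>: "norm \<zeta> = 1" and \<delta>: "\<delta> \<ge> 0"
  shows "(\<integral>\<^sup>+t. S t * indicator {t \<in> {0..2*pi}. norm (cis t - \<zeta>) < \<delta>} t \<partial>lborel)
           \<le> ennreal (48 * \<delta> * J + 352 * sqrt \<delta> * W)"
proof -
  define A where "A = {t \<in> {0..2*pi}. norm (cis t - \<zeta>) < \<delta>}"
  have [measurable]: "A \<in> sets borel" unfolding A_def by (rule meas_arc)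
  define q where "q k t = r * norm (b k) / norm (1 - b k * (r * cis t))" for k t
  have "continuous_on UNIV (q k)" for k
    unfolding q_def using nz[OF norm_rcis] by (intro continuous_intros) auto
  hence [measurable]: "q k \<in> borel_measurable borel" for k
    by (rule borel_measurable_continuous_onI)
  have s: "(\<lambda>k. 2 * arcT \<delta> (r * norm (b k))) sums (2 * (24 * \<delta> * J + 176 * sqrt \<delta> * W))"
    unfolding arcT_def J_def W_def
    by (intro sums_mult sums_add summable_sums sum_J sum_W)
  have "(\<integral>\<^sup>+t. S t * indicator A t \<partial>lborel) = (\<integral>\<^sup>+t. (\<Sum>k. ennreal (2 * q k t) * indicator A t) \<partial>lborel)"
    by (simp add: S_def q_def)
  also have "\<dots> = (\<Sum>k. \<integral>\<^sup>+t. ennreal (2 * q k t) * indicator A t \<partial>lborel)"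
    by (rule nn_integral_suminf) measurable
  also have "\<dots> = (\<Sum>k. \<integral>\<^sup>+t. 2 * (ennreal (q k t) * indicator A t) \<partial>lborel)"
  proof -
    have "q k t \<ge> 0" for k t using r by (simp add: q_def)
    hence "ennreal (2 * q k t) = 2 * ennreal (q k t)" for k t by (simp add: ennreal_mult)
    thus ?thesis by (simp add: mult.assoc)
  qed
  also have "\<dots> = (\<Sum>k. 2 * \<integral>\<^sup>+t. ennreal (q k t) * indicator A t \<partial>lborel)"
    by (subst nn_integral_cmult) measurable
  also have "\<dots> \<le> (\<Sum>k. ennreal (2 * arcT \<delta> (r * norm (b k))))"
  proof (rule suminf_le)
    fix k
    have "(\<integral>\<^sup>+t. ennreal (q k t) * indicator A t \<partial>lborel) \<le> ennreal (arcT \<delta> (r * norm (b k)))"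
      unfolding q_def A_def by (rule arc_integral[OF r \<zeta> \<delta> ne1])
    thus "2 * (\<integral>\<^sup>+t. ennreal (q k t) * indicator A t \<partial>lborel) \<le> ennreal (2 * arcT \<delta> (r * norm (b k)))"
      by (simp add: ennreal_mult' mult_left_mono)
  qed auto
  also have "\<dots> = ennreal (\<Sum>k. 2 * arcT \<delta> (r * norm (b k)))"
    using s \<delta> r by (intro suminf_ennreal2) (auto simp: sums_iff intro!: arcT_nonneg)
  also have "(\<Sum>k. 2 * arcT \<delta> (r * norm (b k))) = 48 * \<delta> * J + 352 * sqrt \<delta> * W"
    using s by (simp add: sums_iff)
  finally show ?thesis by (simp add: A_def)
qed

text \<open>Otherwise \<open>norm (L z)\<close> exceeds \<open>\<epsilon>\<close> off the arc, and
  its integral is too large. The majorant over the whole circle gives at most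
  \<open>2 * \<epsilon> * r\<close>, the arc at most \<open>\<epsilon> * r\<close>, and
  \<open>3 < 2 * pi\<close>.\<close>

lemma small_value:
  fixes \<zeta> :: complex
  assumes \<zeta>: "norm \<zeta> = 1" and \<delta>: "0 \<le> \<delta>" "\<delta> \<le> 1/10" and \<epsilon>: "\<epsilon> > 0"
    and JW: "96 * J + 352 * W \<le> \<epsilon> * r"
  obtains t where "norm (cis t - \<zeta>) \<ge> \<delta>" "norm (L (r * cis t)) \<le> \<epsilon>"
proof (rule ccontr)
  note witness = that
  assume neg: "\<not> thesis"
  have big: "norm (L (r * cis t)) > \<epsilon>" if "norm (cis t - \<zeta>) \<ge> \<delta>" for t
    using witness[OF that] neg by (meson not_le)
  define A where "A = {t \<in> {0..2*pi}. norm (cis t - \<zeta>) < \<delta>}"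
  have [measurable]: "A \<in> sets borel" unfolding A_def by (rule meas_arc)
  \<comment> \<open>Chords of the unit circle have length at most 2, so the arc estimate with 4 in
    place of \<open>\<delta>\<close> covers the full circle.\<close>
  have full: "{t \<in> {0..2*pi}. norm (cis t - \<zeta>) < 4} = {0..2*pi}"
  proof -
    have "norm (cis t - \<zeta>) < 4" for t using norm_triangle_ineq4[of "cis t" \<zeta>] \<zeta> by simp
    thus ?thesis by auto
  qed
  have "(\<integral>\<^sup>+t. ennreal (\<epsilon> * r) * indicator {0..2*pi} t \<partial>lborel)
      \<le> (\<integral>\<^sup>+t. S t * indicator {0..2*pi} t + ennreal (\<epsilon> * r) * indicator A t \<partial>lborel)"
  proof (rule nn_integral_mono)
    fix t
    show "ennreal (\<epsilon> * r) * indicator {0..2*pi} t \<le> S t * indicator {0..2*pi} t + ennreal (\<epsilon> * r) * indicator A t"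
    proof (cases "t \<in> {0..2*pi} - A")
      case True
      hence "norm (L (r * cis t)) > \<epsilon>" by (intro big) (auto simp: A_def)
      hence "ennreal (\<epsilon> * r) \<le> ennreal (norm (L (r * cis t)) * r)"
        using r by (intro ennreal_leI mult_right_mono) auto
      also have "\<dots> \<le> S t" by (rule L_le_S)
      finally show ?thesis using True by (simp add: add_increasing2)
    next
      case False
      thus ?thesis by (auto simp: indicator_def)
    qed
  qed
  also have "\<dots> = (\<integral>\<^sup>+t. S t * indicator {0..2*pi} t \<partial>lborel) + (\<integral>\<^sup>+t. ennreal (\<epsilon> * r) * indicator A t \<partial>lborel)"
    by (rule nn_integral_add) measurable
  also have "\<dots> \<le> ennreal (48 * 4 * J + 352 * sqrt 4 * W) + ennreal (\<epsilon> * r) * ennreal (8 * \<delta>)"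
  proof (rule add_mono)
    show "(\<integral>\<^sup>+t. S t * indicator {0..2*pi} t \<partial>lborel) \<le> ennreal (48 * 4 * J + 352 * sqrt 4 * W)"
      using S_arc[OF \<zeta>, of 4] unfolding full by simp
    have "emeasure lborel A \<le> ennreal (8 * \<delta>)" unfolding A_def by (rule emeasure_arc) (use \<zeta> \<delta> in auto)
    thus "(\<integral>\<^sup>+t. ennreal (\<epsilon> * r) * indicator A t \<partial>lborel) \<le> ennreal (\<epsilon> * r) * ennreal (8 * \<delta>)"
      by (subst nn_integral_cmult_indicator) (auto intro!: mult_left_mono)
  qed
  also have "\<dots> = ennreal (192 * J + 704 * W + \<epsilon> * r * (8 * \<delta>))"
    using JW_nonneg r \<epsilon> \<delta> by (simp add: ennreal_mult[symmetric] ennreal_plus[symmetric] del: ennreal_plus)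
  also have "(\<integral>\<^sup>+t. ennreal (\<epsilon> * r) * indicator {0..2*pi} t \<partial>lborel) = ennreal (\<epsilon> * r * (2 * pi))"
    using r \<epsilon> by (subst nn_integral_cmult_indicator) (auto simp: ennreal_mult)
  finally have "\<epsilon> * r * (2 * pi) \<le> 192 * J + 704 * W + \<epsilon> * r * (8 * \<delta>)"
    using JW_nonneg r \<epsilon> \<delta> by (subst (asm) ennreal_le_iff) auto
  also have "\<dots> \<le> 2 * (\<epsilon> * r) + \<epsilon> * r * 1"
    using JW \<delta> r \<epsilon> by (intro add_mono mult_left_mono) auto
  finally have "\<epsilon> * r * (2 * pi) \<le> \<epsilon> * r * 3" by simp
  moreover have "\<epsilon> * r * 3 < \<epsilon> * r * (2 * pi)" using r \<epsilon> pi_gt3 by (intro mult_strict_left_mono) auto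
  ultimately show False by simp
qed

text \<open>Where \<open>norm G \<le> M / r < 1/2\<close>, \<open>exp L = 1 + G\<close> has positive
  real part, so \<open>Im L\<close> never meets an odd multiple of \<open>pi / 2\<close>. The good
  set is connected and contains a point where \<open>L\<close> is at most 1, so \<open>L\<close> is
  the principal logarithm throughout it and \<open>r * norm L \<le> 2 * M\<close>. The integral
  \<open>2 * pi * n\<close> is then paid by this bound and the majorant on the arc. For
  \<open>\<delta> = 0\<close> the arc is empty.\<close>

lemma count_bound:
  fixes \<zeta> :: complex
  assumes \<zeta>: "norm \<zeta> = 1" and \<delta>: "0 \<le> \<delta>" "\<delta> \<le> 1/10" and M: "M \<ge> 0" "2 * M < r"
    and JW: "96 * J + 352 * W \<le> r"
    and G: "\<And>w :: complex. norm w = 1 \<Longrightarrow> norm (w - \<zeta>) \<ge> \<delta> \<Longrightarrow> norm ((f (r * w + 1) - f (r * w)) / f (r * w)) \<le> M / r"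
  shows "real (card {k. r * norm (b k) > 1}) \<le> 2 * M + 8 * \<delta> * J + 60 * sqrt \<delta> * W"
proof -
  define T where "T = {w :: complex. norm w = 1 \<and> norm (w - \<zeta>) \<ge> \<delta>}"
  define g where "g w = (f (r * w + 1) - f (r * w)) / f (r * w)" for w :: complex
  have nrw: "norm (r * w) = r" if "w \<in> T" for w :: complex using that r by (simp add: T_def norm_mult)
  have eL: "exp (L (r * w)) = 1 + g w" if "w \<in> T" for w :: complex
    using exp_L[OF nrw[OF that]] fz[OF nrw[OF that]] by (simp add: g_def field_simps)
  have g_le: "norm (g w) \<le> M / r" if "w \<in> T" for w :: complex
    using G[of w] that by (simp add: T_def g_def)
  have Mr: "M / r < 1/2" using M r by (simp add: field_simps)
  obtain t where t: "norm (cis t - \<zeta>) \<ge> \<delta>" "norm (L (r * cis t)) \<le> 1"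
    using small_value[OF \<zeta> \<delta>, of 1] JW by auto
  define h where "h w = Im (L (r * w))" for w :: complex
  have "continuous_on T h"
    unfolding h_def
    by (intro continuous_intros continuous_on_compose2[OF L_continuous]) (use nrw in auto)
  moreover have "connected T" unfolding T_def by (rule connected_arc[OF \<zeta>])
  ultimately have conn: "connected (h ` T)" by (rule connected_continuous_image)
  have tT: "cis t \<in> T" using t by (simp add: T_def)
  have ht: "\<bar>h (cis t)\<bar> \<le> 1" using abs_Im_le_cmod[of "L (r * cis t)"] t by (simp add: h_def)
  have ncos: "cos (h w) > 0" if w: "w \<in> T" for w :: complex
  proof -
    have "Re (exp (L (r * w))) = exp (Re (L (r * w))) * cos (h w)" by (simp add: Re_exp h_def)
    moreover have "Re (1 + g w) > 0"
      using abs_Re_le_cmod[of "g w"] g_le[OF w] Mr unfolding plus_complex.sel one_complex.sel by linarith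
    ultimately show ?thesis using eL[OF w] by (simp add: zero_less_mult_iff)
  qed
  have hb: "\<bar>h w\<bar> < pi / 2" if w: "w \<in> T" for w :: complex
  proof (rule ccontr)
    assume "\<not> \<bar>h w\<bar> < pi / 2"
    hence "pi / 2 \<in> h ` T \<or> - (pi / 2) \<in> h ` T"
    proof (cases "h w \<ge> 0")
      case True
      hence "pi / 2 \<in> h ` T"
        using conn[unfolded connected_iff_interval, rule_format, of "h (cis t)" "h w" "pi / 2"]
          \<open>\<not> \<bar>h w\<bar> < pi / 2\<close> tT w ht pi_gt3 by auto
      thus ?thesis by blast
    next
      case False
      hence "- (pi / 2) \<in> h ` T"
        using conn[unfolded connected_iff_interval, rule_format, of "h w" "h (cis t)" "- (pi / 2)"]
          \<open>\<not> \<bar>h w\<bar> < pi / 2\<close> tT w ht pi_gt3 by auto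
      thus ?thesis by blast
    qed
    then obtain v where v: "v \<in> T" "h v = pi / 2 \<or> h v = - (pi / 2)"
      unfolding image_iff by metis
    have "cos (h v) = 0" using v(2) by (elim disjE) (simp_all only: cos_minus cos_pi_half)
    thus False using ncos[OF v(1)] by simp
  qed
  have LT: "norm (L (r * w)) * r \<le> 2 * M" if w: "w \<in> T" for w :: complex
  proof -
    have "L (r * w) = Ln (exp (L (r * w)))"
      using hb[OF w] by (intro Ln_exp[symmetric]) (auto simp: h_def)
    hence "norm (L (r * w)) = norm (Ln (1 + g w))" by (simp only: eL[OF w])
    also have "\<dots> \<le> 2 * norm (g w)" using g_le[OF w] Mr by (intro norm_Ln_le) linarith
    also have "\<dots> \<le> 2 * (M / r)" using g_le[OF w] by linarith
    finally show ?thesis using r by (simp add: field_simps)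
  qed
  define F where "F t = norm (L (r * cis t)) * r" for t
  define n where "n = card {k. r * norm (b k) > 1}"
  have cL: "continuous_on {0..2*pi} (\<lambda>t. L (r * cis t))"
    by (intro continuous_on_compose2[OF L_continuous] continuous_intros) (use norm_rcis in auto)
  have hi: "((\<lambda>t. L (r * cis t) * r * \<i> * cis t) has_integral 2 * of_real pi * \<i> * of_nat n) {0..2*pi}"
    using contour_L has_contour_integral_part_circlepath_iff[of 0 "2 * pi" L _ 0 r]
    by (simp add: circlepath_def n_def)
  have intF: "F integrable_on {0..2*pi}"
    unfolding F_def by (intro integrable_continuous_real continuous_intros cL)
  have "norm (integral {0..2*pi} (\<lambda>t. L (r * cis t) * r * \<i> * cis t)) \<le> integral {0..2*pi} F"
    by (rule integral_norm_bound_integral)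
       (use hi intF r in \<open>auto simp: has_integral_integrable F_def norm_mult\<close>)
  hence "2 * pi * n \<le> integral {0..2*pi} F"
    using integral_unique[OF hi] by (simp add: norm_mult)
  hence "ennreal (2 * pi * n) \<le> ennreal (integral {0..2*pi} F)" by (rule ennreal_leI)
  also have "\<dots> = (\<integral>\<^sup>+t. ennreal (F t) * indicator {0..2*pi} t \<partial>lborel)"
    by (rule nn_integral_has_integral_lebesgue'[symmetric, OF _ integrable_integral[OF intF]])
       (use r in \<open>simp add: F_def\<close>)
  also have "\<dots> \<le> (\<integral>\<^sup>+t. ennreal (2 * M) * indicator {0..2*pi} t +
      S t * indicator {t \<in> {0..2*pi}. norm (cis t - \<zeta>) < \<delta>} t \<partial>lborel)"
  proof (rule nn_integral_mono)
    fix t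
    let ?A = "{t \<in> {0..2*pi}. norm (cis t - \<zeta>) < \<delta>}"
    show "ennreal (F t) * indicator {0..2*pi} t \<le> ennreal (2 * M) * indicator {0..2*pi} t + S t * indicator ?A t"
    proof (cases "t \<in> {0..2*pi}")
      case tin: True
      show ?thesis
      proof (cases "t \<in> ?A")
        case True
        have "ennreal (F t) \<le> S t" unfolding F_def by (rule L_le_S)
        thus ?thesis using True tin by (simp add: add_increasing)
      next
        case False
        hence "F t \<le> 2 * M" unfolding F_def using tin by (intro LT) (auto simp: T_def)
        thus ?thesis using False tin by (simp add: ennreal_leI)
      qed
    qed auto
  qed
  also have "\<dots> = (\<integral>\<^sup>+t. ennreal (2 * M) * indicator {0..2*pi} t \<partial>lborel) +
     (\<integral>\<^sup>+t. S t * indicator {t \<in> {0..2*pi}. norm (cis t - \<zeta>) < \<delta>} t \<partial>lborel)"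
    by (rule nn_integral_add) (use meas_arc[of \<zeta> \<delta>] in measurable)
  also have "\<dots> \<le> ennreal (2 * M) * ennreal (2 * pi) + ennreal (48 * \<delta> * J + 352 * sqrt \<delta> * W)"
    by (intro add_mono S_arc[OF \<zeta> \<delta>(1)]) (subst nn_integral_cmult_indicator; simp)
  also have "\<dots> = ennreal (4 * pi * M + 48 * \<delta> * J + 352 * sqrt \<delta> * W)"
    using M \<delta> JW_nonneg
    by (simp add: ennreal_mult[symmetric] ennreal_plus[symmetric] mult_ac add.assoc del: ennreal_plus)
  finally have "2 * pi * n \<le> 4 * pi * M + 48 * \<delta> * J + 352 * sqrt \<delta> * W"
    using M \<delta> JW_nonneg by (subst (asm) ennreal_le_iff) (auto intro!: add_nonneg_nonneg)
  moreover have "48 * \<delta> * J \<le> 2 * pi * (8 * \<delta> * J)"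
    using pi_gt3 \<delta> JW_nonneg mult_right_mono[of 3 pi "\<delta> * J"] by simp
  moreover have "352 * sqrt \<delta> * W \<le> 2 * pi * (60 * sqrt \<delta> * W)"
  proof -
    have "0 \<le> sqrt \<delta> * W" using \<delta> JW_nonneg by simp
    moreover from this have "3 * (sqrt \<delta> * W) \<le> pi * (sqrt \<delta> * W)"
      using pi_gt3 by (intro mult_right_mono) auto
    ultimately show ?thesis by simp
  qed
  ultimately have "2 * pi * n \<le> 2 * pi * (2 * M + 8 * \<delta> * J + 60 * sqrt \<delta> * W)"
    by (simp add: algebra_simps)
  thus ?thesis unfolding n_def by (rule mult_left_le_imp_le) simp
qed

end

section \<open>Sums over the zeros\<close>

text \<open>The sums over zeros are continuous but have corners and singular derivatives at isolated
  radii; the fundamental theorem of calculus with finitely many exceptions tolerates both.\<close>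

lemma mono_off_finite_set:
  fixes h :: "real \<Rightarrow> real"
  assumes ab: "a \<le> b" and E: "finite E" and cont: "continuous_on {a..b} h"
    and der: "\<And>x. x \<in> {a<..<b} - E \<Longrightarrow> \<exists>y\<ge>0. (h has_field_derivative y) (at x)"
  shows "h a \<le> h b"
proof -
  define h' where "h' x = (if x \<in> {a<..<b} - E then (SOME y. y \<ge> 0 \<and> (h has_field_derivative y) (at x)) else 0)" for x
  have h': "h' x \<ge> 0 \<and> (h has_field_derivative h' x) (at x)" if "x \<in> {a<..<b} - E" for x
    using someI_ex[of "\<lambda>y. y \<ge> 0 \<and> (h has_field_derivative y) (at x)"] der[OF that] that
    by (auto simp: h'_def)
  have "(h' has_integral (h b - h a)) {a..b}"
    by (rule fundamental_theorem_of_calculus_interior_strong[OF E ab _ cont])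
       (use h' in \<open>auto simp: has_real_derivative_iff_has_vector_derivative\<close>)
  moreover have "0 \<le> h' x" for x
    using h'[of x] by (cases "x \<in> {a<..<b} - E") (auto simp: h'_def)
  ultimately have "0 \<le> h b - h a" by (rule has_integral_nonneg) 
  thus ?thesis by simp
qed

locale zero_weights =
  fixes \<beta> :: "nat \<Rightarrow> real" and \<sigma> :: real
  assumes \<beta>: "\<And>k. \<beta> k \<ge> 0" and \<sigma>: "1/2 \<le> \<sigma>" "\<sigma> < 3/5"
    and sm\<sigma>: "summable (\<lambda>k. \<beta> k powr \<sigma>)"
begin

definition "Jf r = (\<Sum>k. min 1 (r * \<beta> k))"
definition "Wf r = (\<Sum>k. r * \<beta> k * wfund (r * \<beta> k))"
definition "Af r = (\<Sum>k. gfun (r * \<beta> k))"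
definition "nf r = card {k. r * \<beta> k > 1}"
text \<open>\<open>sqrt r\<close> times the function \<open>F\<close> of the overview; with this
  normalisation all bounds are of order \<open>r powr \<sigma>\<close>.\<close>

definition "Phi r = (\<Sum>k. \<phi> (r * \<beta> k))"
text \<open>The logarithm of the canonical product at radius \<open>r\<close> as if all zeros lay on
  one ray through that point: the least value the true directions allow.\<close>

definition "us r = (\<Sum>k. ln \<bar>1 - r * \<beta> k\<bar>)"
definition "C\<sigma> = (\<Sum>k. \<beta> k powr \<sigma>)"
text \<open>Radii at which some term meets a corner or singularity of its kernel. They are locally
  finite in \<open>r > 0\<close>, which is what the monotonicity arguments need.\<close>

definition "exc = {r. \<exists>k. r * \<beta> k \<in> {1/2, 1, 3/2}}"

lemma sm: "summable \<beta>"
proof (rule summable_comparison_test_ev[OF _ sm\<sigma>])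
  have "eventually (\<lambda>k. \<beta> k powr \<sigma> < 1) sequentially"
    using order_tendstoD(2)[OF summable_LIMSEQ_zero[OF sm\<sigma>], of 1] by simp
  thus "eventually (\<lambda>k. norm (\<beta> k) \<le> \<beta> k powr \<sigma>) sequentially"
  proof eventually_elim
    case (elim k)
    have "\<beta> k < 1"
    proof (rule ccontr)
      assume "\<not> \<beta> k < 1"
      hence "1 \<le> \<beta> k powr \<sigma>" using \<sigma> by (intro ge_one_powr_ge_zero) auto
      thus False using elim by simp
    qed
    hence "\<beta> k powr 1 \<le> \<beta> k powr \<sigma>" using \<beta>[of k] \<sigma> by (intro powr_mono') auto
    thus ?case using \<beta>[of k] by simp
  qed
qed

lemma finite_ge: "c > 0 \<Longrightarrow> finite {k. \<beta> k \<ge> c}"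
proof -
  assume c: "c > 0"
  have "eventually (\<lambda>k. \<beta> k < c) sequentially"
    using order_tendstoD(2)[OF summable_LIMSEQ_zero[OF sm] c] .
  then obtain N where "\<And>k. k \<ge> N \<Longrightarrow> \<beta> k < c" by (auto simp: eventually_sequentially)
  hence "{k. \<beta> k \<ge> c} \<subseteq> {..<N}" by (metis (mono_tags, lifting) leI lessThan_iff mem_Collect_eq not_less subsetI)
  thus ?thesis by (rule finite_subset) simp
qed

lemma finite_nf: "r > 0 \<Longrightarrow> finite {k. r * \<beta> k > 1}"
  by (rule finite_subset[OF _ finite_ge[of "1 / r"]]) (auto simp: field_simps)

lemma finite_exc: "0 < a \<Longrightarrow> finite (exc \<inter> {a..b})"
proof -
  assume a: "0 < a"
  define K where "K = {k. \<beta> k \<ge> 1 / (2 * max a b)}"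
  have K: "finite K" unfolding K_def by (rule finite_ge) (use a in auto)
  have "exc \<inter> {a..b} \<subseteq> (\<Union>k\<in>K. {1/2 / \<beta> k, 1 / \<beta> k, 3/2 / \<beta> k})"
  proof
    fix r assume r: "r \<in> exc \<inter> {a..b}"
    then obtain k where k: "r * \<beta> k \<in> {1/2, 1, 3/2}" by (auto simp: exc_def)
    have r0: "r > 0" "r \<le> max a b" using r a by auto
    have "1/2 \<le> r * \<beta> k" using k by auto
    also have "\<dots> \<le> max a b * \<beta> k" using r0 \<beta> by (intro mult_right_mono) auto
    finally have "k \<in> K" using a by (simp add: K_def field_simps)
    moreover have "\<beta> k \<noteq> 0" using k by auto
    hence "r \<in> {1/2 / \<beta> k, 1 / \<beta> k, 3/2 / \<beta> k}" using k by (auto simp: field_simps)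
    ultimately show "r \<in> (\<Union>k\<in>K. {1/2 / \<beta> k, 1 / \<beta> k, 3/2 / \<beta> k})" by blast
  qed
  thus ?thesis by (rule finite_subset) (use K in auto)
qed

context
  fixes r :: real assumes r: "r > 0"
begin

lemma sum_min: "summable (\<lambda>k. min 1 (r * \<beta> k))"
  by (rule summable_comparison_test'[OF summable_mult[OF sm, of r], of 0]) (use r \<beta> in auto)

lemma sum_W: "summable (\<lambda>k. r * \<beta> k * wfund (r * \<beta> k))"
proof (rule summable_finite[OF finite_ge[of "1 / (2 * r)"]])
  fix k assume "k \<notin> {k. \<beta> k \<ge> 1 / (2 * r)}"
  hence "r * \<beta> k < 1/2" using r by (simp add: field_simps)
  thus "r * \<beta> k * wfund (r * \<beta> k) = 0" by (simp add: wfund_def)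
qed (use r in simp)

lemma gfun_kernel:
  shows sum_g: "summable (\<lambda>k. gfun (r * \<beta> k))"
    and sum_gd: "summable (\<lambda>k. \<beta> k * gfund (r * \<beta> k))"
    and Af_deriv': "r \<notin> exc \<Longrightarrow> (Af has_field_derivative (\<Sum>k. \<beta> k * gfund (r * \<beta> k))) (at r)"
    and Af_cont: "isCont Af r"
proof -
  have 1: "(gfun has_field_derivative gfund x) (at x)" if "0 < x" "x < 1/2" for x
    by (rule gfun_has_derivative) (use that in auto)
  have 2: "\<bar>gfund x\<bar> \<le> 4" if "0 < x" "x < 1/2" for x using gfund_small[of x] that by simp
  have 3: "\<bar>gfun x\<bar> \<le> 4 * x" if "0 < x" "x < 1/2" for x using gfun_bounds[of x] that by auto
  note K = kernel_sum[OF \<beta> sm, of "1/2" gfun gfund 4 r, OF _ gfun_0 1 2 3 r, simplified]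
  show "summable (\<lambda>k. gfun (r * \<beta> k))" by (rule K(1))
  show "summable (\<lambda>k. \<beta> k * gfund (r * \<beta> k))" by (rule K(2))
  show "(Af has_field_derivative (\<Sum>k. \<beta> k * gfund (r * \<beta> k))) (at r)" if "r \<notin> exc"
    unfolding Af_def[abs_def] using that
    by (intro K(3) gfun_has_derivative) (auto simp: exc_def)
  show "isCont Af r"
    unfolding Af_def[abs_def]
    by (rule K(4)) (use gfun_continuous in \<open>auto simp: continuous_on_eq_continuous_at\<close>)
qed

lemma phi_kernel:
  shows sum_phi: "summable (\<lambda>k. \<phi> (r * \<beta> k))"
    and sum_phid: "summable (\<lambda>k. \<beta> k * \<phi>d (r * \<beta> k))"
    and Phi_deriv': "r \<notin> exc \<Longrightarrow> (Phi has_field_derivative (\<Sum>k. \<beta> k * \<phi>d (r * \<beta> k))) (at r)"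
    and Phi_cont: "isCont Phi r"
proof -
  have 1: "(\<phi> has_field_derivative \<phi>d x) (at x)" if "0 < x" "x < 1/4" for x
    by (rule phi_has_derivative) (use that in auto)
  have 2: "\<bar>\<phi>d x\<bar> \<le> 4" if "0 < x" "x < 1/4" for x using phid_bound[of x] that by simp
  have 3: "\<bar>\<phi> x\<bar> \<le> 4 * x" if "0 < x" "x < 1/4" for x using phi_nonneg_le[of x] that by simp
  note K = kernel_sum[OF \<beta> sm, of "1/4" \<phi> \<phi>d 4 r, OF _ phi_0 1 2 3 r, simplified]
  show "summable (\<lambda>k. \<phi> (r * \<beta> k))" by (rule K(1))
  show "summable (\<lambda>k. \<beta> k * \<phi>d (r * \<beta> k))" by (rule K(2))
  show "(Phi has_field_derivative (\<Sum>k. \<beta> k * \<phi>d (r * \<beta> k))) (at r)" if "r \<notin> exc"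
    unfolding Phi_def[abs_def] using that r
    by (intro K(3) phi_has_derivative) (auto simp: exc_def)
  show "isCont Phi r"
    unfolding Phi_def[abs_def] by (rule K(4)) (use phi_continuous in auto)
qed

lemma min_le_powr: "x \<ge> 0 \<Longrightarrow> min 1 x \<le> x powr \<sigma>"
proof (cases "x < 1")
  case True
  assume "x \<ge> 0"
  hence "x powr 1 \<le> x powr \<sigma>" using True \<sigma> by (intro powr_mono') auto
  thus ?thesis using True \<open>x \<ge> 0\<close> by auto
next
  case False
  hence "1 \<le> x powr \<sigma>" using \<sigma> by (intro ge_one_powr_ge_zero) auto
  thus ?thesis by auto
qed

lemma powr_sums: "(\<lambda>k. (r * \<beta> k) powr \<sigma>) sums (r powr \<sigma> * C\<sigma>)"
proof -
  have "(\<lambda>k. r powr \<sigma> * \<beta> k powr \<sigma>) sums (r powr \<sigma> * C\<sigma>)"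
    unfolding C\<sigma>_def by (intro sums_mult summable_sums sm\<sigma>)
  thus ?thesis using r \<beta> by (simp add: powr_mult)
qed

lemma Jf_le: "Jf r \<le> r powr \<sigma> * C\<sigma>"
  unfolding Jf_def using powr_sums r \<beta>
  by (subst sums_unique[OF powr_sums]) (intro suminf_le min_le_powr sum_min, auto simp: sums_iff)

lemma Phi_le: "Phi r \<le> 8 * (r powr \<sigma> * C\<sigma>)"
proof -
  have s: "(\<lambda>k. 8 * (r * \<beta> k) powr \<sigma>) sums (8 * (r powr \<sigma> * C\<sigma>))" by (rule sums_mult[OF powr_sums])
  show ?thesis unfolding Phi_def sums_unique[OF s]
    by (intro suminf_le phi_le_powr sum_phi) (use s r \<beta> \<sigma> in \<open>auto simp: sums_iff\<close>)
qed

lemma Af_bounds: "Jf r \<le> Af r" "Af r \<le> 21/20 * Jf r"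
proof -
  show "Jf r \<le> Af r" unfolding Jf_def Af_def
    by (intro suminf_le gfun_bounds sum_min sum_g) (use r \<beta> in auto)
  have "Af r \<le> (\<Sum>k. 21/20 * min 1 (r * \<beta> k))" unfolding Af_def
    by (intro suminf_le gfun_bounds summable_mult sum_min sum_g) (use r \<beta> in auto)
  also have "\<dots> = 21/20 * Jf r" unfolding Jf_def by (rule suminf_mult[OF sum_min])
  finally show "Af r \<le> 21/20 * Jf r" .
qed

lemma Wf_nonneg: "Wf r \<ge> 0"
  unfolding Wf_def using r \<beta> wfund_nonneg by (intro suminf_nonneg sum_W) auto

lemma nf_sums: "(\<lambda>k. if r * \<beta> k > 1 then 1 else 0) sums real (nf r)"
proof -
  have "(\<lambda>k. if k \<in> {k. r * \<beta> k > 1} then 1 else 0) sums (\<Sum>k | r * \<beta> k > 1. 1::real)"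
    by (rule sums_If_finite_set[OF finite_nf[OF r]])
  thus ?thesis by (simp add: nf_def)
qed

lemma nf_le_Jf: "real (nf r) \<le> Jf r"
  unfolding Jf_def sums_unique[OF nf_sums]
  by (intro suminf_le sum_min) (use r \<beta> nf_sums in \<open>auto simp: sums_iff\<close>)

text \<open>Termwise, \<open>x * gfund x\<close> is \<open>min 1 x\<close> minus the indicator of
  \<open>x > 1\<close> plus \<open>x * wfund x / 80\<close>: the relation between \<open>J\<close>
  and the counting function, with a bonus from zeros close to the circle.\<close>

lemma Af_deriv:
  assumes "r \<notin> exc"
  obtains D where "(Af has_field_derivative D) (at r)" "r * D = Jf r - nf r + Wf r / 80"
proof
  let ?D = "\<Sum>k. \<beta> k * gfund (r * \<beta> k)"
  show "(Af has_field_derivative ?D) (at r)" by (rule Af_deriv'[OF assms])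
  have eq: "r * (\<beta> k * gfund (r * \<beta> k)) = min 1 (r * \<beta> k) - (if r * \<beta> k > 1 then 1 else 0) + r * \<beta> k * wfund (r * \<beta> k) / 80" for k
  proof -
    have "r * \<beta> k \<noteq> 1" using assms by (auto simp: exc_def)
    thus ?thesis by (auto simp: gfund_def algebra_simps)
  qed
  have "(\<lambda>k. r * (\<beta> k * gfund (r * \<beta> k))) sums (r * ?D)"
    by (intro sums_mult summable_sums sum_gd)
  moreover have "(\<lambda>k. r * (\<beta> k * gfund (r * \<beta> k))) sums (Jf r - nf r + Wf r / 80)"
    unfolding eq Jf_def Wf_def
    by (intro sums_add sums_diff sums_divide nf_sums summable_sums sum_min sum_W)
  ultimately show "r * ?D = Jf r - nf r + Wf r / 80" by (rule sums_unique2)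
qed

text \<open>The logarithmic series is written as a difference of two kernel series, which supplies
  its convergence as well as its value.\<close>

lemma us_sums:
  assumes "r \<notin> exc"
  shows "(\<lambda>k. ln \<bar>1 - r * \<beta> k\<bar>) sums us r"
    "(\<Sum>k. r * (\<beta> k * \<phi>d (r * \<beta> k))) = Phi r / 2 - us r"
proof -
  have eq: "ln \<bar>1 - r * \<beta> k\<bar> = \<phi> (r * \<beta> k) / 2 - r * (\<beta> k * \<phi>d (r * \<beta> k))" for k
  proof (cases "\<beta> k = 0")
    case False
    hence "r * \<beta> k > 0" "r * \<beta> k \<noteq> 1" using assms \<beta>[of k] r by (auto simp: exc_def)
    from x_phid[OF this] show ?thesis by (simp add: mult.assoc)
  qed simp
  have s1: "(\<lambda>k. \<phi> (r * \<beta> k) / 2) sums (Phi r / 2)"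
    unfolding Phi_def by (intro sums_divide summable_sums sum_phi)
  have s2: "summable (\<lambda>k. r * (\<beta> k * \<phi>d (r * \<beta> k)))" by (rule summable_mult[OF sum_phid])
  have "(\<lambda>k. ln \<bar>1 - r * \<beta> k\<bar>) sums (Phi r / 2 - (\<Sum>k. r * (\<beta> k * \<phi>d (r * \<beta> k))))"
    unfolding eq by (intro sums_diff s1 summable_sums s2)
  thus "(\<lambda>k. ln \<bar>1 - r * \<beta> k\<bar>) sums us r"
    "(\<Sum>k. r * (\<beta> k * \<phi>d (r * \<beta> k))) = Phi r / 2 - us r"
    by (simp_all add: us_def sums_iff)
qed

text \<open>Dividing by \<open>Phi r\<close>, the logarithmic derivative of \<open>F\<close> times
  \<open>r\<close> is \<open>- us r / Phi r\<close>.\<close>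

lemma Phi_deriv:
  assumes "r \<notin> exc"
  obtains D where "(Phi has_field_derivative D) (at r)" "r * D = Phi r / 2 - us r"
proof
  show "(Phi has_field_derivative (\<Sum>k. \<beta> k * \<phi>d (r * \<beta> k))) (at r)" by (rule Phi_deriv'[OF assms])
  show "r * (\<Sum>k. \<beta> k * \<phi>d (r * \<beta> k)) = Phi r / 2 - us r"
    using us_sums(2)[OF assms] suminf_mult[OF sum_phid, of r] by simp
qed

lemma us_le_Phi:
  assumes "r \<notin> exc"
  shows "us r \<le> Phi r / 2"
proof -
  have s1: "(\<lambda>k. \<phi> (r * \<beta> k) / 2) sums (Phi r / 2)"
    unfolding Phi_def by (intro sums_divide summable_sums sum_phi)
  show ?thesis
    unfolding us_def sums_unique[OF s1]
  proof (rule suminf_le)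
    fix k
    show "ln \<bar>1 - r * \<beta> k\<bar> \<le> \<phi> (r * \<beta> k) / 2"
      using phi_ge_ln[of "r * \<beta> k"] assms r \<beta>[of k] by (cases "\<beta> k = 0") (auto simp: exc_def)
  qed (use us_sums[OF assms] s1 in \<open>auto simp: sums_iff\<close>)
qed

end

lemma nf_large:
  assumes "infinite {k. \<beta> k \<noteq> 0}"
  shows "eventually (\<lambda>r. real (nf r) \<ge> c) at_top"
proof -
  obtain T where T: "T \<subseteq> {k. \<beta> k \<noteq> 0}" "finite T" "card T = nat \<lceil>c\<rceil>"
    using infinite_arbitrarily_large[OF assms] by blast
  have "eventually (\<lambda>r. \<forall>k\<in>T. r > 1 / \<beta> k) at_top"
    by (rule eventually_ball_finite[OF T(2)]) (auto intro: eventually_gt_at_top)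
  moreover have "eventually (\<lambda>r::real. r > 0) at_top" by (rule eventually_gt_at_top)
  ultimately show ?thesis
  proof eventually_elim
    case (elim r)
    have "T \<subseteq> {k. r * \<beta> k > 1}"
    proof
      fix k assume k: "k \<in> T"
      hence "\<beta> k > 0" using T(1) \<beta>[of k] by auto
      thus "k \<in> {k. r * \<beta> k > 1}" using elim k by (auto simp: field_simps)
    qed
    hence "card T \<le> nf r" unfolding nf_def by (intro card_mono finite_nf elim)
    thus ?case using T(3) by linarith
  qed
qed

text \<open>Each nonzero entry eventually contributes at least \<open>ln r\<close>, so with
  infinitely many of them every logarithmic error term is negligible against
  \<open>Phi\<close>.\<close>

lemma Phi_large:
  assumes "infinite {k. \<beta> k \<noteq> 0}"
  shows "eventually (\<lambda>r. Phi r \<ge> c * ln r) at_top"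
proof -
  obtain T where T: "T \<subseteq> {k. \<beta> k \<noteq> 0}" "finite T" "card T = nat \<lceil>c\<rceil>"
    using infinite_arbitrarily_large[OF assms] by blast
  have "eventually (\<lambda>r. \<forall>k\<in>T. r > (1 / \<beta> k)\<^sup>2) at_top"
    by (rule eventually_ball_finite[OF T(2)]) (auto intro: eventually_gt_at_top)
  moreover have "eventually (\<lambda>r::real. r > 1) at_top" by (rule eventually_gt_at_top)
  ultimately show ?thesis
  proof eventually_elim
    case (elim r)
    have r0: "r > 0" using elim by simp
    have "c * ln r \<le> real (card T) * ln r" using T(3) elim real_nat_ceiling_ge[of c]
      by (intro mult_right_mono) auto
    also have "\<dots> = (\<Sum>k\<in>T. ln r)" by simp
    also have "\<dots> \<le> (\<Sum>k\<in>T. \<phi> (r * \<beta> k))"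
    proof (rule sum_mono)
      fix k assume k: "k \<in> T"
      have b: "\<beta> k > 0" using T(1) \<beta>[of k] k by auto
      have "sqrt ((1 / \<beta> k)\<^sup>2) \<le> sqrt r" using elim k by (intro real_sqrt_le_mono) auto
      hence "1 / \<beta> k \<le> sqrt r" using b by simp
      hence "1 \<le> sqrt r * \<beta> k" using b by (simp add: field_simps)
      hence "sqrt r * 1 \<le> sqrt r * (sqrt r * \<beta> k)" using r0 by (intro mult_left_mono) auto
      hence s: "sqrt r \<le> r * \<beta> k" using r0 by (simp add: mult.assoc[symmetric])
      moreover have s1: "1 \<le> sqrt r" using elim by simp
      ultimately have "2 * ln (r * \<beta> k) \<le> \<phi> (r * \<beta> k)" by (intro phi_large) linarith
      moreover have "ln (sqrt r) \<le> ln (r * \<beta> k)" using s s1 by (intro ln_mono) linarith+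
      moreover have "ln (sqrt r) = ln r / 2" using r0 by (simp add: ln_sqrt)
      ultimately show "ln r \<le> \<phi> (r * \<beta> k)" by linarith
    qed
    also have "\<dots> \<le> Phi r"
      unfolding Phi_def using T(2) r0 \<beta> by (intro sum_le_suminf sum_phi) (auto intro: phi_nonneg)
    finally show ?case .
  qed
qed

end

section \<open>The growth argument\<close>

lemma linear_product_bounds:
  fixes c :: "'a \<Rightarrow> complex"
  assumes "finite K" "\<And>k. k \<in> K \<Longrightarrow> c k \<noteq> 0"
  obtains A where "A > 0" "eventually (\<lambda>r. \<forall>z. norm z = r \<longrightarrow>
     norm (\<Prod>k\<in>K. 1 - c k * z) \<le> A * r ^ card K \<and> r ^ card K \<le> A * norm (\<Prod>k\<in>K. 1 - c k * z)) at_top"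
proof -
  have "\<exists>A>0. eventually (\<lambda>r. \<forall>z. norm z = r \<longrightarrow>
     norm (\<Prod>k\<in>K. 1 - c k * z) \<le> A * r ^ card K \<and> r ^ card K \<le> A * norm (\<Prod>k\<in>K. 1 - c k * z)) at_top"
    using assms
  proof (induction K)
    case empty
    show ?case by (intro exI[of _ 1]) simp
  next
    case (insert j K)
    obtain A where A: "A > 0" "eventually (\<lambda>r. \<forall>z. norm z = r \<longrightarrow>
       norm (\<Prod>k\<in>K. 1 - c k * z) \<le> A * r ^ card K \<and> r ^ card K \<le> A * norm (\<Prod>k\<in>K. 1 - c k * z)) at_top"
      using insert by auto
    define m where "m = norm (c j)"
    have m: "m > 0" using insert.prems[of j] by (simp add: m_def)
    define B where "B = 1 + m + 2 / m"
    have B: "B \<ge> 1 + m" "B \<ge> 2 / m" "B > 0" using m by (auto simp: B_def add_pos_pos)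
    have "eventually (\<lambda>r::real. r \<ge> 1) at_top" "eventually (\<lambda>r::real. r \<ge> 2 / m) at_top"
      by (rule eventually_ge_at_top)+
    with A(2) have "eventually (\<lambda>r. \<forall>z. norm z = r \<longrightarrow>
       norm (\<Prod>k\<in>insert j K. 1 - c k * z) \<le> (B * A) * r ^ card (insert j K) \<and>
       r ^ card (insert j K) \<le> (B * A) * norm (\<Prod>k\<in>insert j K. 1 - c k * z)) at_top"
    proof eventually_elim
      case (elim r)
      show ?case
      proof (intro allI impI)
        fix z :: complex assume z: "norm z = r"
        have p: "norm (\<Prod>k\<in>K. 1 - c k * z) \<le> A * r ^ card K" "r ^ card K \<le> A * norm (\<Prod>k\<in>K. 1 - c k * z)"
          using elim(1) z by auto
        have "norm (1 - c j * z) \<le> 1 + m * r"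
          using norm_triangle_ineq4[of 1 "c j * z"] z by (simp add: norm_mult m_def)
        also have "\<dots> \<le> (1 + m) * r" using elim by (simp add: algebra_simps)
        also have "\<dots> \<le> B * r" using B elim by (intro mult_right_mono) auto
        finally have 1: "norm (1 - c j * z) \<le> B * r" .
        have "m * r \<le> 2 * (m * r - 1)" using elim(3) m by (simp add: field_simps)
        hence "r \<le> 2 / m * (m * r - 1)" using m by (simp add: field_simps)
        also have "\<dots> \<le> 2 / m * norm (1 - c j * z)"
          using norm_triangle_ineq2[of "c j * z" 1] z m
          by (intro mult_left_mono) (auto simp: norm_mult m_def norm_minus_commute)
        also have "\<dots> \<le> B * norm (1 - c j * z)" using B by (intro mult_right_mono) auto
        finally have 2: "r \<le> B * norm (1 - c j * z)" .
        have r0: "r \<ge> 0" using elim by simp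
        have "norm (1 - c j * z) * norm (\<Prod>k\<in>K. 1 - c k * z) \<le> (B * r) * (A * r ^ card K)"
          by (intro mult_mono 1 p) (use B r0 in auto)
        moreover have "r * r ^ card K \<le> (B * norm (1 - c j * z)) * (A * norm (\<Prod>k\<in>K. 1 - c k * z))"
          by (intro mult_mono 2 p) (use B r0 in auto)
        ultimately show "norm (\<Prod>k\<in>insert j K. 1 - c k * z) \<le> (B * A) * r ^ card (insert j K) \<and>
          r ^ card (insert j K) \<le> (B * A) * norm (\<Prod>k\<in>insert j K. 1 - c k * z)"
          using insert.hyps by (simp add: norm_mult mult_ac)
      qed
    qed
    moreover have "B * A > 0" using A B by simp
    ultimately show ?case by blast
  qed
  thus thesis using that by blast
qed

text \<open>Both zero lists share one index set: \<open>agree\<close> places common zeros at common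
  positions, and \<open>fin\<close> says that \<open>\<Delta>f\<close> has only finitely many zeros
  in excess, which is how finitely many zeros of \<open>G\<close> enter. The normalisation at 0 is
  arranged by translating \<open>f\<close>.\<close>

locale difference_zeros =
  fixes f :: "complex \<Rightarrow> complex" and b b' :: "nat \<Rightarrow> complex" and \<sigma> :: real
  assumes \<sigma>: "1/2 \<le> \<sigma>" "\<sigma> < 3/5"
    and sm: "summable (\<lambda>k. norm (b k) powr \<sigma>)"
    and f0: "f 0 \<noteq> 0" and d0: "f 1 \<noteq> f 0"
    and prodf: "\<And>z. (\<lambda>n. \<Prod>k<n. 1 - b k * z) \<longlonglongrightarrow> f z / f 0"
    and prodd: "\<And>z. (\<lambda>n. \<Prod>k<n. 1 - b' k * z) \<longlonglongrightarrow> (f (z + 1) - f z) / (f 1 - f 0)"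
    and agree: "\<And>k. b' k \<noteq> 0 \<Longrightarrow> b k \<noteq> 0 \<Longrightarrow> b' k = b k"
    and fin: "finite {k. b' k \<noteq> 0 \<and> b k = 0}"
    and inf: "infinite {k. b k \<noteq> 0}"
    and zero: "\<And>z. f z = 0 \<Longrightarrow> \<exists>k. b k * z = 1"
    and zero': "\<And>z. f (z + 1) = f z \<Longrightarrow> \<exists>k. b' k * z = 1"
begin

text \<open>Reciprocals of the zeros of \<open>f\<close> that \<open>\<Delta>f\<close> does not
  cancel, with multiplicity: the poles of \<open>G\<close>.\<close>

definition e :: "nat \<Rightarrow> complex" where "e k = (if b' k = 0 then b k else 0)"
definition G :: "complex \<Rightarrow> complex" where "G z = (f (z + 1) - f z) / f z"
definition Fin :: "nat set" where "Fin = {k. b' k \<noteq> 0 \<and> b k = 0}"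
definition P :: "complex \<Rightarrow> complex" where "P z = (\<Prod>k\<in>Fin. 1 - b' k * z)"

sublocale B: zero_weights "\<lambda>k. norm (b k)" \<sigma>
  by unfold_locales (use \<sigma> sm in auto)

sublocale E: zero_weights "\<lambda>k. norm (e k)" \<sigma>
proof unfold_locales
  show "summable (\<lambda>k. norm (e k) powr \<sigma>)"
    by (rule summable_comparison_test'[OF sm, of 0]) (use \<sigma> in \<open>auto simp: e_def\<close>)
qed (use \<sigma> in auto)

lemma Jf_unbounded: "eventually (\<lambda>r. B.Jf r \<ge> c) at_top"
proof -
  have i: "infinite {k. norm (b k) \<noteq> 0}" using inf by simp
  have "eventually (\<lambda>r::real. r > 0) at_top" by (rule eventually_gt_at_top)
  with B.nf_large[OF i, of c] show ?thesis
    by eventually_elim (use B.nf_le_Jf in fastforce)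
qed

text \<open>A zero at distance less than 4 has \<open>\<bar>x - 1\<bar> \<le> 6 / r\<close>, so its
  term alone makes \<open>Wf r\<close> at least \<open>(r / 6) powr (3/4) / 8\<close>, whereas
  \<open>K * Af r\<close> is only \<open>O (r powr \<sigma>)\<close> with
  \<open>\<sigma> < 3/4\<close>. So either the circle is far from all zeros or \<open>Wf\<close> is
  large enough to drive the growth of \<open>Af\<close> by itself.\<close>

lemma circle_ok:
  assumes K: "K \<ge> 0" and \<epsilon>: "\<epsilon> > 0"
  shows "eventually (\<lambda>r. r \<notin> B.exc \<longrightarrow> B.Wf r \<le> K * B.Af r \<longrightarrow>
     zero_free_circle b f r \<and> 96 * B.Jf r + 352 * B.Wf r \<le> \<epsilon> * r) at_top"
proof -
  define C where "C = B.C\<sigma>"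
  have C: "C \<ge> 0" unfolding C_def B.C\<sigma>_def by (intro suminf_nonneg sm) auto
  define Q where "Q = 8 * (K * (21/20)) * C"
  have "eventually (\<lambda>r::real. Q * r powr \<sigma> < (r / 6) powr (3/4)) at_top"
    using \<sigma>(2) by real_asymp
  moreover have "eventually (\<lambda>r::real. (96 + 352 * (K * (21/20))) * C * r powr \<sigma> \<le> \<epsilon> * r) at_top"
    using \<sigma> \<epsilon> by real_asymp
  moreover have "eventually (\<lambda>r::real. r \<ge> 12) at_top" by (rule eventually_ge_at_top)
  ultimately show ?thesis
  proof eventually_elim
    case (elim r)
    have r: "r > 0" using elim by simp
    show ?case
    proof (intro impI)
      assume ex: "r \<notin> B.exc" and W: "B.Wf r \<le> K * B.Af r"
      have "K * B.Af r \<le> K * (21/20 * B.Jf r)" using K B.Af_bounds[OF r] by (intro mult_left_mono)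
      also have "\<dots> \<le> K * (21/20 * (r powr \<sigma> * C))"
        using K B.Jf_le[OF r] by (intro mult_left_mono) (auto simp: C_def)
      finally have W2: "B.Wf r \<le> K * (21/20) * (r powr \<sigma> * C)" using W by simp
      have J2: "B.Jf r \<le> r powr \<sigma> * C" using B.Jf_le[OF r] by (simp add: C_def)
      have "96 * B.Jf r + 352 * B.Wf r \<le> 96 * (r powr \<sigma> * C) + 352 * (K * (21/20) * (r powr \<sigma> * C))"
        using W2 J2 by (intro add_mono mult_left_mono) auto
      also have "\<dots> = (96 + 352 * (K * (21/20))) * C * r powr \<sigma>" by (simp add: algebra_simps)
      also have "\<dots> \<le> \<epsilon> * r" by (rule elim)
      finally have JW: "96 * B.Jf r + 352 * B.Wf r \<le> \<epsilon> * r" .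
      have dist: "\<bar>r - 1 / norm (b k)\<bar> \<ge> 4" if bk: "b k \<noteq> 0" for k
      proof (rule ccontr)
        assume "\<not> \<bar>r - 1 / norm (b k)\<bar> \<ge> 4"
        hence lt: "\<bar>r - 1 / norm (b k)\<bar> < 4" by simp
        define x where "x = r * norm (b k)"
        have x: "x > 0" "x \<noteq> 1" using bk r ex by (auto simp: x_def B.exc_def)
        have rx: "1 / norm (b k) = r / x" using bk r by (simp add: x_def)
        have "\<bar>r - r / x\<bar> = r * \<bar>x - 1\<bar> / x"
        proof -
          have "r - r / x = r * (x - 1) / x" using x by (simp add: field_simps)
          thus ?thesis using r x by (simp add: abs_mult)
        qed
        hence lt': "r * \<bar>x - 1\<bar> < 4 * x" using lt rx x by (simp add: field_simps)
        have near: "\<bar>x - 1\<bar> < 1/2"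
        proof (rule ccontr)
          assume n: "\<not> \<bar>x - 1\<bar> < 1/2"
          have "12 * \<bar>x - 1\<bar> \<le> r * \<bar>x - 1\<bar>" using elim by (intro mult_right_mono) auto
          hence "12 * \<bar>x - 1\<bar> < 4 * x" using lt' by linarith
          thus False using n by (cases "x \<ge> 1") (simp_all add: abs_of_neg)
        qed
        have "x \<le> 3/2" using near by linarith
        hence "r * \<bar>x - 1\<bar> \<le> 6" using lt' by linarith
        hence "\<bar>x - 1\<bar> \<le> 6 / r" using r by (simp add: field_simps)
        hence "(6 / r) powr (-3/4) \<le> \<bar>x - 1\<bar> powr (-3/4)"
          using x by (intro powr_mono2') auto
        also have "\<dots> = 4 * wfund x" using near by (simp add: wfund_def)
        also have "\<dots> \<le> 4 * (2 * (x * wfund x))"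
        proof -
          have "1/2 \<le> x" using near by linarith
          from mult_right_mono[OF this wfund_nonneg[of x]] show ?thesis by simp
        qed
        also have "x * wfund x \<le> B.Wf r"
          unfolding B.Wf_def x_def
          using sum_le_suminf[OF B.sum_W[OF r], of "{k}"] r wfund_nonneg by auto
        also note W2
        also have "4 * (2 * (K * (21/20) * (r powr \<sigma> * C))) = Q * r powr \<sigma>"
          by (simp add: Q_def)
        also have "(6 / r) powr (-3/4) = (r / 6) powr (3/4)"
          using r by (simp add: powr_divide powr_minus field_simps)
        finally show False using elim by simp
      qed
      have "zero_free_circle b f r"
      proof
        show "summable (\<lambda>k. norm (b k))" by (rule B.sm)
        show "f z \<noteq> 0" if z: "norm z = r" for z
        proof
          assume "f z = 0"
          then obtain k where k: "b k * z = 1" using zero by blast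
          have "norm (b k) * norm z = 1" using arg_cong[OF k, of norm] by (simp add: norm_mult)
          hence "r * norm (b k) = 1" by (simp add: z mult.commute)
          thus False using ex by (auto simp: B.exc_def)
        qed
      qed (use r dist prodf f0 in auto)
      thus "zero_free_circle b f r \<and> 96 * B.Jf r + 352 * B.Wf r \<le> \<epsilon> * r" using JW by blast
    qed
  qed
qed

text \<open>\<open>h + ln Af - 7/10 * ln r\<close> has derivative at least
  \<open>(3/4 - 7/10) / r\<close> off isolated radii, so it is nondecreasing, but the upper bounds
  force it to minus infinity. \<open>h\<close> is left open because it is 0 when
  \<open>1 / G\<close> is rational and a multiple of \<open>ln F\<close> otherwise.\<close>

lemma final_contradiction:
  fixes h :: "real \<Rightarrow> real"
  assumes X: "\<And>a b. a > 0 \<Longrightarrow> finite (X \<inter> {a..b})"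
    and cont: "eventually (\<lambda>r. isCont h r) at_top"
    and der: "eventually (\<lambda>r. r \<notin> B.exc \<union> X \<longrightarrow> (\<exists>y. (h has_field_derivative y) (at r) \<and>
       r * y + (B.Jf r - real (B.nf r) + B.Wf r / 80) / B.Af r \<ge> 3/4)) at_top"
    and ub: "eventually (\<lambda>r. h r \<le> c + s * ln r) at_top" and s: "s + \<sigma> < 7/10"
  shows False
proof -
  define \<Theta> where "\<Theta> r = h r + ln (B.Af r) - 7/10 * ln r" for r
  have "eventually (\<lambda>r. isCont h r \<and> (r \<notin> B.exc \<union> X \<longrightarrow> (\<exists>y. (h has_field_derivative y) (at r) \<and>
       r * y + (B.Jf r - real (B.nf r) + B.Wf r / 80) / B.Af r \<ge> 3/4)) \<and> h r \<le> c + s * ln r \<and>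
       B.Jf r \<ge> 1 \<and> r > 0) at_top"
    using cont der ub Jf_unbounded[of 1] eventually_gt_at_top[of 0] by eventually_elim blast
  then obtain R where R: "\<And>r. r \<ge> R \<Longrightarrow> isCont h r" "\<And>r. r \<ge> R \<Longrightarrow> r \<notin> B.exc \<union> X \<Longrightarrow> \<exists>y. (h has_field_derivative y) (at r) \<and>
       r * y + (B.Jf r - real (B.nf r) + B.Wf r / 80) / B.Af r \<ge> 3/4" "\<And>r. r \<ge> R \<Longrightarrow> h r \<le> c + s * ln r"
       "\<And>r. r \<ge> R \<Longrightarrow> B.Jf r \<ge> 1" "\<And>r. r \<ge> R \<Longrightarrow> r > 0"
    unfolding eventually_at_top_linorder by metis
  have R0: "R > 0" using R(5) by blast
  have Apos: "B.Af r > 0" if "r \<ge> R" for r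
    using B.Af_bounds(1)[OF R(5)[OF that]] R(4)[OF that] by linarith
  have mono: "\<Theta> R \<le> \<Theta> r" if r: "r \<ge> R" for r
  proof (rule mono_off_finite_set[OF r])
    show "finite ((B.exc \<union> X) \<inter> {R..r})"
      using B.finite_exc[OF R0] X[OF R0] by (simp add: Int_Un_distrib2)
    have "isCont \<Theta> x" if "x \<ge> R" for x
      unfolding \<Theta>_def using R(1)[OF that] B.Af_cont[OF R(5)[OF that]] Apos[OF that] R(5)[OF that]
      by (intro continuous_intros) auto
    thus "continuous_on {R..r} \<Theta>" by (intro continuous_at_imp_continuous_on) auto
    show "\<exists>y\<ge>0. (\<Theta> has_field_derivative y) (at x)"
      if x: "x \<in> {R<..<r} - (B.exc \<union> X) \<inter> {R..r}" for x
    proof -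
      have xR: "x \<ge> R" "x \<notin> B.exc \<union> X" using x by auto
      have x0: "x > 0" using R(5)[OF xR(1)] .
      obtain y where y: "(h has_field_derivative y) (at x)"
        "x * y + (B.Jf x - real (B.nf x) + B.Wf x / 80) / B.Af x \<ge> 3/4" using R(2)[OF xR] by blast
      obtain D where D: "(B.Af has_field_derivative D) (at x)" "x * D = B.Jf x - B.nf x + B.Wf x / 80"
        using B.Af_deriv[OF x0] xR(2) by auto
      have lnA: "((\<lambda>x. ln (B.Af x)) has_field_derivative (1 / B.Af x * D)) (at x)"
        by (rule DERIV_chain2[OF DERIV_ln_divide[OF Apos[OF xR(1)]] D(1)])
      have "(\<Theta> has_field_derivative y + 1 / B.Af x * D - 7/10 * (1 / x)) (at x)"
        unfolding \<Theta>_def by (intro DERIV_diff DERIV_add y(1) lnA DERIV_cmult DERIV_ln_divide x0)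
      moreover have "y + 1 / B.Af x * D - 7/10 * (1 / x) \<ge> 0"
      proof -
        have "x * (y + 1 / B.Af x * D - 7/10 * (1 / x)) = x * y + (x * D) / B.Af x - 7/10"
          using x0 by (simp add: algebra_simps)
        also have "\<dots> \<ge> 0" unfolding D(2) using y(2) by linarith
        finally show ?thesis using x0 by (simp add: zero_le_mult_iff)
      qed
      ultimately show ?thesis by blast
    qed
  qed
  define C where "C = B.C\<sigma>"
  define t where "t = 7/10 - (s + \<sigma>)"
  have t: "t > 0" using s by (simp add: t_def)
  have up: "\<Theta> r \<le> c + ln (21/20 * C) - t * ln r" if r: "r \<ge> R" for r
  proof -
    have r0: "r > 0" using R(5)[OF r] .
    have J: "1 \<le> r powr \<sigma> * C" using R(4)[OF r] B.Jf_le[OF r0] by (simp add: C_def)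
    have C: "C > 0" using J r0 by (smt (verit) mult_nonneg_nonpos powr_ge_zero)
    have "B.Af r \<le> 21/20 * (r powr \<sigma> * C)" using B.Af_bounds(2)[OF r0] B.Jf_le[OF r0] by (simp add: C_def)
    hence "ln (B.Af r) \<le> ln (21/20 * (r powr \<sigma> * C))" using Apos[OF r] by (intro ln_mono) auto
    also have "21/20 * (r powr \<sigma> * C) = (21/20 * C) * r powr \<sigma>" by simp
    also have "ln \<dots> = ln (21/20 * C) + \<sigma> * ln r"
      using C r0 by (subst ln_mult) (auto simp: ln_powr)
    finally show ?thesis using R(3)[OF r] by (simp add: \<Theta>_def t_def algebra_simps)
  qed
  have "eventually (\<lambda>r. c + ln (21/20 * C) - t * ln r < \<Theta> R) at_top"
    using t by real_asymp
  moreover have "eventually (\<lambda>r. r \<ge> R) at_top" by (rule eventually_ge_at_top)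
  ultimately have "eventually (\<lambda>r::real. False) at_top"
  proof eventually_elim
    case (elim r)
    thus False using mono[of r] up[of r] by linarith
  qed
  thus False by simp
qed

lemma finite_Fin: "finite Fin" using fin by (simp add: Fin_def)

text \<open>Index by index, the factors of \<open>f\<close>, completed by those of \<open>P\<close>,
  equal the factors of \<open>\<Delta>f\<close> times those of \<open>e\<close>; the identity of
  partial products is exact once \<open>n\<close> passes all of \<open>Fin\<close>.\<close>

lemma E_limit:
  assumes d: "f (z + 1) \<noteq> f z"
  shows "(\<lambda>n. \<Prod>k<n. 1 - e k * z) \<longlonglongrightarrow> (f 1 - f 0) / f 0 * P z / G z"
proof -
  obtain N where N: "Fin \<subseteq> {..<N}" using finite_Fin finite_nat_iff_bounded by auto
  have eq: "(\<Prod>k<n. 1 - b k * z) * P z = (\<Prod>k<n. 1 - e k * z) * (\<Prod>k<n. 1 - b' k * z)" if "n \<ge> N" for n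
  proof -
    have "P z = (\<Prod>k<n. if k \<in> Fin then 1 - b' k * z else 1)"
      unfolding P_def using N that by (intro prod.mono_neutral_cong_left) auto
    hence "(\<Prod>k<n. 1 - b k * z) * P z = (\<Prod>k<n. (1 - b k * z) * (if k \<in> Fin then 1 - b' k * z else 1))"
      by (simp add: prod.distrib)
    also have "\<dots> = (\<Prod>k<n. (1 - e k * z) * (1 - b' k * z))"
    proof (rule prod.cong)
      fix k
      show "(1 - b k * z) * (if k \<in> Fin then 1 - b' k * z else 1) = (1 - e k * z) * (1 - b' k * z)"
        using agree[of k] by (cases "b' k = 0"; cases "b k = 0") (auto simp: e_def Fin_def)
    qed simp
    finally show ?thesis by (simp add: prod.distrib)
  qed
  let ?d = "(f (z + 1) - f z) / (f 1 - f 0)"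
  have dn: "?d \<noteq> 0" using d d0 by simp
  have "eventually (\<lambda>n. (\<Prod>k<n. 1 - b' k * z) \<noteq> 0) sequentially"
    by (rule tendsto_imp_eventually_ne[OF prodd dn])
  moreover have "eventually (\<lambda>n. n \<ge> N) sequentially" by (rule eventually_ge_at_top)
  ultimately have ev: "eventually (\<lambda>n. (\<Prod>k<n. 1 - b k * z) * P z / (\<Prod>k<n. 1 - b' k * z) = (\<Prod>k<n. 1 - e k * z)) sequentially"
    by eventually_elim (simp add: eq)
  have "(\<lambda>n. (\<Prod>k<n. 1 - b k * z) * P z / (\<Prod>k<n. 1 - b' k * z)) \<longlonglongrightarrow> f z / f 0 * P z / ?d"
    by (intro tendsto_intros prodf prodd dn)
  hence "(\<lambda>n. \<Prod>k<n. 1 - e k * z) \<longlonglongrightarrow> f z / f 0 * P z / ?d"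
    by (rule Lim_transform_eventually[OF _ ev])
  also have "f z / f 0 * P z / ?d = (f 1 - f 0) / f 0 * P z / G z"
    using d d0 f0 by (simp add: G_def field_simps)
  finally show ?thesis .
qed

lemma P_bounds:
  obtains A where "A > 0" "eventually (\<lambda>r. \<forall>z. norm z = r \<longrightarrow>
     norm (P z) \<le> A * r ^ card Fin \<and> r ^ card Fin \<le> A * norm (P z)) at_top"
  using linear_product_bounds[OF finite_Fin, of b'] by (auto simp: Fin_def P_def)

lemma diff_nonzero:
  assumes "norm z \<notin> B.exc" "P z \<noteq> 0"
  shows "f (z + 1) \<noteq> f z"
proof
  assume "f (z + 1) = f z"
  then obtain k where k: "b' k * z = 1" using zero' by blast
  hence bk: "b' k \<noteq> 0" by auto
  show False
  proof (cases "b k = 0")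
    case True
    thus False using assms(2) k bk finite_Fin by (auto simp: P_def Fin_def)
  next
    case False
    hence "b k * z = 1" using agree[OF bk] k by simp
    hence "norm z * norm (b k) = 1" by (metis mult.commute norm_mult norm_one)
    thus False using assms(1) by (auto simp: B.exc_def)
  qed
qed

lemma circle_sums_eq: "zero_free_circle b f r \<Longrightarrow> zero_free_circle.J b r = B.Jf r"
  "zero_free_circle b f r \<Longrightarrow> zero_free_circle.W b r = B.Wf r"
  by (simp_all add: zero_free_circle.J_def zero_free_circle.W_def B.Jf_def B.Wf_def)

lemma Af_pos_eventually: "eventually (\<lambda>r. B.Af r > 0 \<and> B.Jf r \<ge> c \<and> r > 0) at_top"
  using Jf_unbounded[of "max c 1"] eventually_gt_at_top[of 0]
proof eventually_elim
  case (elim r)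
  thus ?case using B.Af_bounds(1)[of r] by auto
qed

text \<open>\<open>G\<close> behaves like a power of \<open>r\<close>. If it is
  \<open>O (1 / r)\<close>, a circle away from the zeros encloses a bounded number of them, against
  infinitely many zeros. If it is bounded below, \<open>small_value\<close> contradicts this, as a
  small logarithm means small \<open>G\<close>. So every large circle passes close to a zero,
  \<open>Wf > 80 * Af\<close>, and the growth of \<open>Af\<close> alone is too fast.\<close>

lemma rational_case:
  assumes K: "finite {k. e k \<noteq> 0}"
  shows False
proof -
  define K where "K = {k. e k \<noteq> 0}"
  have finK: "finite K" using K by (simp add: K_def)
  define Q where "Q z = (\<Prod>k\<in>K. 1 - e k * z)" for z
  define c where "c = norm ((f 1 - f 0) / f 0)"
  have c: "c > 0" using d0 f0 by (simp add: c_def)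
  obtain A where A: "A > 0" "eventually (\<lambda>r. \<forall>z. norm z = r \<longrightarrow>
     norm (P z) \<le> A * r ^ card Fin \<and> r ^ card Fin \<le> A * norm (P z)) at_top" by (rule P_bounds)
  obtain A' where A': "A' > 0" "eventually (\<lambda>r. \<forall>z. norm z = r \<longrightarrow>
     norm (Q z) \<le> A' * r ^ card K \<and> r ^ card K \<le> A' * norm (Q z)) at_top"
    unfolding Q_def by (rule linear_product_bounds[OF finK, of e]) (auto simp: K_def)
  have lim: "norm (Q z) * norm (G z) = c * norm (P z)" if "f (z + 1) \<noteq> f z" "f z \<noteq> 0" for z
  proof -
    obtain N where N: "K \<subseteq> {..<N}" using finK finite_nat_iff_bounded by auto
    have "(\<Prod>k<n. 1 - e k * z) = Q z" if "n \<ge> N" for n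
      unfolding Q_def using N that by (intro prod.mono_neutral_right) (auto simp: K_def)
    hence "(\<lambda>n. \<Prod>k<n. 1 - e k * z) \<longlonglongrightarrow> Q z"
      by (intro tendsto_eventually) (auto simp: eventually_sequentially)
    hence "Q z = (f 1 - f 0) / f 0 * P z / G z"
      by (rule LIMSEQ_unique[OF _ E_limit[OF that(1)]])
    moreover have "G z \<noteq> 0" using that by (simp add: G_def)
    ultimately have "Q z * G z = (f 1 - f 0) / f 0 * P z" by (metis nonzero_eq_divide_eq)
    thus ?thesis by (metis c_def norm_mult)
  qed
  have key: "eventually (\<lambda>r. r \<notin> B.exc \<longrightarrow> B.Wf r > 80 * B.Af r) at_top"
  proof (cases "card Fin < card K")
    case True
    define M where "M = c * A * A'"
    have M: "M \<ge> 0" using c A A' by (simp add: M_def)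
    have i: "infinite {k. norm (b k) \<noteq> 0}" using inf by simp
    show ?thesis
      using circle_ok[of 80 1, simplified] A(2) A'(2) B.nf_large[OF i, of "2 * M + 1"]
        eventually_gt_at_top[of "2 * M"] eventually_ge_at_top[of 1]
    proof eventually_elim
      case (elim r)
      show ?case
      proof (intro impI, rule ccontr)
        assume ex: "r \<notin> B.exc" and "\<not> B.Wf r > 80 * B.Af r"
        hence z: "zero_free_circle b f r" and JW: "96 * B.Jf r + 352 * B.Wf r \<le> r" using elim(1) by auto
        have G: "norm ((f (r * w + 1) - f (r * w)) / f (r * w)) \<le> M / r" if w: "norm w = 1" for w :: complex
        proof (cases "f (r * w + 1) = f (r * w)")
          case True
          thus ?thesis using M elim by simp
        next
          case False
          have nrw: "norm (r * w) = r" using w elim by (simp add: norm_mult)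
          have fz: "f (r * w) \<noteq> 0" using zero_free_circle.fz[OF z nrw] .
          have "r ^ card K * norm (G (r * w)) \<le> A' * norm (Q (r * w)) * norm (G (r * w))"
            using elim(3) nrw by (intro mult_right_mono) auto
          also have "\<dots> = A' * (c * norm (P (r * w)))" using lim[OF False fz] by simp
          also have "\<dots> \<le> A' * (c * (A * r ^ card Fin))"
            using elim(2) nrw A' c by (intro mult_left_mono) auto
          finally have "r ^ card K * norm (G (r * w)) \<le> M * r ^ card Fin" by (simp add: M_def mult_ac)
          moreover have "r ^ (card Fin + 1) \<le> r ^ card K" using True elim by (intro power_increasing) auto
          hence "r ^ (card Fin + 1) * norm (G (r * w)) \<le> r ^ card K * norm (G (r * w))" by (intro mult_right_mono) auto
          ultimately have "r ^ card Fin * (r * norm (G (r * w))) \<le> r ^ card Fin * M" by (simp add: mult_ac)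
          hence "r * norm (G (r * w)) \<le> M" using elim by (simp add: mult_le_cancel_left_pos)
          thus ?thesis using elim by (simp add: G_def field_simps)
        qed
        have "real (B.nf r) \<le> 2 * M + 8 * 0 * zero_free_circle.J b r + 60 * sqrt 0 * zero_free_circle.W b r"
          unfolding B.nf_def
          by (rule zero_free_circle.count_bound[OF z, of 1 0 M])
             (use M elim JW G in \<open>auto simp: circle_sums_eq[OF z]\<close>)
        thus False using elim(4) by simp
      qed
    qed
  next
    case False
    define g where "g = c / (A * A')"
    have g: "g > 0" using c A A' by (simp add: g_def)
    have "isCont (exp :: complex \<Rightarrow> complex) 0" by (intro continuous_intros)
    then obtain \<epsilon>' where \<epsilon>': "\<epsilon>' > 0" "\<And>l :: complex. norm l < \<epsilon>' \<Longrightarrow> norm (exp l - 1) < g"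
      using g unfolding continuous_at_eps_delta by (auto simp: dist_norm)
    define \<epsilon> where "\<epsilon> = \<epsilon>' / 2"
    have \<epsilon>: "\<epsilon> > 0" "\<epsilon> < \<epsilon>'" using \<epsilon>' by (auto simp: \<epsilon>_def)
    show ?thesis
      using circle_ok[of 80 \<epsilon>, OF _ \<epsilon>(1), simplified] A(2) A'(2) eventually_ge_at_top[of 1]
    proof eventually_elim
      case (elim r)
      show ?case
      proof (intro impI, rule ccontr)
        assume ex: "r \<notin> B.exc" and "\<not> B.Wf r > 80 * B.Af r"
        hence z: "zero_free_circle b f r" and JW: "96 * B.Jf r + 352 * B.Wf r \<le> \<epsilon> * r" using elim(1) by auto
        obtain t where t: "norm (zero_free_circle.L b (r * cis t)) \<le> \<epsilon>"
          by (rule zero_free_circle.small_value[OF z, of 1 0 \<epsilon>]) (use JW \<epsilon> in \<open>auto simp: circle_sums_eq[OF z]\<close>)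
        define w where "w = of_real r * cis t"
        define l where "l = zero_free_circle.L b w"
        have nw: "norm w = r" using elim by (simp add: w_def norm_mult)
        have fz: "f w \<noteq> 0" using zero_free_circle.fz[OF z nw] .
        have "exp l = f (w + 1) / f w" unfolding l_def by (rule zero_free_circle.exp_L[OF z nw])
        hence Gl: "G w = exp l - 1" using fz by (simp add: G_def field_simps)
        have ln: "norm l \<le> \<epsilon>" using t by (simp add: l_def w_def)
        have Gs: "norm (G w) < g" using \<epsilon>'(2)[of l] ln \<epsilon> by (simp add: Gl)
        have "P w \<noteq> 0"
        proof
          assume "P w = 0"
          hence "r ^ card Fin \<le> 0" using elim(2) nw by auto
          moreover have "0 < r ^ card Fin" using elim(4) by simp
          ultimately show False by linarith
        qed
        hence False: "f (w + 1) \<noteq> f w" using diff_nonzero[of w] ex nw by simp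
        have "g \<le> norm (G w)"
        proof -
          have "r ^ card K * c \<le> r ^ card Fin * c"
            using \<open>\<not> card Fin < card K\<close> elim c by (intro mult_right_mono power_increasing) auto
          also have "\<dots> \<le> A * norm (P w) * c" using elim(2) nw c by (intro mult_right_mono) auto
          also have "\<dots> = A * (norm (Q w) * norm (G w))" using lim[OF False fz] by simp
          also have "\<dots> \<le> A * (A' * r ^ card K * norm (G w))"
            using elim(3) nw A by (intro mult_left_mono mult_right_mono) auto
          finally have "r ^ card K * c \<le> r ^ card K * (A * A' * norm (G w))" by (simp add: mult_ac)
          hence "c \<le> A * A' * norm (G w)" using elim by (simp add: mult_le_cancel_left_pos)
          thus ?thesis using A A' by (simp add: g_def field_simps)
        qed
        thus False using Gs by simp
      qed
    qed
  qed
  show False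
  proof (rule final_contradiction[of "{}" "\<lambda>_. 0" 0 0])
    show "eventually (\<lambda>r. r \<notin> B.exc \<union> {} \<longrightarrow> (\<exists>y. ((\<lambda>_. 0) has_field_derivative y) (at r) \<and>
       r * y + (B.Jf r - real (B.nf r) + B.Wf r / 80) / B.Af r \<ge> 3/4)) at_top"
      using key Af_pos_eventually[of 0]
    proof eventually_elim
      case (elim r)
      show ?case
      proof
        assume "r \<notin> B.exc \<union> {}"
        hence "B.Wf r > 80 * B.Af r" using elim by simp
        hence "B.Af r \<le> B.Jf r - real (B.nf r) + B.Wf r / 80" using B.nf_le_Jf[of r] elim by simp
        hence "1 \<le> (B.Jf r - real (B.nf r) + B.Wf r / 80) / B.Af r" using elim by simp
        thus "\<exists>y. ((\<lambda>_. 0) has_field_derivative y) (at r) \<and>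
          r * y + (B.Jf r - real (B.nf r) + B.Wf r / 80) / B.Af r \<ge> 3/4"
          by (intro exI[of _ "0::real"] conjI DERIV_const) linarith
      qed
    qed
  qed (use \<sigma> in auto)
qed

end

section \<open>Growth inequality in the infinite case\<close>

context difference_zeros
begin

text \<open>The product over \<open>e\<close> equals a constant times \<open>P / G\<close>, so a
  lower bound on \<open>G\<close> bounds it above polynomially. A nonzero limit rules out vanishing
  factors, so the logarithms of the partial products converge.\<close>

lemma log_E_bound:
  obtains N where "N > 0" "eventually (\<lambda>r. \<forall>z. norm z = r \<longrightarrow> norm (G z) > 1 / r \<longrightarrow>
     (\<exists>U. (\<lambda>k. ln (norm (1 - e k * z))) sums U \<and> U \<le> N * ln r)) at_top"
proof -
  define c where "c = norm ((f 1 - f 0) / f 0)"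
  have c: "c > 0" using d0 f0 by (simp add: c_def)
  obtain A where A: "A > 0" "eventually (\<lambda>r. \<forall>z. norm z = r \<longrightarrow>
     norm (P z) \<le> A * r ^ card Fin \<and> r ^ card Fin \<le> A * norm (P z)) at_top" by (rule P_bounds)
  \<comment> \<open>Two powers beyond the degree of \<open>P\<close>: one for
    \<open>1 / norm (G z) < r\<close>, one to absorb the constant \<open>c * A\<close>.\<close>
  define N where "N = real (card Fin + 2)"
  have "eventually (\<lambda>r. \<forall>z. norm z = r \<longrightarrow> norm (G z) > 1 / r \<longrightarrow>
     (\<exists>U. (\<lambda>k. ln (norm (1 - e k * z))) sums U \<and> U \<le> N * ln r)) at_top"
    using A(2) eventually_ge_at_top[of 1] eventually_ge_at_top[of "c * A"]
  proof eventually_elim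
    case (elim r)
    have r0: "r > 0" using elim by simp
    show ?case
    proof (intro allI impI)
      fix z assume z: "norm z = r" and Gz: "norm (G z) > 1 / r"
      have G0: "G z \<noteq> 0" using Gz r0 by auto
      hence d: "f (z + 1) \<noteq> f z" by (auto simp: G_def)
      have "0 < r ^ card Fin" using r0 by simp
      also have "\<dots> \<le> A * norm (P z)" using elim(1) z by blast
      finally have P0: "P z \<noteq> 0" by auto
      define E where "E = (f 1 - f 0) / f 0 * P z / G z"
      have E0: "E \<noteq> 0" using P0 G0 d0 f0 by (simp add: E_def)
      have lim: "(\<lambda>n. \<Prod>k<n. 1 - e k * z) \<longlonglongrightarrow> E" unfolding E_def by (rule E_limit[OF d])
      have nz: "1 - e k * z \<noteq> 0" for k
      proof
        assume k: "1 - e k * z = 0"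
        have "eventually (\<lambda>n. n > k) sequentially" by (rule eventually_gt_at_top)
        hence "eventually (\<lambda>n. (\<Prod>k<n. 1 - e k * z) = 0) sequentially"
          by eventually_elim (use k in \<open>auto simp: prod_zero_iff\<close>)
        hence "(\<lambda>n. \<Prod>k<n. 1 - e k * z) \<longlonglongrightarrow> 0" by (rule tendsto_eventually)
        with lim E0 show False using LIMSEQ_unique by blast
      qed
      have "(\<lambda>n. ln (norm (\<Prod>k<n. 1 - e k * z))) \<longlonglongrightarrow> ln (norm E)"
        using E0 by (intro tendsto_intros lim) auto
      also have "(\<lambda>n. ln (norm (\<Prod>k<n. 1 - e k * z))) = (\<lambda>n. \<Sum>k<n. ln (norm (1 - e k * z)))"
        using nz by (simp add: prod_norm[symmetric] ln_prod)
      finally have s: "(\<lambda>k. ln (norm (1 - e k * z))) sums ln (norm E)" by (simp add: sums_def)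
      have "norm E = c * norm (P z) / norm (G z)" by (simp add: E_def c_def norm_mult norm_divide)
      also have "\<dots> \<le> c * norm (P z) / (1 / r)"
        using Gz r0 c by (intro divide_left_mono mult_pos_pos) (auto intro: less_trans[of 0 "1 / r"])
      also have "\<dots> = c * norm (P z) * r" by simp
      also have "\<dots> \<le> c * (A * r ^ card Fin) * r"
        using elim(1) z c r0 by (intro mult_left_mono mult_right_mono) auto
      also have "\<dots> = (c * A) * r ^ (card Fin + 1)" by simp
      also have "\<dots> \<le> r * r ^ (card Fin + 1)" using elim r0 by (intro mult_right_mono) auto
      also have "\<dots> = r ^ (card Fin + 2)" by simp
      finally have "ln (norm E) \<le> ln (r ^ (card Fin + 2))" using E0 by (intro ln_mono) auto
      also have "\<dots> = N * ln r" unfolding N_def by (rule ln_realpow)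
      finally show "\<exists>U. (\<lambda>k. ln (norm (1 - e k * z))) sums U \<and> U \<le> N * ln r" using s by blast
    qed
  qed
  moreover have "N > 0" by (simp add: N_def)
  ultimately show thesis using that by blast
qed

lemma ln_norm_factor:
  fixes w :: complex
  assumes w: "norm w = 1" and a: "a \<noteq> 0" and r: "r > 0" "r * norm a \<noteq> 1"
  shows "ln (norm (1 - a * (r * w))) =
     ln ((1 - r * norm a)\<^sup>2 + r * norm a * (norm (w - cnj (sgn a)))\<^sup>2) / 2"
proof -
  obtain t where t: "w = cis t" using unit_eq_cis[OF w] by metis
  define \<zeta> where "\<zeta> = cnj (sgn a)"
  have \<zeta>: "norm \<zeta> = 1" using a by (simp add: \<zeta>_def norm_sgn)
  have az: "a * (r * w) = of_real (r * norm a) * (cis t * cnj \<zeta>)"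
  proof -
    have "a = norm a * sgn a" using a by (simp add: sgn_div_norm scaleR_conv_of_real)
    thus ?thesis by (subst \<open>a = norm a * sgn a\<close>) (simp add: \<zeta>_def t mult_ac)
  qed
  have sq: "(norm (1 - a * (r * w)))\<^sup>2 = (1 - r * norm a)\<^sup>2 + r * norm a * (norm (w - \<zeta>))\<^sup>2"
    unfolding az unfolding t using norm_one_minus_sq[OF \<zeta>, of "r * norm a" t] r by simp
  have "(1 - r * norm a)\<^sup>2 + r * norm a * (norm (w - \<zeta>))\<^sup>2 > 0"
    using r by (intro add_pos_nonneg) auto
  hence "norm (1 - a * (r * w)) > 0" unfolding sq[symmetric] by (simp add: zero_less_power2)
  hence "ln ((norm (1 - a * (r * w)))\<^sup>2) = 2 * ln (norm (1 - a * (r * w)))"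
    by (simp add: ln_realpow)
  thus ?thesis unfolding sq \<zeta>_def by simp
qed

text \<open>Each factor is smallest when its zero has the direction of the point, by the triangle
  inequality. A single point with \<open>U = O (ln r)\<close> therefore bounds \<open>us\<close> by
  \<open>O (ln r)\<close>, which is the almost monotonicity of \<open>F\<close>.\<close>

lemma one_point:
  fixes w :: complex
  assumes w: "norm w = 1" and r: "r > 0" "r \<notin> E.exc"
    and U: "(\<lambda>k. ln (norm (1 - e k * (r * w)))) sums U"
  shows "E.us r \<le> U"
proof (rule sums_le[OF _ E.us_sums(1)[OF r] U])
  fix k
  show "ln \<bar>1 - r * norm (e k)\<bar> \<le> ln (norm (1 - e k * (r * w)))"
  proof (rule ln_mono)
    have "r * norm (e k) \<noteq> 1" using r by (auto simp: E.exc_def)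
    thus "0 < \<bar>1 - r * norm (e k)\<bar>" by simp
    show "\<bar>1 - r * norm (e k)\<bar> \<le> norm (1 - e k * (r * w))"
      using norm_triangle_ineq3[of 1 "e k * (r * w)"] w r by (simp add: norm_mult mult_ac)
  qed
qed

text \<open>Two far apart points of a circle cannot both be close to the direction of the same zero.\<close>
lemma two_points:
  fixes w1 w2 :: complex
  assumes w: "norm w1 = 1" "norm w2 = 1" "norm (w1 - w2) \<ge> \<delta>" and \<delta>: "\<delta> > 0"
    and r: "r > 0" "r \<notin> E.exc"
    and U: "(\<lambda>k. ln (norm (1 - e k * (r * w1)))) sums U1" "(\<lambda>k. ln (norm (1 - e k * (r * w2)))) sums U2"
    and C: "C > 0" "\<And>x. x > 0 \<Longrightarrow> x \<noteq> 1 \<Longrightarrow> \<phi> x \<le> C * dgain \<delta> x + 4 * ln \<bar>1 - x\<bar>"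
  shows "E.Phi r \<le> C * (U1 + U2 - 2 * E.us r) + 4 * E.us r"
proof -
  let ?x = "\<lambda>k. r * norm (e k)"
  let ?u = "\<lambda>(w::complex) k. ln (norm (1 - e k * (r * w)))"
  let ?v = "\<lambda>k. ln \<bar>1 - ?x k\<bar>"
  have s: "(\<lambda>k. C * (?u w1 k + ?u w2 k - 2 * ?v k) + 4 * ?v k) sums (C * (U1 + U2 - 2 * E.us r) + 4 * E.us r)"
    by (intro sums_add sums_mult sums_diff U E.us_sums r)
  have "\<phi> (?x k) \<le> C * (?u w1 k + ?u w2 k - 2 * ?v k) + 4 * ?v k" for k
  proof (cases "e k = 0")
    case True
    thus ?thesis by simp
  next
    case False
    have x1: "?x k \<noteq> 1" using r by (auto simp: E.exc_def)
    have x0: "?x k > 0" using False r by simp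
    define \<zeta> where "\<zeta> = cnj (sgn (e k))"
    define h where "h w = ((1 - ?x k)\<^sup>2 + ?x k * (norm (w - \<zeta>))\<^sup>2)" for w
    have hu: "?u w k = ln (h w) / 2" if "norm w = 1" for w
      unfolding h_def \<zeta>_def by (rule ln_norm_factor[OF that False r(1) x1])
    have p: "(1 - ?x k)\<^sup>2 > 0" using x1 by simp
    have lv: "ln ((1 - ?x k)\<^sup>2) = 2 * ?v k"
    proof -
      have "ln (\<bar>1 - ?x k\<bar>\<^sup>2) = real 2 * ?v k" by (rule ln_realpow)
      thus ?thesis by simp
    qed
    have low: "?v k \<le> ?u w k" if "norm w = 1" for w
    proof -
      have "ln ((1 - ?x k)\<^sup>2) \<le> ln (h w)"
        using p x0 by (intro ln_mono) (auto simp: h_def)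
      thus ?thesis unfolding hu[OF that] lv by simp
    qed
    have high: "?v k + dgain \<delta> (?x k) \<le> ?u w k" if "norm w = 1" "norm (w - \<zeta>) \<ge> \<delta> / 2" for w
    proof -
      define q where "q = (1 - ?x k)\<^sup>2"
      have "(\<delta> / 2)\<^sup>2 \<le> (norm (w - \<zeta>))\<^sup>2" using that \<delta> by (intro power_mono) auto
      hence "?x k * (\<delta> / 2)\<^sup>2 \<le> ?x k * (norm (w - \<zeta>))\<^sup>2" using x0 by (intro mult_left_mono) auto
      hence "q + ?x k * (\<delta> / 2)\<^sup>2 \<le> h w" unfolding h_def q_def by (rule add_left_mono)
      moreover have "q * (1 + ?x k * \<delta>\<^sup>2 / (4 * q)) = q + ?x k * (\<delta> / 2)\<^sup>2" if "q > 0" for q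
        using that by (simp add: field_simps power2_eq_square)
      ultimately have le: "q * (1 + ?x k * \<delta>\<^sup>2 / (4 * q)) \<le> h w" using p by (simp add: q_def)
      have g0: "1 + ?x k * \<delta>\<^sup>2 / (4 * q) > 0" using x0 p by (intro add_pos_nonneg) (auto simp: q_def)
      have "ln q + ln (1 + ?x k * \<delta>\<^sup>2 / (4 * q)) = ln (q * (1 + ?x k * \<delta>\<^sup>2 / (4 * q)))"
        using p g0 by (subst ln_mult) (auto simp: q_def)
      also have "\<dots> \<le> ln (h w)" using le p g0 by (intro ln_mono) (auto simp: q_def)
      finally show ?thesis using lv unfolding hu[OF that(1)] dgain_def q_def by simp
    qed
    have "\<delta> \<le> norm (w1 - \<zeta>) + norm (w2 - \<zeta>)"
      using w(3) norm_triangle_ineq4[of "w1 - \<zeta>" "w2 - \<zeta>"] by simp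
    hence "norm (w1 - \<zeta>) \<ge> \<delta> / 2 \<or> norm (w2 - \<zeta>) \<ge> \<delta> / 2" by linarith
    hence "dgain \<delta> (?x k) \<le> ?u w1 k + ?u w2 k - 2 * ?v k"
      using high[of w1] high[of w2] low[of w1] low[of w2] w by fastforce
    hence "C * dgain \<delta> (?x k) \<le> C * (?u w1 k + ?u w2 k - 2 * ?v k)" using C(1) by (intro mult_left_mono) auto
    thus ?thesis using C(2)[OF x0 x1] by linarith
  qed
  hence "E.Phi r \<le> (\<Sum>k. C * (?u w1 k + ?u w2 k - 2 * ?v k) + 4 * ?v k)"
    unfolding E.Phi_def using s by (intro suminf_le E.sum_phi r) (auto simp: sums_iff)
  thus ?thesis using s by (simp add: sums_iff)
qed

text \<open>Small enough that \<open>8 * \<delta>c \<le> 1/100\<close> and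
  \<open>60 * sqrt \<delta>c \<le> 1/80\<close>, so that the arc terms in \<open>count_bound\<close>
  fit into \<open>J / 100\<close> and \<open>W / 80\<close>; an even power of 10 keeps the root
  rational.\<close>

definition \<delta>c :: real where "\<delta>c = 1 / 10 ^ 8"

lemma sqrt_\<delta>c: "sqrt \<delta>c = 1 / 10 ^ 4"
proof -
  have eq: "\<delta>c = (1 / 10 ^ 4)\<^sup>2" by (simp add: \<delta>c_def power2_eq_square)
  show ?thesis unfolding eq real_sqrt_abs by simp
qed

text \<open>Up to the factor \<open>1 / r\<close>, the sum is the logarithmic derivative of
  \<open>F powr (2 * C)\<close> times \<open>Af\<close>. Circles are classified by closeness to a
  zero and by the position of the points where \<open>norm G > 1 / r\<close>: none, two that are far
  apart, or all in one short arc.\<close>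

lemma key_inequality:
  assumes infE: "infinite {k. e k \<noteq> 0}"
    and C: "C > 0" "\<And>x. x > 0 \<Longrightarrow> x \<noteq> 1 \<Longrightarrow> \<phi> x \<le> C * dgain \<delta>c x + 4 * ln \<bar>1 - x\<bar>"
  shows "eventually (\<lambda>r. r \<notin> B.exc \<union> E.exc \<longrightarrow> E.Phi r > 0 \<and>
     2 * C * (- E.us r / E.Phi r) + (B.Jf r - real (B.nf r) + B.Wf r / 80) / B.Af r \<ge> 3/4) at_top"
proof -
  obtain N where N: "N > 0" and ev: "eventually (\<lambda>r. \<forall>z. norm z = r \<longrightarrow> norm (G z) > 1 / r \<longrightarrow>
     (\<exists>U. (\<lambda>k. ln (norm (1 - e k * z))) sums U \<and> U \<le> N * ln r)) at_top" by (rule log_E_bound)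
  define p where "p = 2 * C"
  have p: "p > 0" using C by (simp add: p_def)
  have iE: "infinite {k. norm (e k) \<noteq> 0}" using infE by simp
  have iB: "infinite {k. norm (b k) \<noteq> 0}" using inf by simp
  \<comment> \<open>The factor 20 makes the logarithmic error \<open>(p + 4) * N * ln r\<close> at
    most \<open>Phi / 20\<close>.\<close>
  define m where "m = 20 * (p + 4) * N + 1"
  have m: "m > 0" using p N by (simp add: m_def add_pos_pos)
  have p80: "80 * (p + 1) \<ge> 0" using p by simp
  show ?thesis
    using ev circle_ok[OF p80 zero_less_one] E.Phi_large[OF iE, of m] B.nf_large[OF iB, of 3]
      Af_pos_eventually[of 100] eventually_gt_at_top[of 2]
  proof eventually_elim
    case (elim r)
    have r: "r > 2" using elim by simp
    have lnr: "ln r > 0" using r by simp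
    have Ppos: "E.Phi r > 0" using elim(3) m lnr by (smt (verit) mult_pos_pos)
    have Nln: "20 * (p + 4) * N * ln r \<le> E.Phi r"
      using elim(3) lnr by (simp add: m_def algebra_simps)
    have Apos: "B.Af r > 0" and J: "B.Jf r \<ge> 100" using elim by auto
    have r0: "r > 0" using r by simp
    let ?R = "(B.Jf r - real (B.nf r) + B.Wf r / 80) / B.Af r"
    have R0: "?R \<ge> 0" using B.nf_le_Jf[OF r0] B.Wf_nonneg[OF r0] Apos by simp
    show ?case
    proof (intro impI conjI Ppos)
      assume ex: "r \<notin> B.exc \<union> E.exc"
      have "p * (- E.us r / E.Phi r) + ?R \<ge> 3/4"
      proof (cases "B.Wf r \<le> 80 * (p + 1) * B.Af r")
        \<comment> \<open>A circle possibly close to a zero: \<open>Af\<close> contributes at least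
          \<open>p + 1\<close>, while \<open>us \<le> Phi / 2\<close> limits the loss of
          \<open>F\<close> to \<open>p / 2\<close>.\<close>
        case False
        hence "80 * ((p + 1) * B.Af r) < B.Wf r" by (simp only: not_le mult.assoc)
        hence "(p + 1) * B.Af r \<le> B.Jf r - real (B.nf r) + B.Wf r / 80"
          using B.nf_le_Jf[OF r0] by linarith
        hence "p + 1 \<le> ?R" using Apos by (simp add: pos_le_divide_eq)
        moreover have "- E.us r / E.Phi r \<ge> - (1/2)"
          using E.us_le_Phi[OF r0] ex Ppos by (simp add: field_simps)
        hence "p * (- E.us r / E.Phi r) \<ge> p * (- (1/2))" using p by (intro mult_left_mono) auto
        ultimately show ?thesis using p by linarith
      next
        case True
        hence z: "zero_free_circle b f r" and JW: "96 * B.Jf r + 352 * B.Wf r \<le> r"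
          using elim(2) ex by auto
        have U: "\<exists>U. (\<lambda>k. ln (norm (1 - e k * (r * w)))) sums U \<and> U \<le> N * ln r"
          if "norm w = 1" "norm (G (r * w)) > 1 / r" for w :: complex
          using elim(1) that r0 by (simp add: norm_mult)
        show ?thesis
        proof (cases "\<exists>w::complex. norm w = 1 \<and> norm (G (r * w)) > 1 / r")
          \<comment> \<open>If \<open>norm G \<le> 1 / r\<close> on the entire circle, at most 2
            zeros are enclosed, which is impossible for large \<open>r\<close>.\<close>
          case False
          have "real (B.nf r) \<le> 2 * 1 + 8 * 0 * zero_free_circle.J b r + 60 * sqrt 0 * zero_free_circle.W b r"
            unfolding B.nf_def
            by (rule zero_free_circle.count_bound[OF z, of 1 0 1])
               (use r JW False in \<open>auto simp: circle_sums_eq[OF z] G_def not_less\<close>)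
          thus ?thesis using elim(4) by simp
        next
          case True
          then obtain \<zeta> :: complex where \<zeta>: "norm \<zeta> = 1" "norm (G (r * \<zeta>)) > 1 / r" by blast
          obtain U1 where U1: "(\<lambda>k. ln (norm (1 - e k * (r * \<zeta>)))) sums U1" "U1 \<le> N * ln r"
            using U[OF \<zeta>] by blast
          have us: "E.us r \<le> N * ln r" using one_point[OF \<zeta>(1) r0 _ U1(1)] ex U1(2) by auto
          show ?thesis
          proof (cases "\<exists>w::complex. norm w = 1 \<and> norm (w - \<zeta>) \<ge> \<delta>c \<and> norm (G (r * w)) > 1 / r")
            case True
            \<comment> \<open>Two separated points: the gain forces \<open>p * (- us)\<close> to be
              at least \<open>19/20 * Phi\<close>, so \<open>F\<close> alone grows fast
              enough.\<close>
            then obtain w :: complex where w: "norm w = 1" "norm (w - \<zeta>) \<ge> \<delta>c" "norm (G (r * w)) > 1 / r" by blast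
            obtain U2 where U2: "(\<lambda>k. ln (norm (1 - e k * (r * w)))) sums U2" "U2 \<le> N * ln r"
              using U[OF w(1,3)] by blast
            have "E.Phi r \<le> C * (U2 + U1 - 2 * E.us r) + 4 * E.us r"
              by (rule two_points[OF w(1) \<zeta>(1) w(2) _ r0 _ U2(1) U1(1) C]) (use ex in \<open>auto simp: \<delta>c_def\<close>)
            also have "C * (U2 + U1 - 2 * E.us r) \<le> C * (2 * (N * ln r) - 2 * E.us r)"
              using U1(2) U2(2) C(1) by (intro mult_left_mono) auto
            finally have "E.Phi r \<le> C * (2 * (N * ln r) - 2 * E.us r) + 4 * (N * ln r)" using us by linarith
            hence "E.Phi r \<le> (p + 4) * N * ln r + p * (- E.us r)" by (simp add: p_def algebra_simps)
            hence "3/4 * E.Phi r \<le> p * (- E.us r)" using Nln Ppos by linarith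
            hence "3/4 \<le> p * (- E.us r / E.Phi r)"
              using Ppos by (simp only: pos_le_divide_eq times_divide_eq_right)
            thus ?thesis using R0 by linarith
          next
            \<comment> \<open>All points lie in one short arc: \<open>Af\<close> contributes at
              least 4/5 and \<open>F\<close> loses at most 1/20, which is exactly 3/4. The value 4/5
              is \<open>21/25\<close> divided by \<open>21/20\<close>.\<close>
            case False
            have "real (B.nf r) \<le> 2 * 1 + 8 * \<delta>c * zero_free_circle.J b r + 60 * sqrt \<delta>c * zero_free_circle.W b r"
              unfolding B.nf_def
              by (rule zero_free_circle.count_bound[OF z \<zeta>(1), of \<delta>c 1])
                 (use r JW False in \<open>auto simp: circle_sums_eq[OF z] G_def not_less \<delta>c_def\<close>)
            hence "real (B.nf r) \<le> 2 + B.Jf r / 100 + B.Wf r / 80"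
              unfolding sqrt_\<delta>c using B.Wf_nonneg[OF r0] J by (simp add: \<delta>c_def circle_sums_eq[OF z])
            hence "21/25 * B.Jf r \<le> B.Jf r - real (B.nf r) + B.Wf r / 80" using J by linarith
            moreover have "4/5 * B.Af r \<le> 21/25 * B.Jf r" using B.Af_bounds(2)[OF r0] by linarith
            ultimately have "4/5 * B.Af r \<le> B.Jf r - real (B.nf r) + B.Wf r / 80" by linarith
            hence R: "4/5 \<le> ?R" using Apos by (simp add: pos_le_divide_eq)
            have "20 * (p * E.us r) \<le> 20 * (p * (N * ln r))" using us p by simp
            also have "\<dots> \<le> 20 * (p + 4) * N * ln r" using p N lnr by (simp add: algebra_simps)
            also note Nln
            finally have "- (1/20) * E.Phi r \<le> p * (- E.us r)" by simp
            hence "- (1/20) \<le> p * (- E.us r / E.Phi r)"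
              using Ppos by (simp only: pos_le_divide_eq times_divide_eq_right)
            thus ?thesis using R by linarith
          qed
        qed
      qed
      thus "2 * C * (- E.us r / E.Phi r) + ?R \<ge> 3/4" by (simp add: p_def)
    qed
  qed
qed

text \<open>Here \<open>h\<close> is \<open>2 * C * ln F\<close>.
  \<open>Phi = O (r powr \<sigma>)\<close> bounds it by
  \<open>2 * C * (\<sigma> - 1/2) * ln r\<close> up to a constant, small against the forced growth
  when \<open>\<sigma>\<close> is close to 1/2.\<close>

lemma contradiction:
  assumes C: "C > 0" "\<And>x. x > 0 \<Longrightarrow> x \<noteq> 1 \<Longrightarrow> \<phi> x \<le> C * dgain \<delta>c x + 4 * ln \<bar>1 - x\<bar>"
    and s: "2 * C * (\<sigma> - 1/2) + \<sigma> < 7/10"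
  shows False
proof (cases "finite {k. e k \<noteq> 0}")
  case True
  thus False by (rule rational_case)
next
  case infE: False
  have iE: "infinite {k. norm (e k) \<noteq> 0}" using infE by simp
  note key = key_inequality[OF infE C(1)]
  have Pp: "eventually (\<lambda>r. E.Phi r > 0 \<and> r > 1) at_top"
    using E.Phi_large[OF iE, of 1] eventually_gt_at_top[of 1]
    by eventually_elim (smt (verit) ln_gt_zero)
  define h where "h r = 2 * C * (ln (E.Phi r) - ln r / 2)" for r
  show False
  proof (rule final_contradiction[of "E.exc" h "2 * C * ln (8 * E.C\<sigma>)" "2 * C * (\<sigma> - 1/2)"])
    show "finite (E.exc \<inter> {a..b})" if "a > 0" for a b by (rule E.finite_exc[OF that])
    show "eventually (isCont h) at_top"
      using Pp
    proof eventually_elim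
      case (elim r)
      thus ?case unfolding h_def[abs_def] using E.Phi_cont[of r]
        by (intro continuous_intros) auto
    qed
    show "eventually (\<lambda>r. r \<notin> B.exc \<union> E.exc \<longrightarrow> (\<exists>y. (h has_field_derivative y) (at r) \<and>
       r * y + (B.Jf r - real (B.nf r) + B.Wf r / 80) / B.Af r \<ge> 3/4)) at_top"
    proof -
      have "eventually (\<lambda>r. r \<notin> B.exc \<union> E.exc \<longrightarrow> E.Phi r > 0 \<and>
         2 * C * (- E.us r / E.Phi r) + (B.Jf r - real (B.nf r) + B.Wf r / 80) / B.Af r \<ge> 3/4) at_top"
        by (rule key) (rule C(2))
      thus ?thesis using Pp
      proof eventually_elim
        case (elim r)
        show ?case
        proof
          assume ex: "r \<notin> B.exc \<union> E.exc"
          have r0: "r > 0" using elim by simp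
          have Ppos: "E.Phi r > 0" using elim by simp
          obtain D where D: "(E.Phi has_field_derivative D) (at r)" "r * D = E.Phi r / 2 - E.us r"
            using E.Phi_deriv[OF r0] ex by auto
          have lnP: "((\<lambda>r. ln (E.Phi r)) has_field_derivative (1 / E.Phi r * D)) (at r)"
            by (rule DERIV_chain2[OF DERIV_ln_divide[OF Ppos] D(1)])
          have "(h has_field_derivative 2 * C * (1 / E.Phi r * D - 1 / r / 2)) (at r)"
            unfolding h_def[abs_def]
            by (intro DERIV_cmult DERIV_diff lnP DERIV_cdivide DERIV_ln_divide r0)
          moreover have "r * (2 * C * (1 / E.Phi r * D - 1 / r / 2)) = 2 * C * (- E.us r / E.Phi r)"
          proof -
            have "r * (2 * C * (1 / E.Phi r * D - 1 / r / 2)) = 2 * C * ((r * D) / E.Phi r - 1/2)"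
              using r0 by (simp add: field_simps)
            also have "(r * D) / E.Phi r - 1/2 = - E.us r / E.Phi r"
              unfolding D(2) using Ppos by (simp add: field_simps)
            finally show ?thesis .
          qed
          ultimately show "\<exists>y. (h has_field_derivative y) (at r) \<and>
             r * y + (B.Jf r - real (B.nf r) + B.Wf r / 80) / B.Af r \<ge> 3/4"
            using elim(1) ex by (intro exI[of _ "2 * C * (1 / E.Phi r * D - 1 / r / 2)"]) auto
        qed
      qed
    qed
    show "eventually (\<lambda>r. h r \<le> 2 * C * ln (8 * E.C\<sigma>) + 2 * C * (\<sigma> - 1/2) * ln r) at_top"
      using Pp
    proof eventually_elim
      case (elim r)
      have r0: "r > 0" using elim by simp
      have "0 < 8 * (r powr \<sigma> * E.C\<sigma>)" using elim E.Phi_le[OF r0] by linarith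
      hence C0: "E.C\<sigma> > 0" using r0 by (simp add: zero_less_mult_iff)
      have "ln (E.Phi r) \<le> ln (8 * (r powr \<sigma> * E.C\<sigma>))" using elim E.Phi_le[OF r0] by (intro ln_mono) auto
      also have "8 * (r powr \<sigma> * E.C\<sigma>) = (8 * E.C\<sigma>) * r powr \<sigma>" by simp
      also have "ln \<dots> = ln (8 * E.C\<sigma>) + \<sigma> * ln r"
        using C0 r0 by (subst ln_mult) (auto simp: ln_powr)
      finally have "2 * C * (ln (E.Phi r) - ln r / 2) \<le> 2 * C * (ln (8 * E.C\<sigma>) + \<sigma> * ln r - ln r / 2)"
        using C(1) by (intro mult_left_mono) auto
      thus ?case by (simp add: h_def algebra_simps)
    qed
    show "2 * C * (\<sigma> - 1/2) + \<sigma> < 7/10" by (rule s)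
  qed
qed

end

section \<open>The theorem\<close>

lemma growth_of_order:
  assumes hol: "f holomorphic_on UNIV" and ord: "entire_order f < ereal c" and c: "c > 1/4"
  obtains \<rho> where "0 < \<rho>" "\<rho> < c" "growth \<rho> f"
proof -
  obtain \<rho>0 where \<rho>0: "entire_order f < ereal \<rho>0" "\<rho>0 < c"
    using ereal_dense2[OF ord] by auto
  \<comment> \<open>The order may be 0 or even minus infinity, but the later estimates need a
    positive exponent; 1/4 is allowed because it lies below \<open>c\<close>.\<close>
  define \<rho> where "\<rho> = max \<rho>0 (1/4)"
  have \<rho>: "0 < \<rho>" "\<rho> < c" "\<rho>0 \<le> \<rho>" using \<rho>0 c by (auto simp: \<rho>_def)
  have le_M: "norm (f z) \<le> max_modulus f (norm z)" for z
  proof -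
    have "compact ((\<lambda>z. norm (f z)) ` sphere 0 (norm z))"
      by (intro compact_continuous_image continuous_intros holomorphic_on_imp_continuous_on
          holomorphic_on_subset[OF hol]) auto
    hence "bdd_above ((\<lambda>z. norm (f z)) ` sphere 0 (norm z))"
      by (intro bounded_imp_bdd_above compact_imp_bounded)
    thus ?thesis unfolding max_modulus_def by (intro cSup_upper) auto
  qed
  have "eventually (\<lambda>r. ereal (ln (ln (max_modulus f r)) / ln r) < ereal \<rho>0) at_top"
    using \<rho>0(1) unfolding entire_order_def by (rule Limsup_lessD)
  moreover have "eventually (\<lambda>r::real. r > 1) at_top" by (rule eventually_gt_at_top)
  ultimately have "eventually (\<lambda>r. \<forall>z. norm z = r \<longrightarrow> norm (f z) \<le> exp (r powr \<rho>)) at_top"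
  proof eventually_elim
    case (elim r)
    have lr: "ln r > 0" using elim by simp
    define M where "M = max_modulus f r"
    have "M \<le> exp (r powr \<rho>)"
    \<comment> \<open>The iterated logarithm says nothing about \<open>M\<close> unless
      \<open>ln M\<close> is positive; otherwise \<open>M \<le> 1\<close> is enough.\<close>
    proof (cases "ln M > 0 \<and> M > 0")
      case False
      have "M \<le> 1 \<or> M \<le> 0" using False by (metis ln_gt_zero not_le less_eq_real_def less_trans zero_less_one)
      moreover have "exp (r powr \<rho>) \<ge> 1" by simp
      ultimately show ?thesis by linarith
    next
      case True
      have "ln (ln M) / ln r < \<rho>0" using elim by (simp add: M_def)
      hence "ln (ln M) < \<rho>0 * ln r" using lr by (simp add: field_simps)
      also have "\<dots> \<le> \<rho> * ln r" using \<rho> lr by simp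
      finally have "exp (ln (ln M)) < exp (\<rho> * ln r)" by simp
      hence "ln M < r powr \<rho>" using True elim by (simp add: powr_def)
      hence "exp (ln M) < exp (r powr \<rho>)" by simp
      thus ?thesis using True by simp
    qed
    thus ?case using le_M by (metis M_def order_trans)
  qed
  then obtain R where R: "\<And>z. norm z \<ge> R \<Longrightarrow> norm (f z) \<le> exp (norm z powr \<rho>)"
    unfolding eventually_at_top_linorder by blast
  have "compact (f ` cball 0 R)"
    by (intro compact_continuous_image holomorphic_on_imp_continuous_on holomorphic_on_subset[OF hol]) auto
  then obtain B where B: "B > 0" "\<And>z. norm z \<le> R \<Longrightarrow> norm (f z) \<le> B"
    using compact_imp_bounded bounded_pos by (metis imageI mem_cball_0)
  define C where "C = 1 + \<bar>ln B\<bar>"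
  have "norm (f z) \<le> exp (C * (1 + norm z) powr \<rho>)" for z
  proof (cases "norm z \<ge> R")
    case True
    have "norm z powr \<rho> \<le> (1 + norm z) powr \<rho>" using \<rho> by (intro powr_mono2) auto
    also have "\<dots> = 1 * (1 + norm z) powr \<rho>" by simp
    also have "\<dots> \<le> C * (1 + norm z) powr \<rho>" by (intro mult_right_mono) (auto simp: C_def)
    finally show ?thesis using R[OF True] by (meson exp_le_cancel_iff order_trans)
  next
    case False
    have "norm (f z) \<le> exp (ln B)" using B False by simp
    also have "ln B \<le> C * 1" by (simp add: C_def)
    also have "C * 1 \<le> C * (1 + norm z) powr \<rho>"
      using \<rho> by (intro mult_left_mono ge_one_powr_ge_zero) (auto simp: C_def)
    finally show ?thesis by simp
  qed
  hence "growth \<rho> f" unfolding growth_def by (intro exI[of _ C]) (auto simp: C_def)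
  thus thesis using that \<rho> by blast
qed

lemma growth_shift:
  assumes "growth \<rho> f" "\<rho> > 0"
  shows "growth \<rho> (\<lambda>z. f (z + a))"
proof -
  obtain C where C: "C > 0" "\<And>z. norm (f z) \<le> exp (C * (1 + norm z) powr \<rho>)"
    using assms by (auto simp: growth_def)
  have "norm (f (z + a)) \<le> exp ((C * (1 + norm a) powr \<rho>) * (1 + norm z) powr \<rho>)" for z
  proof -
    have "1 + norm (z + a) \<le> 1 + norm z + norm a" using norm_triangle_ineq[of z a] by simp
    also have "\<dots> \<le> (1 + norm a) * (1 + norm z)" by (simp add: algebra_simps)
    finally have "(1 + norm (z + a)) powr \<rho> \<le> ((1 + norm a) * (1 + norm z)) powr \<rho>"
      using assms(2) by (intro powr_mono2) auto
    also have "\<dots> = (1 + norm a) powr \<rho> * (1 + norm z) powr \<rho>" by (rule powr_mult)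
    finally have "C * (1 + norm (z + a)) powr \<rho> \<le> C * (1 + norm a) powr \<rho> * (1 + norm z) powr \<rho>"
      using C(1) by (simp add: mult.assoc)
    thus ?thesis using C(2)[of "z + a"] by (meson exp_le_cancel_iff order_trans)
  qed
  moreover have "1 + norm a > 0" by (simp add: add_pos_nonneg)
  hence "C * (1 + norm a) powr \<rho> > 0" using C(1) by simp
  ultimately show ?thesis unfolding growth_def by blast
qed

lemma growth_diff:
  assumes "growth \<rho> f" "growth \<rho> g" "\<rho> > 0"
  shows "growth \<rho> (\<lambda>z. f z - g z)"
proof -
  obtain C where C: "C > 0" "\<And>z. norm (f z) \<le> exp (C * (1 + norm z) powr \<rho>)"
    using assms by (auto simp: growth_def)
  obtain D where D: "D > 0" "\<And>z. norm (g z) \<le> exp (D * (1 + norm z) powr \<rho>)"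
    using assms by (auto simp: growth_def)
  have "norm (f z - g z) \<le> exp ((C + D + 1) * (1 + norm z) powr \<rho>)" for z
  proof -
    define t where "t = (1 + norm z) powr \<rho>"
    have t: "t \<ge> 1" unfolding t_def using assms by (intro ge_one_powr_ge_zero) auto
    have "norm (f z - g z) \<le> exp (C * t) + exp (D * t)"
      using norm_triangle_ineq4[of "f z" "g z"] C(2)[of z] D(2)[of z] by (simp add: t_def)
    also have "\<dots> \<le> exp ((C + D) * t) + exp ((C + D) * t)"
      using C D t by (intro add_mono) (auto simp: mult_right_mono)
    also have "\<dots> = 2 * exp ((C + D) * t)" by simp
    also have "2 \<le> exp t" using t exp_ge_add_one_self[of t] by linarith
    hence "2 * exp ((C + D) * t) \<le> exp t * exp ((C + D) * t)" by (intro mult_right_mono) auto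
    also have "\<dots> = exp ((C + D + 1) * t)" by (simp add: exp_add[symmetric] algebra_simps)
    finally show ?thesis by (simp add: t_def)
  qed
  thus ?thesis unfolding growth_def using C(1) D(1) by (intro exI[of _ "C + D + 1"]) auto
qed

section \<open>Multiplicities and the simultaneous listing of zeros\<close>

lemma zero_order_facts:
  assumes hol: "g holomorphic_on UNIV" and g0: "g 0 \<noteq> 0"
  shows zorder_entire_nonneg: "zorder g z \<ge> 0"
    and zorder_entire_eq_0: "zorder g z = 0 \<longleftrightarrow> g z \<noteq> 0"
    and entire_countable_zeros: "countable {z. g z = 0}"
proof -
  have ev: "eventually (\<lambda>w. g w \<noteq> 0) (at z)" for z
    using non_zero_neighbour_alt[of g UNIV z 0] hol g0 by auto
  have an: "g analytic_on {z}" using hol by (auto simp: analytic_at)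
  show "zorder g z \<ge> 0" by (rule zorder_ge_0[OF an eventually_frequently[OF _ ev]]) simp
  show "zorder g z = 0 \<longleftrightarrow> g z \<noteq> 0" by (rule zorder_eq_0_iff[OF an eventually_frequently[OF _ ev]]) simp
  show "countable {z. g z = 0}"
    using holomorphic_countable_equal_UNIV[OF hol, of "\<lambda>_. 0"] g0 by auto
qed

text \<open>Enumerating the pairs of a point and an index below the larger multiplicity lists both
  zero multisets at once, so that common zeros occupy common positions.\<close>
lemma common_enumeration:
  fixes m1 m2 :: "complex \<Rightarrow> nat"
  assumes cnt: "countable {z. m1 z > 0 \<or> m2 z > 0}" and zero: "m1 0 = 0" "m2 0 = 0"
    and fin: "finite {z. m2 z > m1 z}"
  obtains b1 b2 :: "nat \<Rightarrow> complex" where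
    "\<And>w. w \<noteq> 0 \<Longrightarrow> finite {k. b1 k = w} \<and> card {k. b1 k = w} = m1 (1 / w)"
    "\<And>w. w \<noteq> 0 \<Longrightarrow> finite {k. b2 k = w} \<and> card {k. b2 k = w} = m2 (1 / w)"
    "\<And>k. b2 k \<noteq> 0 \<Longrightarrow> b1 k \<noteq> 0 \<Longrightarrow> b2 k = b1 k"
    "finite {k. b2 k \<noteq> 0 \<and> b1 k = 0}"
proof -
  define I where "I = {(z, j). j < max (m1 z) (m2 z)}"
  have "I \<subseteq> {z. m1 z > 0 \<or> m2 z > 0} \<times> UNIV" by (auto simp: I_def)
  hence cI: "countable I" by (rule countable_subset) (use cnt in auto)
  define t where "t = to_nat_on I"
  define s where "s = inv_into I t"
  have inj: "inj_on t I" unfolding t_def by (rule inj_on_to_nat_on[OF cI])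
  have st: "s (t x) = x" if "x \<in> I" for x using inv_into_f_f[OF inj that] by (simp add: s_def)
  define B where "B m k = (if k \<in> t ` I \<and> snd (s k) < m (fst (s k)) then 1 / fst (s k) else 0)" for m :: "complex \<Rightarrow> nat" and k
  have fib: "finite {k. B m k = w} \<and> card {k. B m k = w} = m (1 / w)"
    if w: "w \<noteq> 0" and m: "\<And>z. m z \<le> max (m1 z) (m2 z)" for m w
  proof -
    have sub: "{1 / w} \<times> {..<m (1 / w)} \<subseteq> I" using m[of "1 / w"] by (auto simp: I_def)
    have eq: "{k. B m k = w} = t ` ({1 / w} \<times> {..<m (1 / w)})"
    proof (intro equalityI subsetI)
      fix k assume "k \<in> {k. B m k = w}"
      hence k: "k \<in> t ` I" "snd (s k) < m (fst (s k))" "1 / fst (s k) = w"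
        using w by (auto simp: B_def split: if_splits)
      then obtain x where x: "x \<in> I" "k = t x" by auto
      have sx: "s k = x" using st x by simp
      have "fst x = 1 / w" using k(3) w by (auto simp: sx)
      hence "x \<in> {1 / w} \<times> {..<m (1 / w)}" using k(2) by (cases x) (auto simp: sx)
      thus "k \<in> t ` ({1 / w} \<times> {..<m (1 / w)})" using x by blast
    next
      fix k assume "k \<in> t ` ({1 / w} \<times> {..<m (1 / w)})"
      then obtain j where j: "j < m (1 / w)" "k = t (1 / w, j)" by auto
      have "(1 / w, j) \<in> I" using sub j by auto
      thus "k \<in> {k. B m k = w}" using j w by (simp add: B_def st)
    qed
    have "inj_on t ({1 / w} \<times> {..<m (1 / w)})" using inj sub by (rule inj_on_subset)
    thus ?thesis unfolding eq by (simp add: card_image card_cartesian_product)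
  qed
  show thesis
  proof (rule that[of "B m1" "B m2"])
    show "B m2 k = B m1 k" if "B m2 k \<noteq> 0" "B m1 k \<noteq> 0" for k
      using that by (auto simp: B_def split: if_splits)
    have "{k. B m2 k \<noteq> 0 \<and> B m1 k = 0} \<subseteq> t ` (SIGMA z:{z. m2 z > m1 z}. {..<m2 z})"
    proof
      fix k assume "k \<in> {k. B m2 k \<noteq> 0 \<and> B m1 k = 0}"
      hence k: "B m2 k \<noteq> 0" "B m1 k = 0" by auto
      from k(1) have k1: "k \<in> t ` I" "snd (s k) < m2 (fst (s k))" "fst (s k) \<noteq> 0"
        by (auto simp: B_def split: if_splits)
      with k(2) have k2: "\<not> snd (s k) < m1 (fst (s k))" by (auto simp: B_def split: if_splits)
      obtain x where x: "x \<in> I" "k = t x" using k1 by auto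
      have "s k = x" using st x by simp
      hence "x \<in> (SIGMA z:{z. m2 z > m1 z}. {..<m2 z})" using k1 k2 by (cases x) auto
      thus "k \<in> t ` (SIGMA z:{z. m2 z > m1 z}. {..<m2 z})" using x by blast
    qed
    thus "finite {k. B m2 k \<noteq> 0 \<and> B m1 k = 0}"
      by (rule finite_subset) (use fin in auto)
  qed (use fib in auto)
qed

text \<open>The quotient has positive order, so its Laurent expansion has no constant term. This
  detects zeros of the quotient at common zeros too, where its pointwise value carries no
  information.\<close>

lemma quotient_tendsto_0:
  assumes hol: "g holomorphic_on UNIV" "d holomorphic_on UNIV" and nz: "g 0 \<noteq> 0" "d 0 \<noteq> 0"
    and zo: "zorder d z > zorder g z"
  shows "((\<lambda>w. d w / g w) \<longlongrightarrow> 0) (at z)"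
proof -
  have ev: "eventually (\<lambda>w. h w \<noteq> 0) (at z)" if "h holomorphic_on UNIV" "h 0 \<noteq> 0" for h :: "complex \<Rightarrow> complex"
    using non_zero_neighbour_alt[of h UNIV z 0] that by auto
  have exp: "(\<lambda>w. h (z + w)) has_laurent_expansion fps_to_fls (fps_expansion h z)" if "h holomorphic_on UNIV" for h
    by (intro has_laurent_expansion_fps analytic_at_imp_has_fps_expansion) (use that in \<open>auto simp: analytic_at\<close>)
  define F where "F = fps_to_fls (fps_expansion d z) / fps_to_fls (fps_expansion g z)"
  have F: "(\<lambda>w. d (z + w) / g (z + w)) has_laurent_expansion F"
    unfolding F_def by (intro has_laurent_expansion_divide exp hol)
  have mer: "h meromorphic_on {z}" if "h holomorphic_on UNIV" for h
    using that by (intro analytic_on_imp_meromorphic_on) (auto simp: analytic_at)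
  have zq: "zorder (\<lambda>w. d w / g w) z = zorder d z - zorder g z"
    by (rule zorder_divide) (use mer hol ev nz in \<open>auto intro!: eventually_frequently\<close>)
  have "((\<lambda>w. d (z + w) / g (z + w)) \<longlongrightarrow> 0) (at 0)"
  proof (cases "F = 0")
    case True
    thus ?thesis using has_laurent_expansion_imp_tendsto_0[OF F] by simp
  next
    case False
    have "zorder (\<lambda>w. d w / g w) z = fls_subdegree F"
      by (rule has_laurent_expansion_zorder[OF F False])
    hence "fls_subdegree F > 0" using zq zo by simp
    hence "fls_nth F 0 = 0" "fls_subdegree F \<ge> 0" by auto
    thus ?thesis using has_laurent_expansion_imp_tendsto_0[OF F] by simp
  qed
  thus ?thesis by (subst at_to_0) (simp add: filterlim_filtermap add.commute)
qed

lemma zero_seq_product: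
  assumes hol: "g holomorphic_on UNIV" and g0: "g 0 \<noteq> 0" and b: "zero_seq g b"
    and gr: "growth \<rho> g" and \<rho>: "0 < \<rho>" "\<rho> < \<sigma>" and \<sigma>: "1/2 \<le> \<sigma>" "\<sigma> < 3/5"
  shows "summable (\<lambda>k. norm (b k) powr \<sigma>)"
    and "(\<lambda>n. \<Prod>k<n. 1 - b k * z) \<longlonglongrightarrow> g z / g 0"
    and "g w = 0 \<Longrightarrow> \<exists>k. b k * w = 1"
proof -
  obtain C where C: "C > 0" "\<And>R. R > 0 \<Longrightarrow> real (card {k. norm (b k) \<ge> 1 / R}) \<le> C * (1 + R) powr \<rho>"
    using zero_count_bound[OF hol g0 b gr \<rho>(1)] by blast
  show s: "summable (\<lambda>k. norm (b k) powr \<sigma>)"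
    by (rule summable_powr_from_count[OF zero_seq_finite[OF hol g0 b] C(2) \<rho>])
  interpret zero_weights "\<lambda>k. norm (b k)" \<sigma> by unfold_locales (use \<sigma> s in auto)
  show "(\<lambda>n. \<Prod>k<n. 1 - b k * z) \<longlonglongrightarrow> g z / g 0"
    by (rule hadamard_product[OF hol g0 b gr \<rho>(1) _ sm]) (use \<rho> \<sigma> in simp)
  assume w: "g w = 0"
  hence w0: "w \<noteq> 0" using g0 by auto
  have "zorder g w \<noteq> 0" using zorder_entire_eq_0[OF hol g0, of w] w by simp
  hence "card {k. b k = 1 / w} \<noteq> 0" using b w0 unfolding zero_seq_def by (metis div_by_1 divide_divide_eq_right divide_eq_0_iff mult_1 of_nat_0 zero_neq_one)
  hence "{k. b k = 1 / w} \<noteq> {}" by (metis card.empty)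
  then obtain k where "b k = 1 / w" by blast
  thus "\<exists>k. b k * w = 1" using w0 by (intro exI[of _ k]) simp
qed

text \<open>In genus 0 an entire function with finitely many zeros is its finite product, so a
  transcendental one has infinitely many.\<close>

lemma finite_product_polynomial:
  assumes lim: "\<And>z. (\<lambda>n. \<Prod>k<n. 1 - b k * z) \<longlonglongrightarrow> g z / g 0" and g0: "g 0 \<noteq> (0 :: complex)"
    and fin: "finite {k. b k \<noteq> 0}"
  obtains p where "\<And>z. g z = poly p z"
proof -
  define F where "F = {k. b k \<noteq> 0}"
  obtain N where N: "F \<subseteq> {..<N}" using fin finite_nat_iff_bounded by (auto simp: F_def)
  have "g z = poly (smult (g 0) (\<Prod>k\<in>F. [:1, - b k:])) z" for z
  proof -
    have "(\<Prod>k<n. 1 - b k * z) = (\<Prod>k\<in>F. 1 - b k * z)" if "n \<ge> N" for n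
      using N that by (intro prod.mono_neutral_right) (auto simp: F_def)
    hence "(\<lambda>n. \<Prod>k<n. 1 - b k * z) \<longlonglongrightarrow> (\<Prod>k\<in>F. 1 - b k * z)"
      by (intro tendsto_eventually) (auto simp: eventually_sequentially)
    hence "g z / g 0 = (\<Prod>k\<in>F. 1 - b k * z)" using lim LIMSEQ_unique by blast
    thus ?thesis using g0 by (simp add: poly_prod field_simps)
  qed
  thus thesis using that by blast
qed

theorem theorem1p3:
  shows "\<exists>\<delta>0::real. 0 < \<delta>0 \<and> \<delta>0 < 1/2 \<and>
    (\<forall>f. transcendental_entire f \<and> entire_order f < ereal (1/2 + \<delta>0) \<longrightarrow>
       infinite (mero_zeros (\<lambda>z. (f (z + 1) - f z) / f z)))"
proof -
  obtain C where C: "C > 0" "\<And>x. x > 0 \<Longrightarrow> x \<noteq> 1 \<Longrightarrow>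
      \<phi> x \<le> C * dgain (1 / 10 ^ 8) x + 4 * ln \<bar>1 - x\<bar>"
    using phi_le_dgain[of "1 / 10 ^ 8"] by auto
  \<comment> \<open>Chosen so that \<open>(2 * C + 1) * \<delta>0 = 1/20\<close>: for
    \<open>\<sigma> < 1/2 + \<delta>0\<close> the exponent
    \<open>2 * C * (\<sigma> - 1/2) + \<sigma>\<close> stays below 11/20, hence below 7/10, and
    \<open>\<sigma> < 3/5\<close>.\<close>
  define \<delta>0 where "\<delta>0 = 1 / (20 * (2 * C + 1))"
  have \<delta>0: "0 < \<delta>0" "\<delta>0 < 1/20" "2 * C * \<delta>0 + \<delta>0 = 1/20"
    using C(1) by (auto simp: \<delta>0_def field_simps)
  have "infinite (mero_zeros (\<lambda>z. (f (z + 1) - f z) / f z))"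
    if tr: "transcendental_entire f" and ord: "entire_order f < ereal (1/2 + \<delta>0)" for f
  proof
    assume fin: "finite (mero_zeros (\<lambda>z. (f (z + 1) - f z) / f z))"
    have hol: "f holomorphic_on UNIV" and np: "\<nexists>p. \<forall>z. f z = poly p z"
      using tr by (auto simp: transcendental_entire_def)
    obtain \<rho> where \<rho>: "0 < \<rho>" "\<rho> < 1/2 + \<delta>0" "growth \<rho> f"
      by (rule growth_of_order[OF hol ord]) (use \<delta>0 in auto)
    have hol': "(\<lambda>z. f (z + a)) holomorphic_on UNIV" for a
      by (rule holomorphic_on_compose_gen[of "\<lambda>z. z + a" UNIV f UNIV, unfolded o_def])
         (use hol in \<open>auto intro!: holomorphic_intros\<close>)
    \<comment> \<open>The products are normalised at 0, so the origin is moved to a point where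
      neither \<open>f\<close> nor its difference vanishes. If the difference vanished identically,
      every point would be a zero of the quotient.\<close>
    obtain z0 where z0: "f z0 \<noteq> 0" "f (z0 + 1) \<noteq> f z0"
    proof -
      have "\<exists>z1. f (z1 + 1) \<noteq> f z1"
      proof (rule ccontr)
        assume "\<nexists>z1. f (z1 + 1) \<noteq> f z1"
        hence "mero_zeros (\<lambda>z. (f (z + 1) - f z) / f z) = UNIV" by (auto simp: mero_zeros_def)
        thus False using fin infinite_UNIV_char_0 by metis
      qed
      then obtain z1 where z1: "f (z1 + 1) - f z1 \<noteq> 0" by auto
      have "\<exists>z2. f z2 \<noteq> 0"
      proof (rule ccontr)
        assume "\<nexists>z2. f z2 \<noteq> 0"
        hence "\<forall>z. f z = poly 0 z" by simp
        thus False using np by blast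
      qed
      then obtain z2 where z2: "f z2 \<noteq> 0" by auto
      have h2: "(\<lambda>z. f (z + 1) - f z) holomorphic_on UNIV" by (intro holomorphic_intros hol hol')
      have "eventually (\<lambda>z. f z \<noteq> 0) (at z1)"
        using non_zero_neighbour_alt[of f UNIV z1 z2] hol z2 by auto
      moreover have "eventually (\<lambda>z. f (z + 1) - f z \<noteq> 0) (at z1)"
        using non_zero_neighbour_alt[OF h2, of z1 z1] z1 by auto
      ultimately have "eventually (\<lambda>z. f z \<noteq> 0 \<and> f (z + 1) - f z \<noteq> 0) (at z1)" by eventually_elim auto
      hence "\<exists>z. f z \<noteq> 0 \<and> f (z + 1) - f z \<noteq> 0" using eventually_happens' at_neq_bot by blast
      thus thesis using that by auto
    qed
    define g where "g z = f (z + z0)" for z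
    define d where "d z = g (z + 1) - g z" for z
    have g: "g holomorphic_on UNIV" "growth \<rho> g" "g 0 \<noteq> 0"
      using hol' growth_shift[OF \<rho>(3,1)] z0 by (auto simp: g_def[abs_def])
    have g1: "(\<lambda>z. g (z + 1)) holomorphic_on UNIV"
      unfolding g_def using hol'[of "1 + z0"] by (simp add: add_ac)
    have d: "d holomorphic_on UNIV" "growth \<rho> d" "d 0 \<noteq> 0"
    proof -
      show "d holomorphic_on UNIV" unfolding d_def[abs_def] by (rule holomorphic_on_diff[OF g1 g(1)])
      show "growth \<rho> d"
        unfolding d_def[abs_def] by (rule growth_diff[OF growth_shift[OF g(2) \<rho>(1)] g(2) \<rho>(1)])
      show "d 0 \<noteq> 0" using z0 by (simp add: d_def g_def add.commute)
    qed
    define m where "m h z = nat (zorder h z)" for h and z :: complex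
    \<comment> \<open>Excess multiplicity of the difference over \<open>g\<close> at
      \<open>z\<close> makes the quotient tend to 0 there, hence gives a zero of the original
      quotient at \<open>z + z0\<close>.\<close>
    have fz: "finite {z. m d z > m g z}"
    proof (rule finite_subset)
      show "{z. m d z > m g z} \<subseteq> (\<lambda>z. z - z0) ` mero_zeros (\<lambda>z. (f (z + 1) - f z) / f z)"
      proof
        fix z assume "z \<in> {z. m d z > m g z}"
        hence "zorder d z > zorder g z" by (auto simp: m_def)
        hence "((\<lambda>w. d w / g w) \<longlongrightarrow> 0) (at z)"
          by (rule quotient_tendsto_0[OF g(1) d(1) g(3) d(3)])
        from LIM_offset[OF this, of "- z0"]
        have "z + z0 \<in> mero_zeros (\<lambda>z. (f (z + 1) - f z) / f z)"
          by (simp add: mero_zeros_def d_def g_def algebra_simps)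
        thus "z \<in> (\<lambda>z. z - z0) ` mero_zeros (\<lambda>z. (f (z + 1) - f z) / f z)"
          by (intro image_eqI[of _ _ "z + z0"]) auto
      qed
    qed (use fin in auto)
    have m_pos: "m h z > 0 \<longleftrightarrow> h z = 0" if "h holomorphic_on UNIV" "h 0 \<noteq> 0" for h z
      using zorder_entire_nonneg[OF that, of z] zorder_entire_eq_0[OF that, of z] by (auto simp: m_def)
    have cnt: "countable {z. m g z > 0 \<or> m d z > 0}"
    proof -
      have "{z. m g z > 0 \<or> m d z > 0} = {z. g z = 0} \<union> {z. d z = 0}"
        using m_pos[OF g(1,3)] m_pos[OF d(1,3)] by auto
      thus ?thesis using entire_countable_zeros[OF g(1,3)] entire_countable_zeros[OF d(1,3)] by auto
    qed
    have m0: "m g 0 = 0" "m d 0 = 0" using m_pos[OF g(1,3), of 0] m_pos[OF d(1,3), of 0] g(3) d(3) by auto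
    obtain b b' :: "nat \<Rightarrow> complex" where b: "\<And>w. w \<noteq> 0 \<Longrightarrow> finite {k. b k = w} \<and> card {k. b k = w} = m g (1 / w)"
      and b': "\<And>w. w \<noteq> 0 \<Longrightarrow> finite {k. b' k = w} \<and> card {k. b' k = w} = m d (1 / w)"
      and agree: "\<And>k. b' k \<noteq> 0 \<Longrightarrow> b k \<noteq> 0 \<Longrightarrow> b' k = b k"
      and finb: "finite {k. b' k \<noteq> 0 \<and> b k = 0}"
      by (rule common_enumeration[OF cnt m0 fz], rule that)
    have zs: "zero_seq g b" "zero_seq d b'"
      unfolding zero_seq_def using b b' zorder_entire_nonneg[OF g(1,3)] zorder_entire_nonneg[OF d(1,3)]
      by (auto simp: m_def)
    \<comment> \<open>The midpoint leaves room on both sides: above \<open>\<rho>\<close>, for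
      convergence of the \<open>\<sigma>\<close>-th powers, and strictly below
      \<open>1/2 + \<delta>0\<close>.\<close>
    define \<sigma> where "\<sigma> = (max \<rho> (1/2) + (1/2 + \<delta>0)) / 2"
    have \<sigma>: "\<rho> < \<sigma>" "1/2 \<le> \<sigma>" "\<sigma> < 1/2 + \<delta>0" using \<rho> \<delta>0 by (auto simp: \<sigma>_def max_def)
    have \<sigma>': "\<sigma> < 3/5" using \<sigma> \<delta>0 by linarith
    note gp = zero_seq_product[OF g(1,3) zs(1) g(2) \<rho>(1) \<sigma>(1,2) \<sigma>']
    note dp = zero_seq_product[OF d(1,3) zs(2) d(2) \<rho>(1) \<sigma>(1,2) \<sigma>']
    have infb: "infinite {k. b k \<noteq> 0}"
    proof
      assume "finite {k. b k \<noteq> 0}"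
      then obtain p where p: "\<And>z. g z = poly p z"
        using finite_product_polynomial[OF gp(2) g(3)] by blast
      have "f z = poly (pcompose p [:- z0, 1:]) z" for z
        using p[of "z - z0"] by (simp add: g_def poly_pcompose)
      thus False using np by blast
    qed
    have "2 * C * (\<sigma> - 1/2) \<le> 2 * C * \<delta>0" using C(1) \<sigma> by (intro mult_left_mono) auto
    hence small: "2 * C * (\<sigma> - 1/2) + \<sigma> < 7/10" using \<delta>0 \<sigma> by linarith
    interpret difference_zeros g b b' \<sigma>
    proof
      show "(\<lambda>n. \<Prod>k<n. 1 - b' k * z) \<longlonglongrightarrow> (g (z + 1) - g z) / (g 1 - g 0)" for z
        using dp(2)[of z] by (simp add: d_def)
      show "\<exists>k. b' k * z = 1" if "g (z + 1) = g z" for z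
        using dp(3)[of z] that by (simp add: d_def)
      show "g 1 \<noteq> g 0" using d(3) by (simp add: d_def)
    qed (use \<sigma> \<sigma>' gp g(3) agree finb infb in auto)
    show False
      by (rule contradiction[OF C(1) _ small]) (use C(2) in \<open>simp add: \<delta>c_def\<close>)
  qed
  thus ?thesis using \<delta>0 by (intro exI[of _ \<delta>0]) auto
qed

end
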